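(* Let $Q$ and $R$ be disjoint quivers, let $\mathcal I\subset K\mathcal Q$ and $\mathcal J\subset K\mathcal R$ be two-sided ideals generated by sets of relations $\{\rho_u\}_{u}$ on $Q$ and $\{\sigma_v\}_{v}$ on $R$, and let $M:K\mathcal Q/\mathcal I\otimes_K(K\mathcal R/\mathcal J)^{op}\to \mathrm{mod}\,K$ be a functor. For each $(i,j)\in Q_0\times R_0$ choose a $K$-basis $B(i,j)$ of $M(i,j)$, and let $(R,\mathcal B,Q)$ be the augmented quiver of $R$ and $Q$ by $\mathcal B=\bigcup_{(i,j)}B(i,j)$, and $\mu$ the ideal generated by the set of relations $\mu(R,\mathcal B,Q)$. Then there exists an isomorphism of categories $$F:\ \Lambda=\begin{pmatrix} K\mathcal R/\mathcal J & 0\\ M & K\mathcal Q/\mathcal I\end{pmatrix}\longrightarrow \frac{K(\mathcal R,\mathcal B,\mathcal Q)}{\mathcal I\cup\mathcal J\cup\mu}.$$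
   Context: $K$ is a field; functors between $K$-categories are $K$-linear; $\mathrm{mod}\,K$ is the category of finite-dimensional $K$-vector spaces. A quiver $Q=(Q_0,Q_1,s,t)$ has vertices $Q_0$, arrows $Q_1$, source and target maps $s,t$. The quivers $Q,R$ are assumed strongly locally finite (each vertex is the source and the target of only finitely many arrows, and there are finitely many paths between any two vertices). The path category $K\mathcal Q$ is the additive $K$-category whose objects are finite direct sums of vertices, with morphisms $a\to b$ between vertices having as basis the paths from $a$ to $b$, composition induced by concatenation of paths; compositions are written from right to left below. A relation on $Q$ is a finite $K$-linear combination of paths of length $\ge2$ with common source and common target. $[f]$ denotes the class of $f$ in a quotient category. Tensor product: $\mathcal C\otimes_K\mathcal C'$ has objects the pairs $(p,q)$, morphism spaces $\mathcal C(p_1,p_2)\otimes_K\mathcal C'(q_1,q_2)$, and composition $(f_2\otimes g_2)(f_1\otimes g_1)=f_2f_1\otimes g_2g_1$. Triangular matrix category: given additive $K$-categories $\mathcal T,\mathcal U$ and a functor $M:\mathcal U\otimes_K\mathcal T^{op}\to\mathrm{Mod}\,K$, the category $\begin{pmatrix}\mathcal T&0\\ M&\mathcal U\end{pmatrix}$ has objects the matrices $\begin{pmatrix}T&0\\ M&U\end{pmatrix}$ with $T\in\mathcal T$, $U\in\mathcal U$; a morphism from $\begin{pmatrix}T&0\\ M&U\end{pmatrix}$ to $\begin{pmatrix}T'&0\\ M&U'\end{pmatrix}$ is a matrix $\begin{pmatrix}f&0\\ m&g\end{pmatrix}$ with $f\in\mathcal T(T,T')$, $g\in\mathcal U(U,U')$,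 $m\in M(U',T)$; and composition is $\begin{pmatrix}f_2&0\\ m_2&g_2\end{pmatrix}\begin{pmatrix}f_1&0\\ m_1&g_1\end{pmatrix}=\begin{pmatrix}f_2f_1&0\\ m_2\bullet f_1+g_2\bullet m_1&g_2g_1\end{pmatrix}$, where $m_2\bullet f_1=M(1\otimes f_1^{op})(m_2)$ and $g_2\bullet m_1=M(g_2\otimes1)(m_1)$. Augmented quiver: put $\eta(i,j)=\dim_KM(i,j)$ and $B(i,j)=\{b^{(i,j)}_t\}_{1\le t\le\eta(i,j)}$. For each $(i,j)\in Q_0\times R_0$ let $\overrightarrow B(j,i)=\{\overrightarrow b^{(j,i)}_t\}_{1\le t\le \eta(i,j)}$ be a set of new arrows $\overrightarrow b^{(j,i)}_t:j\to i$, and $\overrightarrow{\mathcal B}=\bigcup\overrightarrow B(j,i)$. The quiver $(R,\mathcal B,Q)$ has vertex set $R_0\cup Q_0$ and arrow set $R_1\cup Q_1\cup\overrightarrow{\mathcal B}$; its path category is $K(\mathcal R,\mathcal B,\mathcal Q)$. $\mathcal I\cup\mathcal J$ denotes the ideal of $K(\mathcal R,\mathcal B,\mathcal Q)$ generated by $\{\rho_u\}\cup\{\sigma_v\}$, viewed as relations on $(R,\mathcal B,Q)$. For $(i,j)\in Q_0\times R_0$ let $\overrightarrow{(-)}:M(i,j)\to \mathrm{Hom}(j,i)$ (Hom in $K(\mathcal R,\mathcal B,\mathcal Q)/(\mathcal I\cup\mathcal J)$) be the $K$-linear map with $b^{(i,j)}_t\mapsto\overrightarrow b^{(j,i)}_t$.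 The set $\mu(R,\mathcal B,Q)$ of relations in $K(\mathcal R,\mathcal B,\mathcal Q)/(\mathcal I\cup\mathcal J)$ consists, for all $(i,j)\in Q_0\times R_0$ and $b\in B(i,j)$, of the elements $[q]\overrightarrow b-\overrightarrow{q\bullet b}$ for $q\in Q_1$ with $s(q)=i$, and $\overrightarrow b[r]-\overrightarrow{b\bullet r}$ for $r\in R_1$ with $t(r)=j$, where $q\bullet b=M([q]\otimes1_j)(b)\in M(t(q),j)$ and $b\bullet r=M(1_i\otimes[r]^{op})(b)\in M(i,s(r))$. The quotient $K(\mathcal R,\mathcal B,\mathcal Q)/(\mathcal I\cup\mathcal J\cup\mu)$ is the quotient of $K(\mathcal R,\mathcal B,\mathcal Q)/(\mathcal I\cup\mathcal J)$ by the ideal $\mu$ generated by $\mu(R,\mathcal B,Q)$. *)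

theory Defs
  imports
    "HOL-Algebra.AbelCoset"
    "Jordan_Normal_Form.VS_Connect"
    "Graph_Theory.Arc_Walk"
    "HOL-Library.Poly_Mapping"
begin

hide_const (open) Modules.module_hom

text \<open>The ground field is a type of class \<open>field\<close>; vector spaces over it are
  \<^locale>\<open>vectorspace\<close> structures over \<open>class_ring\<close>. In the vector spaces built below the ring
  fields \<open>mult\<close> and \<open>one\<close> of the underlying record carry no information.\<close>


section \<open>Categories enriched in vector spaces\<close>

text \<open>\<open>cmp C X Y Z g f\<close> is the composite \<open>g f\<close> of \<open>f : X \<rightarrow> Y\<close> and \<open>g : Y \<rightarrow> Z\<close>. Morphism spaces
  need not be disjoint, so the objects are arguments of the composition.\<close>

record ('o, 'm, 'k) kcat =
  objs :: "'o set"
  Hom :: "'o \<Rightarrow> 'o \<Rightarrow> ('k, 'm) module"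
  idm :: "'o \<Rightarrow> 'm"
  cmp :: "'o \<Rightarrow> 'o \<Rightarrow> 'o \<Rightarrow> 'm \<Rightarrow> 'm \<Rightarrow> 'm"

locale k_category =
  fixes C :: "('o, 'm, 'k::field) kcat"
  assumes Hom_space: "\<lbrakk>X \<in> objs C; Y \<in> objs C\<rbrakk> \<Longrightarrow> vectorspace class_ring (Hom C X Y)"
    and idm_closed: "X \<in> objs C \<Longrightarrow> idm C X \<in> carrier (Hom C X X)"
    and cmp_linear_right: "\<lbrakk>X \<in> objs C; Y \<in> objs C; Z \<in> objs C; g \<in> carrier (Hom C Y Z)\<rbrakk>
      \<Longrightarrow> (\<lambda>f. cmp C X Y Z g f) \<in> module_hom class_ring (Hom C X Y) (Hom C X Z)"
    and cmp_linear_left: "\<lbrakk>X \<in> objs C; Y \<in> objs C; Z \<in> objs C; f \<in> carrier (Hom C X Y)\<rbrakk>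
      \<Longrightarrow> (\<lambda>g. cmp C X Y Z g f) \<in> module_hom class_ring (Hom C Y Z) (Hom C X Z)"
    and cmp_idm_left: "\<lbrakk>X \<in> objs C; Y \<in> objs C; f \<in> carrier (Hom C X Y)\<rbrakk>
      \<Longrightarrow> cmp C X Y Y (idm C Y) f = f"
    and cmp_idm_right: "\<lbrakk>X \<in> objs C; Y \<in> objs C; f \<in> carrier (Hom C X Y)\<rbrakk>
      \<Longrightarrow> cmp C X X Y f (idm C X) = f"
    and cmp_assoc: "\<lbrakk>W \<in> objs C; X \<in> objs C; Y \<in> objs C; Z \<in> objs C;
        f \<in> carrier (Hom C W X); g \<in> carrier (Hom C X Y); h \<in> carrier (Hom C Y Z)\<rbrakk>
      \<Longrightarrow> cmp C W Y Z h (cmp C W X Y g f) = cmp C W X Z (cmp C X Y Z h g) f"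

record ('o, 'm, 'p, 'n) kfun =
  on_obj :: "'o \<Rightarrow> 'p"
  on_hom :: "'o \<Rightarrow> 'o \<Rightarrow> 'm \<Rightarrow> 'n"

locale k_functor = dom: k_category C + cod: k_category D
  for C :: "('o, 'm, 'k::field) kcat" and D :: "('p, 'n, 'k) kcat" +
  fixes F :: "('o, 'm, 'p, 'n) kfun"
  assumes on_obj_closed: "X \<in> objs C \<Longrightarrow> on_obj F X \<in> objs D"
    and on_hom_linear: "\<lbrakk>X \<in> objs C; Y \<in> objs C\<rbrakk>
      \<Longrightarrow> on_hom F X Y \<in> module_hom class_ring (Hom C X Y) (Hom D (on_obj F X) (on_obj F Y))"
    and on_hom_idm: "X \<in> objs C \<Longrightarrow> on_hom F X X (idm C X) = idm D (on_obj F X)"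
    and on_hom_cmp: "\<lbrakk>X \<in> objs C; Y \<in> objs C; Z \<in> objs C;
        f \<in> carrier (Hom C X Y); g \<in> carrier (Hom C Y Z)\<rbrakk>
      \<Longrightarrow> on_hom F X Z (cmp C X Y Z g f)
          = cmp D (on_obj F X) (on_obj F Y) (on_obj F Z) (on_hom F Y Z g) (on_hom F X Y f)"

definition k_isomorphism ::
    "('o, 'm, 'k::field) kcat \<Rightarrow> ('p, 'n, 'k) kcat \<Rightarrow> ('o, 'm, 'p, 'n) kfun \<Rightarrow> bool" where
  "k_isomorphism C D F \<longleftrightarrow> k_functor C D F \<and> (\<exists>G. k_functor D C G \<and>
     (\<forall>X\<in>objs C. on_obj G (on_obj F X) = X) \<and>
     (\<forall>X\<in>objs C. \<forall>Y\<in>objs C. \<forall>f\<in>carrier (Hom C X Y).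
        on_hom G (on_obj F X) (on_obj F Y) (on_hom F X Y f) = f) \<and>
     (\<forall>X\<in>objs D. on_obj F (on_obj G X) = X) \<and>
     (\<forall>X\<in>objs D. \<forall>Y\<in>objs D. \<forall>f\<in>carrier (Hom D X Y).
        on_hom F (on_obj G X) (on_obj G Y) (on_hom G X Y f) = f))"

definition op_cat :: "('o, 'm, 'k) kcat \<Rightarrow> ('o, 'm, 'k) kcat" where
  "op_cat C = \<lparr>objs = objs C, Hom = (\<lambda>X Y. Hom C Y X), idm = idm C,
     cmp = (\<lambda>X Y Z g f. cmp C Z Y X f g)\<rparr>"

definition linear_maps ::
    "('k::field, 'a) module \<Rightarrow> ('k, 'b) module \<Rightarrow> ('k, 'a \<Rightarrow> 'b) module" where
  "linear_maps V W =
    \<lparr>carrier = module_hom class_ring V W \<inter> extensional (carrier V),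
     mult = undefined, one = undefined,
     zero = (\<lambda>v\<in>carrier V. \<zero>\<^bsub>W\<^esub>),
     add = (\<lambda>f g. \<lambda>v\<in>carrier V. f v \<oplus>\<^bsub>W\<^esub> g v),
     smult = (\<lambda>c f. \<lambda>v\<in>carrier V. c \<odot>\<^bsub>W\<^esub> f v)\<rparr>"

text \<open>The category of finite-dimensional vector spaces whose elements are taken from the type \<open>'x\<close>.\<close>

definition fd_spaces :: "(('k::field, 'x) module, 'x \<Rightarrow> 'x, 'k) kcat" where
  "fd_spaces =
    \<lparr>objs = {V. vectorspace class_ring V \<and> vectorspace.fin_dim class_ring V},
     Hom = linear_maps,
     idm = (\<lambda>V. \<lambda>v\<in>carrier V. v),
     cmp = (\<lambda>U V W g f. compose (carrier U) g f)\<rparr>"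


section \<open>Ideals and quotient categories\<close>

definition two_sided_ideal ::
    "('o, 'm, 'k::field) kcat \<Rightarrow> ('o \<Rightarrow> 'o \<Rightarrow> 'm set) \<Rightarrow> bool" where
  "two_sided_ideal C I \<longleftrightarrow>
    (\<forall>X\<in>objs C. \<forall>Y\<in>objs C. VectorSpace.subspace class_ring (I X Y) (Hom C X Y)) \<and>
    (\<forall>X\<in>objs C. \<forall>Y\<in>objs C. \<forall>Z\<in>objs C.
      (\<forall>f\<in>I X Y. \<forall>g\<in>carrier (Hom C Y Z). cmp C X Y Z g f \<in> I X Z) \<and>
      (\<forall>f\<in>carrier (Hom C X Y). \<forall>g\<in>I Y Z. cmp C X Y Z g f \<in> I X Z))"

text \<open>An element \<open>(X, Y, h)\<close> of \<open>S\<close> stands for a morphism \<open>h : X \<rightarrow> Y\<close>.\<close>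

definition generated_ideal ::
    "('o, 'm, 'k::field) kcat \<Rightarrow> ('o \<times> 'o \<times> 'm) set \<Rightarrow> 'o \<Rightarrow> 'o \<Rightarrow> 'm set" where
  "generated_ideal C S X Y = {f \<in> carrier (Hom C X Y).
     \<forall>I. two_sided_ideal C I \<and> (\<forall>(A, B, h)\<in>S. h \<in> I A B) \<longrightarrow> f \<in> I X Y}"

definition quotient_space :: "('k, 'a) module \<Rightarrow> 'a set \<Rightarrow> ('k, 'a set) module" where
  "quotient_space V W =
    \<lparr>carrier = a_rcosets\<^bsub>V\<^esub> W, mult = undefined, one = undefined,
     zero = W, add = set_add V,
     smult = (\<lambda>c P. \<Union>x\<in>P. W +>\<^bsub>V\<^esub> (c \<odot>\<^bsub>V\<^esub> x))\<rparr>"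

definition cls ::
    "('o, 'm, 'k) kcat \<Rightarrow> ('o \<Rightarrow> 'o \<Rightarrow> 'm set) \<Rightarrow> 'o \<Rightarrow> 'o \<Rightarrow> 'm \<Rightarrow> 'm set" where
  "cls C I X Y f = I X Y +>\<^bsub>Hom C X Y\<^esub> f"

definition quotient_cat ::
    "('o, 'm, 'k) kcat \<Rightarrow> ('o \<Rightarrow> 'o \<Rightarrow> 'm set) \<Rightarrow> ('o, 'm set, 'k) kcat" where
  "quotient_cat C I =
    \<lparr>objs = objs C,
     Hom = (\<lambda>X Y. quotient_space (Hom C X Y) (I X Y)),
     idm = (\<lambda>X. cls C I X X (idm C X)),
     cmp = (\<lambda>X Y Z P N. \<Union>g\<in>P. \<Union>f\<in>N. cls C I X Z (cmp C X Y Z g f))\<rparr>"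


section \<open>Formal linear combinations and tensor products\<close>

definition linear_ext ::
    "('a \<Rightarrow> 'b) \<Rightarrow> ('a \<Rightarrow>\<^sub>0 'k::comm_monoid_add) \<Rightarrow> ('b \<Rightarrow>\<^sub>0 'k)" where
  "linear_ext \<phi> x = (\<Sum>a\<in>Poly_Mapping.keys x. Poly_Mapping.single (\<phi> a) (Poly_Mapping.lookup x a))"

definition bilinear_ext ::
    "('a \<Rightarrow> 'b \<Rightarrow> 'c) \<Rightarrow> ('a \<Rightarrow>\<^sub>0 'k::semiring_0) \<Rightarrow> ('b \<Rightarrow>\<^sub>0 'k) \<Rightarrow> ('c \<Rightarrow>\<^sub>0 'k)" where
  "bilinear_ext \<phi> x y =
     (\<Sum>a\<in>Poly_Mapping.keys x. \<Sum>b\<in>Poly_Mapping.keys y. Poly_Mapping.single (\<phi> a b) (Poly_Mapping.lookup x a * Poly_Mapping.lookup y b))"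

definition scale :: "'k \<Rightarrow> ('a \<Rightarrow>\<^sub>0 'k::semiring_0) \<Rightarrow> ('a \<Rightarrow>\<^sub>0 'k)" where
  "scale c x = Poly_Mapping.map ((*) c) x"

definition free_space :: "'a set \<Rightarrow> ('k::field, 'a \<Rightarrow>\<^sub>0 'k) module" where
  "free_space S =
    \<lparr>carrier = {x. Poly_Mapping.keys x \<subseteq> S}, mult = undefined, one = undefined,
     zero = 0, add = (+), smult = scale\<rparr>"

text \<open>The tensor product is the free space on pairs of vectors modulo the relations below.\<close>

abbreviation pair :: "'a \<Rightarrow> 'b \<Rightarrow> ('a \<times> 'b \<Rightarrow>\<^sub>0 'k::field)" where
  "pair v w \<equiv> Poly_Mapping.single (v, w) 1"

definition tensor_relations ::
    "('k::field, 'a) module \<Rightarrow> ('k, 'b) module \<Rightarrow> ('a \<times> 'b \<Rightarrow>\<^sub>0 'k) set" where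
  "tensor_relations V W = LinearCombinations.module.span class_ring (free_space (carrier V \<times> carrier W))
    ({pair (v \<oplus>\<^bsub>V\<^esub> v') w - pair v w - pair v' w | v v' w.
        v \<in> carrier V \<and> v' \<in> carrier V \<and> w \<in> carrier W} \<union>
     {pair v (w \<oplus>\<^bsub>W\<^esub> w') - pair v w - pair v w' | v w w'.
        v \<in> carrier V \<and> w \<in> carrier W \<and> w' \<in> carrier W} \<union>
     {pair (c \<odot>\<^bsub>V\<^esub> v) w - scale c (pair v w) | c v w.
        v \<in> carrier V \<and> w \<in> carrier W} \<union>
     {pair v (c \<odot>\<^bsub>W\<^esub> w) - scale c (pair v w) | c v w.
        v \<in> carrier V \<and> w \<in> carrier W})"

definition tensor_cls ::
    "('k::field, 'a) module \<Rightarrow> ('k, 'b) module \<Rightarrow> ('a \<times> 'b \<Rightarrow>\<^sub>0 'k) \<Rightarrow> ('a \<times> 'b \<Rightarrow>\<^sub>0 'k) set" where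
  "tensor_cls V W x = tensor_relations V W +>\<^bsub>free_space (carrier V \<times> carrier W)\<^esub> x"

definition pure_tensor ::
    "('k::field, 'a) module \<Rightarrow> ('k, 'b) module \<Rightarrow> 'a \<Rightarrow> 'b \<Rightarrow> ('a \<times> 'b \<Rightarrow>\<^sub>0 'k) set" where
  "pure_tensor V W v w = tensor_cls V W (pair v w)"

definition tensor_space ::
    "('k::field, 'a) module \<Rightarrow> ('k, 'b) module \<Rightarrow> ('k, ('a \<times> 'b \<Rightarrow>\<^sub>0 'k) set) module" where
  "tensor_space V W =
     quotient_space (free_space (carrier V \<times> carrier W)) (tensor_relations V W)"

definition tensor_cat :: "('o, 'm, 'k::field) kcat \<Rightarrow> ('p, 'n, 'k) kcat
    \<Rightarrow> ('o \<times> 'p, ('m \<times> 'n \<Rightarrow>\<^sub>0 'k) set, 'k) kcat" where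
  "tensor_cat C D =
    \<lparr>objs = objs C \<times> objs D,
     Hom = (\<lambda>(X, X') (Y, Y'). tensor_space (Hom C X Y) (Hom D X' Y')),
     idm = (\<lambda>(X, X'). pure_tensor (Hom C X X) (Hom D X' X') (idm C X) (idm D X')),
     cmp = (\<lambda>(X, X') (Y, Y') (Z, Z') P N. \<Union>y\<in>P. \<Union>x\<in>N.
       tensor_cls (Hom C X Z) (Hom D X' Z')
         (bilinear_ext (\<lambda>(g, g') (f, f'). (cmp C X Y Z g f, cmp D X' Y' Z' g' f')) y x))\<rparr>"


section \<open>Path categories\<close>

text \<open>Quivers are digraphs with parallel arcs and loops; a path is an arc walk, the trivial path
  at a vertex being the empty walk. Walks list their arcs in the order of traversal, so the
  composite \<open>q p\<close> of paths is the walk \<open>p @ q\<close>.\<close>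

definition strongly_locally_finite :: "('v, 'e) pre_digraph \<Rightarrow> bool" where
  "strongly_locally_finite G \<longleftrightarrow>
     (\<forall>a\<in>verts G. finite (out_arcs G a) \<and> finite (in_arcs G a)) \<and>
     (\<forall>a\<in>verts G. \<forall>b\<in>verts G. finite {p. pre_digraph.awalk G a p b})"

text \<open>A formal direct sum of vertices is a multiset of vertices, with one summand for each slot
  \<open>(a, k)\<close>, where \<open>k\<close> is less than the multiplicity of \<open>a\<close>. A morphism \<open>X \<rightarrow> Y\<close> is a matrix whose
  entry at \<open>x\<close>, \<open>y\<close> is a combination of paths from the summand \<open>x\<close> of \<open>X\<close> to the summand \<open>y\<close>
  of \<open>Y\<close>; entries outside the slots are zero.\<close>

type_synonym ('v, 'e, 'k) path_mor = "'v \<times> nat \<Rightarrow> 'v \<times> nat \<Rightarrow> ('e list \<Rightarrow>\<^sub>0 'k)"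

definition slots :: "'v multiset \<Rightarrow> ('v \<times> nat) set" where
  "slots X = {(a, k). k < count X a}"

definition path_cat ::
    "('v, 'e) pre_digraph \<Rightarrow> ('v multiset, ('v, 'e, 'k::field) path_mor, 'k) kcat" where
  "path_cat G =
    \<lparr>objs = {X. set_mset X \<subseteq> verts G},
     Hom = (\<lambda>X Y.
       \<lparr>carrier = {f. \<forall>x y.
          (x \<in> slots X \<and> y \<in> slots Y \<longrightarrow>
             Poly_Mapping.keys (f x y) \<subseteq> {p. pre_digraph.awalk G (fst x) p (fst y)}) \<and>
          (\<not> (x \<in> slots X \<and> y \<in> slots Y) \<longrightarrow> f x y = 0)},
        mult = undefined, one = undefined,
        zero = (\<lambda>x y. 0),
        add = (\<lambda>f g x y. f x y + g x y),
        smult = (\<lambda>c f x y. scale c (f x y))\<rparr>),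
     idm = (\<lambda>X x y. if x = y \<and> x \<in> slots X then Poly_Mapping.single [] 1 else 0),
     cmp = (\<lambda>X Y Z g f x z. \<Sum>y\<in>slots Y. bilinear_ext (\<lambda>q p. p @ q) (g y z) (f x y))\<rparr>"

text \<open>The combination \<open>f\<close> of paths from \<open>a\<close> to \<open>b\<close>, as a morphism between the one-vertex objects.\<close>

definition path_mor :: "'v \<Rightarrow> 'v \<Rightarrow> ('e list \<Rightarrow>\<^sub>0 'k::zero) \<Rightarrow> ('v, 'e, 'k) path_mor" where
  "path_mor a b f = (\<lambda>x y. if x = (a, 0) \<and> y = (b, 0) then f else 0)"

text \<open>A relation is given with its source and target, since the combination may be zero.\<close>

type_synonym ('v, 'e, 'k) qrel = "'v \<times> 'v \<times> ('e list \<Rightarrow>\<^sub>0 'k)"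

definition relations_on :: "('v, 'e) pre_digraph \<Rightarrow> ('v, 'e, 'k::field) qrel set" where
  "relations_on G = {(a, b, f). a \<in> verts G \<and> b \<in> verts G \<and>
     Poly_Mapping.keys f \<subseteq> {p. pre_digraph.awalk G a p b \<and> length p \<ge> 2}}"

definition relations_ideal :: "('v, 'e) pre_digraph \<Rightarrow> ('v, 'e, 'k::field) qrel set
    \<Rightarrow> 'v multiset \<Rightarrow> 'v multiset \<Rightarrow> ('v, 'e, 'k) path_mor set" where
  "relations_ideal G S =
     generated_ideal (path_cat G) ((\<lambda>(a, b, f). ({#a#}, {#b#}, path_mor a b f)) ` S)"

definition bound_cat :: "('v, 'e) pre_digraph \<Rightarrow> ('v, 'e, 'k::field) qrel set
    \<Rightarrow> ('v multiset, ('v, 'e, 'k) path_mor set, 'k) kcat" where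
  "bound_cat G S = quotient_cat (path_cat G) (relations_ideal G S)"

definition arrow_cls :: "('v, 'e) pre_digraph \<Rightarrow> ('v, 'e, 'k::field) qrel set
    \<Rightarrow> 'e \<Rightarrow> ('v, 'e, 'k) path_mor set" where
  "arrow_cls G S e = cls (path_cat G) (relations_ideal G S) {#tail G e#} {#head G e#}
     (path_mor (tail G e) (head G e) (Poly_Mapping.single [e] 1))"


section \<open>Triangular matrix categories\<close>

type_synonym ('u, 'n, 't, 'm, 'x, 'k) bimod =
  "('u \<times> 't, ('n \<times> 'm \<Rightarrow>\<^sub>0 'k) set, ('k, 'x) module, 'x \<Rightarrow> 'x) kfun"

text \<open>\<open>g \<bullet> m = M (g \<otimes> 1) m\<close> for \<open>g : u \<rightarrow> u'\<close> in \<open>U\<close> and \<open>m \<in> M (u, t)\<close>;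
  \<open>m \<bullet> f = M (1 \<otimes> f\<^sup>o\<^sup>p) m\<close> for \<open>f : t \<rightarrow> t'\<close> in \<open>T\<close> and \<open>m \<in> M (u, t')\<close>.\<close>

definition left_act :: "('t, 'm, 'k::field) kcat \<Rightarrow> ('u, 'n, 'k) kcat
    \<Rightarrow> ('u, 'n, 't, 'm, 'x, 'k) bimod \<Rightarrow> 't \<Rightarrow> 'u \<Rightarrow> 'u \<Rightarrow> 'n \<Rightarrow> 'x \<Rightarrow> 'x" where
  "left_act T U M t u u' g m = on_hom M (u, t) (u', t)
     (pure_tensor (Hom U u u') (Hom (op_cat T) t t) g (idm (op_cat T) t)) m"

definition right_act :: "('t, 'm, 'k::field) kcat \<Rightarrow> ('u, 'n, 'k) kcat
    \<Rightarrow> ('u, 'n, 't, 'm, 'x, 'k) bimod \<Rightarrow> 'u \<Rightarrow> 't \<Rightarrow> 't \<Rightarrow> 'x \<Rightarrow> 'm \<Rightarrow> 'x" where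
  "right_act T U M u t t' m f = on_hom M (u, t') (u, t)
     (pure_tensor (Hom U u u) (Hom (op_cat T) t' t) (idm U u) f) m"

text \<open>An object \<open>(t, u)\<close> stands for the matrix with diagonal \<open>t\<close>, \<open>u\<close>, and a morphism \<open>(f, m, g)\<close>
  for the matrix with diagonal \<open>f\<close>, \<open>g\<close> and lower left entry \<open>m\<close>.\<close>

definition triangular_cat :: "('t, 'm, 'k::field) kcat \<Rightarrow> ('u, 'n, 'k) kcat
    \<Rightarrow> ('u, 'n, 't, 'm, 'x, 'k) bimod \<Rightarrow> ('t \<times> 'u, 'm \<times> 'x \<times> 'n, 'k) kcat" where
  "triangular_cat T U M =
    \<lparr>objs = objs T \<times> objs U,
     Hom = (\<lambda>(t, u) (t', u'). direct_sum (Hom T t t') (direct_sum (on_obj M (u', t)) (Hom U u u'))),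
     idm = (\<lambda>(t, u). (idm T t, \<zero>\<^bsub>on_obj M (u, t)\<^esub>, idm U u)),
     cmp = (\<lambda>(t1, u1) (t2, u2) (t3, u3) (f2, m2, g2) (f1, m1, g1).
       (cmp T t1 t2 t3 f2 f1,
        right_act T U M u3 t1 t2 m2 f1 \<oplus>\<^bsub>on_obj M (u3, t1)\<^esub> left_act T U M t1 u2 u3 g2 m1,
        cmp U u1 u2 u3 g2 g1))\<rparr>"


section \<open>The augmented quiver\<close>

text \<open>\<open>Inl e\<close> is an arrow of \<open>R\<close> or \<open>Q\<close>; \<open>Inr (i, j, b)\<close> is the new arrow \<open>j \<rightarrow> i\<close>
  attached to the basis vector \<open>b \<in> B i j\<close>.\<close>

type_synonym ('v, 'e, 'x) aug_arrow = "'e + 'v \<times> 'v \<times> 'x"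

definition augmented_quiver :: "('v, 'e) pre_digraph \<Rightarrow> ('v \<Rightarrow> 'v \<Rightarrow> 'x set)
    \<Rightarrow> ('v, 'e) pre_digraph \<Rightarrow> ('v, ('v, 'e, 'x) aug_arrow) pre_digraph" where
  "augmented_quiver R B Q =
    \<lparr>verts = verts R \<union> verts Q,
     arcs = Inl ` (arcs R \<union> arcs Q) \<union>
       Inr ` {(i, j, b). i \<in> verts Q \<and> j \<in> verts R \<and> b \<in> B i j},
     tail = (\<lambda>a. case a of Inl e \<Rightarrow> if e \<in> arcs R then tail R e else tail Q e
                          | Inr (i, j, b) \<Rightarrow> j),
     head = (\<lambda>a. case a of Inl e \<Rightarrow> if e \<in> arcs R then head R e else head Q e
                          | Inr (i, j, b) \<Rightarrow> i)\<rparr>"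

definition view_relations :: "('v, 'e, 'k::field) qrel set
    \<Rightarrow> ('v, ('v, 'e, 'x) aug_arrow, 'k) qrel set" where
  "view_relations S = (\<lambda>(a, b, f). (a, b, linear_ext (map Inl) f)) ` S"

type_synonym ('v, 'e, 'x, 'k) aug_mor = "('v, ('v, 'e, 'x) aug_arrow, 'k) path_mor set"

definition augmented_cat :: "('v, 'e) pre_digraph \<Rightarrow> ('v, 'e, 'k::field) qrel set
    \<Rightarrow> ('v \<Rightarrow> 'v \<Rightarrow> 'x set) \<Rightarrow> ('v, 'e) pre_digraph \<Rightarrow> ('v, 'e, 'k) qrel set
    \<Rightarrow> ('v multiset, ('v, 'e, 'x, 'k) aug_mor, 'k) kcat" where
  "augmented_cat R \<sigma> B Q \<rho> = bound_cat (augmented_quiver R B Q) (view_relations (\<rho> \<union> \<sigma>))"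

definition aug_arrow_cls :: "('v, 'e) pre_digraph \<Rightarrow> ('v, 'e, 'k::field) qrel set
    \<Rightarrow> ('v \<Rightarrow> 'v \<Rightarrow> 'x set) \<Rightarrow> ('v, 'e) pre_digraph \<Rightarrow> ('v, 'e, 'k) qrel set
    \<Rightarrow> ('v, 'e, 'x) aug_arrow \<Rightarrow> ('v, 'e, 'x, 'k) aug_mor" where
  "aug_arrow_cls R \<sigma> B Q \<rho> = arrow_cls (augmented_quiver R B Q) (view_relations (\<rho> \<union> \<sigma>))"

type_synonym ('v, 'e, 'x, 'k) quiver_bimod =
  "('v multiset, ('v, 'e, 'k) path_mor set, 'v multiset, ('v, 'e, 'k) path_mor set, 'x, 'k) bimod"

text \<open>The linear extension of \<open>b \<mapsto> \<close> class of the arrow of \<open>b\<close>; it is the unique such map on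
  \<open>M (i, j)\<close> (undefined off the carrier) when \<open>B i j\<close> is a basis.\<close>

definition arrow_map :: "('v, 'e) pre_digraph \<Rightarrow> ('v, 'e, 'k::field) qrel set
    \<Rightarrow> ('v \<Rightarrow> 'v \<Rightarrow> 'x set) \<Rightarrow> ('v, 'e) pre_digraph \<Rightarrow> ('v, 'e, 'k) qrel set
    \<Rightarrow> ('v, 'e, 'x, 'k) quiver_bimod \<Rightarrow> 'v \<Rightarrow> 'v \<Rightarrow> 'x \<Rightarrow> ('v, 'e, 'x, 'k) aug_mor" where
  "arrow_map R \<sigma> B Q \<rho> M i j =
    (THE \<phi>. \<phi> \<in> carrier (linear_maps (on_obj M ({#i#}, {#j#}))
                                    (Hom (augmented_cat R \<sigma> B Q \<rho>) {#j#} {#i#})) \<and>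
            (\<forall>b\<in>B i j. \<phi> b = aug_arrow_cls R \<sigma> B Q \<rho> (Inr (i, j, b))))"

definition mu_relations :: "('v, 'e) pre_digraph \<Rightarrow> ('v, 'e, 'k::field) qrel set
    \<Rightarrow> ('v \<Rightarrow> 'v \<Rightarrow> 'x set) \<Rightarrow> ('v, 'e) pre_digraph \<Rightarrow> ('v, 'e, 'k) qrel set
    \<Rightarrow> ('v, 'e, 'x, 'k) quiver_bimod
    \<Rightarrow> ('v multiset \<times> 'v multiset \<times> ('v, 'e, 'x, 'k) aug_mor) set" where
  "mu_relations R \<sigma> B Q \<rho> M =
    (let E = augmented_cat R \<sigma> B Q \<rho>; arr = aug_arrow_cls R \<sigma> B Q \<rho>;
         T = bound_cat R \<sigma>; U = bound_cat Q \<rho>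
     in
      {({#j#}, {#head Q q#},
         cmp E {#j#} {#i#} {#head Q q#} (arr (Inl q)) (arr (Inr (i, j, b)))
         \<ominus>\<^bsub>Hom E {#j#} {#head Q q#}\<^esub>
         arrow_map R \<sigma> B Q \<rho> M (head Q q) j
           (left_act T U M {#j#} {#i#} {#head Q q#} (arrow_cls Q \<rho> q) b))
       | i j b q. i \<in> verts Q \<and> j \<in> verts R \<and> b \<in> B i j \<and> q \<in> arcs Q \<and> tail Q q = i} \<union>
      {({#tail R r#}, {#i#},
         cmp E {#tail R r#} {#j#} {#i#} (arr (Inr (i, j, b))) (arr (Inl r))
         \<ominus>\<^bsub>Hom E {#tail R r#} {#i#}\<^esub>
         arrow_map R \<sigma> B Q \<rho> M i (tail R r)
           (right_act T U M {#i#} {#tail R r#} {#j#} b (arrow_cls R \<sigma> r)))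
       | i j b r. i \<in> verts Q \<and> j \<in> verts R \<and> b \<in> B i j \<and> r \<in> arcs R \<and> head R r = j})"

definition augmented_quotient :: "('v, 'e) pre_digraph \<Rightarrow> ('v, 'e, 'k::field) qrel set
    \<Rightarrow> ('v \<Rightarrow> 'v \<Rightarrow> 'x set) \<Rightarrow> ('v, 'e) pre_digraph \<Rightarrow> ('v, 'e, 'k) qrel set
    \<Rightarrow> ('v, 'e, 'x, 'k) quiver_bimod
    \<Rightarrow> ('v multiset, ('v, 'e, 'x, 'k) aug_mor set, 'k) kcat" where
  "augmented_quotient R \<sigma> B Q \<rho> M =
    quotient_cat (augmented_cat R \<sigma> B Q \<rho>)
      (generated_ideal (augmented_cat R \<sigma> B Q \<rho>) (mu_relations R \<sigma> B Q \<rho> M))"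

end

theory Submission
  imports Defs
begin

text \<open>A functor from a path category to a category with biproducts is determined by the images of the
  vertices and arrows. Sending the arrows of \<open>R\<close> and \<open>Q\<close> to their classes on the diagonal and the new
  arrow of \<open>b\<close> to \<open>b\<close> in the lower left corner gives a functor from the path category of the
  augmented quiver to the triangular matrix category, which kills all the relations. It is full, since
  vertices suffice to check this and \<open>M(i, j)\<close> is spanned by \<open>B i j\<close>. A path from \<open>j \<in> R\<close> to
  \<open>i \<in> Q\<close> contains exactly one new arrow, so pushing the old arrows into that arrow by the relations
  \<open>\<mu>\<close> rewrites the path as a combination of the new arrows \<open>j \<rightarrow> i\<close>. As \<open>B i j\<close> is linearly
  independent, the kernel is exactly the ideal generated by the relations.\<close>

section \<open>Vector spaces and quotient spaces\<close>

text \<open>A path category is free, so a functor out of it is given by arbitrary images of arrows;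
  going the other way, from matrices to classes of paths, would need the rewriting already for the
  functor laws. Hence the isomorphism is the inverse of the functor constructed, obtained from
  bijectivity on objects and on morphism spaces.

  Objects are multisets of vertices and morphisms are matrices; biproducts on both sides reduce
  fullness and the kernel to single vertices. A vertex is paired with the empty multiset, a zero
  object, so for two vertices at most one corner of the triangular matrix can be nonzero.

  The relations \<open>\<mu>\<close> live in a quotient already taken. Their ideal is pulled back to
  an ideal \<open>N\<close> of the path category that contains the old relations as well, and
  rewriting becomes congruence modulo \<open>N\<close>. Reduced forms are not shown unique by
  comparing rewritings: each combination of paths from \<open>R\<close> to \<open>Q\<close> is
  congruent to the lift of some vector \<open>m\<close> and has \<open>m\<close> as its image, so
  the functor reads \<open>m\<close> off and a zero image forces the class to vanish.\<close>

lemma class_vectorspaceI: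
  fixes V :: "('k::field, 'a) module"
  assumes "\<zero>\<^bsub>V\<^esub> \<in> carrier V"
    and "\<And>v w. v \<in> carrier V \<Longrightarrow> w \<in> carrier V \<Longrightarrow> v \<oplus>\<^bsub>V\<^esub> w \<in> carrier V"
    and "\<And>v. v \<in> carrier V \<Longrightarrow> \<exists>w\<in>carrier V. v \<oplus>\<^bsub>V\<^esub> w = \<zero>\<^bsub>V\<^esub>"
    and "\<And>c v. v \<in> carrier V \<Longrightarrow> c \<odot>\<^bsub>V\<^esub> v \<in> carrier V"
    and "\<And>v w. v \<in> carrier V \<Longrightarrow> w \<in> carrier V \<Longrightarrow> v \<oplus>\<^bsub>V\<^esub> w = w \<oplus>\<^bsub>V\<^esub> v"
    and "\<And>v w x. v \<in> carrier V \<Longrightarrow> w \<in> carrier V \<Longrightarrow> x \<in> carrier V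
      \<Longrightarrow> (v \<oplus>\<^bsub>V\<^esub> w) \<oplus>\<^bsub>V\<^esub> x = v \<oplus>\<^bsub>V\<^esub> (w \<oplus>\<^bsub>V\<^esub> x)"
    and "\<And>v. v \<in> carrier V \<Longrightarrow> v \<oplus>\<^bsub>V\<^esub> \<zero>\<^bsub>V\<^esub> = v"
    and "\<And>a b v. v \<in> carrier V \<Longrightarrow> (a * b) \<odot>\<^bsub>V\<^esub> v = a \<odot>\<^bsub>V\<^esub> (b \<odot>\<^bsub>V\<^esub> v)"
    and "\<And>v. v \<in> carrier V \<Longrightarrow> 1 \<odot>\<^bsub>V\<^esub> v = v"
    and "\<And>a b v. v \<in> carrier V \<Longrightarrow> (a + b) \<odot>\<^bsub>V\<^esub> v = a \<odot>\<^bsub>V\<^esub> v \<oplus>\<^bsub>V\<^esub> b \<odot>\<^bsub>V\<^esub> v"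
    and "\<And>a v w. v \<in> carrier V \<Longrightarrow> w \<in> carrier V
      \<Longrightarrow> a \<odot>\<^bsub>V\<^esub> (v \<oplus>\<^bsub>V\<^esub> w) = a \<odot>\<^bsub>V\<^esub> v \<oplus>\<^bsub>V\<^esub> a \<odot>\<^bsub>V\<^esub> w"
  shows "vectorspace class_ring V"
  using assms by (intro vs_criteria class_field) auto

lemma module_homI:
  fixes V :: "('k::field, 'a) module"
  assumes "\<And>x. x \<in> carrier V \<Longrightarrow> f x \<in> carrier W"
    and "\<And>x y. x \<in> carrier V \<Longrightarrow> y \<in> carrier V \<Longrightarrow> f (x \<oplus>\<^bsub>V\<^esub> y) = f x \<oplus>\<^bsub>W\<^esub> f y"
    and "\<And>c x. x \<in> carrier V \<Longrightarrow> f (c \<odot>\<^bsub>V\<^esub> x) = c \<odot>\<^bsub>W\<^esub> f x"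
  shows "f \<in> module_hom class_ring V W"
  using assms by (auto simp: LinearCombinations.module_hom_def)

lemma hom_smult:
  fixes V :: "('k::field, 'a) module"
  shows "\<lbrakk>f \<in> module_hom class_ring V W; x \<in> carrier V\<rbrakk> \<Longrightarrow> f (c \<odot>\<^bsub>V\<^esub> x) = c \<odot>\<^bsub>W\<^esub> f x"
  by (simp add: LinearCombinations.module_hom_def)

lemma hom_closed:
  "\<lbrakk>f \<in> module_hom K V W; x \<in> carrier V\<rbrakk> \<Longrightarrow> f x \<in> carrier W"
  by (auto simp: LinearCombinations.module_hom_def)

lemmas hom_add = LinearCombinations.module_hom_add

lemma hom_compose:
  "\<lbrakk>f \<in> module_hom K U V; g \<in> module_hom K V W\<rbrakk> \<Longrightarrow> (\<lambda>x. g (f x)) \<in> module_hom K U W"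
  by (auto simp: LinearCombinations.module_hom_def Pi_iff)

lemma linear_mapI:
  "\<lbrakk>vectorspace K V; vectorspace K W; f \<in> module_hom K V W\<rbrakk> \<Longrightarrow> linear_map K V W f"
  by (simp add: linear_map_def mod_hom_def mod_hom_axioms_def vectorspace_def)

context
  fixes V :: "('k::field, 'a) module" and W :: "('k, 'b) module" and f
  assumes vs: "vectorspace class_ring V" "vectorspace class_ring W"
    and f: "f \<in> module_hom class_ring V W"
begin

interpretation V: vectorspace class_ring V
  by (rule vs)

interpretation W: vectorspace class_ring W
  by (rule vs)

interpretation linear_map class_ring V W f
  using vs f by (rule linear_mapI)

lemma hom_zero: "f \<zero>\<^bsub>V\<^esub> = \<zero>\<^bsub>W\<^esub>"
  by simp

lemma hom_minus: "\<lbrakk>x \<in> carrier V; y \<in> carrier V\<rbrakk> \<Longrightarrow> f (x \<ominus>\<^bsub>V\<^esub> y) = f x \<ominus>\<^bsub>W\<^esub> f y"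
  by simp

lemma hom_finsum:
  assumes "\<And>i. i \<in> A \<Longrightarrow> g i \<in> carrier V"
  shows "f (finsum V g A) = finsum W (\<lambda>i. f (g i)) A"
  using assms
proof (induct A rule: infinite_finite_induct)
  case (insert a A)
  have "g \<in> A \<rightarrow> carrier V" "(\<lambda>i. f (g i)) \<in> A \<rightarrow> carrier W" "g a \<in> carrier V"
    using insert by auto
  then show ?case using insert by (simp add: V.finsum_insert W.finsum_insert)
qed simp_all

end

lemma subspaceI:
  fixes V :: "('k::field, 'a) module"
  assumes "vectorspace class_ring V" "W \<subseteq> carrier V" "\<zero>\<^bsub>V\<^esub> \<in> W"
    and "\<And>x y. x \<in> W \<Longrightarrow> y \<in> W \<Longrightarrow> x \<oplus>\<^bsub>V\<^esub> y \<in> W"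
    and "\<And>c x. x \<in> W \<Longrightarrow> c \<odot>\<^bsub>V\<^esub> x \<in> W"
  shows "VectorSpace.subspace class_ring W V"
  using assms by (auto simp: VectorSpace.subspace_def submodule_def vectorspace_def)

lemma subspaceD:
  fixes V :: "('k::field, 'a) module"
  assumes "VectorSpace.subspace class_ring W V"
  shows "W \<subseteq> carrier V" "\<zero>\<^bsub>V\<^esub> \<in> W"
    "\<And>x y. x \<in> W \<Longrightarrow> y \<in> W \<Longrightarrow> x \<oplus>\<^bsub>V\<^esub> y \<in> W"
    "\<And>c x. x \<in> W \<Longrightarrow> c \<odot>\<^bsub>V\<^esub> x \<in> W"
    "\<And>x y. x \<in> W \<Longrightarrow> y \<in> W \<Longrightarrow> x \<ominus>\<^bsub>V\<^esub> y \<in> W"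
proof -
  interpret S: submodule class_ring W V
    using assms by (simp add: VectorSpace.subspace_def)
  show "W \<subseteq> carrier V" "\<zero>\<^bsub>V\<^esub> \<in> W" "\<And>x y. x \<in> W \<Longrightarrow> y \<in> W \<Longrightarrow> x \<oplus>\<^bsub>V\<^esub> y \<in> W"
    and smult: "\<And>c x. x \<in> W \<Longrightarrow> c \<odot>\<^bsub>V\<^esub> x \<in> W"
    by (simp_all add: S.subset)
  interpret V: Module.module class_ring V
    by (rule S.module)
  show "x \<ominus>\<^bsub>V\<^esub> y \<in> W" if "x \<in> W" "y \<in> W" for x y
  proof -
    have "y \<in> carrier V"
      using that S.subset by blast
    from V.smult_minus_1[OF this] have "\<ominus>\<^bsub>V\<^esub> y \<in> W"
      using smult[OF that(2)] by metis
    then show ?thesis using that by (simp add: a_minus_def)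
  qed
qed

lemma subspace_zero:
  "vectorspace class_ring V \<Longrightarrow> VectorSpace.subspace class_ring {\<zero>\<^bsub>V\<^esub>} (V :: ('k::field, 'a) module)"
  by (rule subspaceI) (auto simp: vectorspace_def Module.module_def abelian_group_def
      intro: abelian_monoid.zero_closed abelian_monoid.l_zero Module.module.smult_r_null)

section \<open>Quotient of a vector space by a subspace\<close>

locale quotient_of_space = V: vectorspace class_ring V
  for V :: "('k::field, 'a) module" +
  fixes W
  assumes W: "VectorSpace.subspace class_ring W V"
begin

text \<open>The cosets in \<open>quotient_space\<close> are those of additive group theory; this
  makes the lemmas about them available. Negatives stay in \<open>W\<close> because they are
  differences from zero.\<close>

lemma abelian_subgroup: "abelian_subgroup W V"
proof (intro abelian_subgroupI3 additive_subgroupI V.abelian_group_axioms)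
  show "subgroup W (add_monoid V)"
  proof
    show "inv\<^bsub>add_monoid V\<^esub> x \<in> W" if "x \<in> W" for x
    proof -
      have "\<zero>\<^bsub>V\<^esub> \<ominus>\<^bsub>V\<^esub> x \<in> W" "x \<in> carrier V"
        using subspaceD[OF W] that by auto
      then show ?thesis by (simp add: a_minus_def) (simp add: a_inv_def)
    qed
  qed (use subspaceD[OF W] in auto)
qed

interpretation abelian_subgroup W V
  by (rule abelian_subgroup)

lemma coset_eq_iff:
  assumes "x \<in> carrier V" "y \<in> carrier V"
  shows "W +>\<^bsub>V\<^esub> x = W +>\<^bsub>V\<^esub> y \<longleftrightarrow> x \<ominus>\<^bsub>V\<^esub> y \<in> W"
proof -
  have "W +>\<^bsub>V\<^esub> x = W +>\<^bsub>V\<^esub> y \<longleftrightarrow> x \<in> W +>\<^bsub>V\<^esub> y"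
    using assms a_rcos_self[of x] a_repr_independence'[of x y] by metis
  also have "\<dots> \<longleftrightarrow> x \<ominus>\<^bsub>V\<^esub> y \<in> W"
    unfolding a_minus_def by (rule a_rcos_module[OF assms(2,1)])
  finally show ?thesis .
qed

lemma coset_self: "x \<in> carrier V \<Longrightarrow> x \<in> W +>\<^bsub>V\<^esub> x"
  by (rule a_rcos_self)

lemma coset_memD:
  "\<lbrakk>x \<in> W +>\<^bsub>V\<^esub> y; y \<in> carrier V\<rbrakk> \<Longrightarrow> x \<in> carrier V \<and> W +>\<^bsub>V\<^esub> x = W +>\<^bsub>V\<^esub> y"
  using a_repr_independence'[of x y] a_elemrcos_carrier[of y x] by auto

lemma carrier_quotient: "carrier (quotient_space V W) = (\<lambda>x. W +>\<^bsub>V\<^esub> x) ` carrier V"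
  by (auto simp: quotient_space_def A_RCOSETS_def')

lemma quotient_add:
  "\<lbrakk>x \<in> carrier V; y \<in> carrier V\<rbrakk>
    \<Longrightarrow> (W +>\<^bsub>V\<^esub> x) \<oplus>\<^bsub>quotient_space V W\<^esub> (W +>\<^bsub>V\<^esub> y) = W +>\<^bsub>V\<^esub> (x \<oplus>\<^bsub>V\<^esub> y)"
  by (simp add: quotient_space_def a_rcos_sum)

lemma quotient_zero: "\<zero>\<^bsub>quotient_space V W\<^esub> = W +>\<^bsub>V\<^esub> \<zero>\<^bsub>V\<^esub>"
  using a_rcos_const[of "\<zero>\<^bsub>V\<^esub>"] subspaceD(2)[OF W] by (simp add: quotient_space_def)

text \<open>Scalar multiplication of cosets is defined as a union over all members of the coset. Any
  two members differ by an element of \<open>W\<close>, and so do their multiples, so the union runs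
  over equal cosets and, being nonempty, collapses to one.\<close>

lemma quotient_smult:
  assumes x: "x \<in> carrier V"
  shows "c \<odot>\<^bsub>quotient_space V W\<^esub> (W +>\<^bsub>V\<^esub> x) = W +>\<^bsub>V\<^esub> (c \<odot>\<^bsub>V\<^esub> x)"
proof -
  have "W +>\<^bsub>V\<^esub> (c \<odot>\<^bsub>V\<^esub> y) = W +>\<^bsub>V\<^esub> (c \<odot>\<^bsub>V\<^esub> x)" if "y \<in> W +>\<^bsub>V\<^esub> x" for y
  proof -
    have y: "y \<in> carrier V" "y \<ominus>\<^bsub>V\<^esub> x \<in> W"
      using coset_memD[OF that x] coset_eq_iff[of y x] x by auto
    have "c \<odot>\<^bsub>V\<^esub> y \<ominus>\<^bsub>V\<^esub> c \<odot>\<^bsub>V\<^esub> x = c \<odot>\<^bsub>V\<^esub> (y \<ominus>\<^bsub>V\<^esub> x)"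
      using x y by (simp add: a_minus_def V.smult_r_distr V.smult_r_minus)
    then show ?thesis
      using subspaceD(4)[OF W y(2)] x y by (simp add: coset_eq_iff)
  qed
  then have "(\<Union>y\<in>W +>\<^bsub>V\<^esub> x. W +>\<^bsub>V\<^esub> (c \<odot>\<^bsub>V\<^esub> y)) = (\<Union>y\<in>W +>\<^bsub>V\<^esub> x. W +>\<^bsub>V\<^esub> (c \<odot>\<^bsub>V\<^esub> x))"
    by (intro SUP_cong) simp_all
  also have "\<dots> = W +>\<^bsub>V\<^esub> (c \<odot>\<^bsub>V\<^esub> x)"
    using coset_self[OF x] by blast
  finally show ?thesis
    by (simp add: quotient_space_def)
qed

lemma vectorspace_quotient: "vectorspace class_ring (quotient_space V W)"
proof (rule class_vectorspaceI, unfold carrier_quotient, goal_cases)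
  case 1
  show ?case by (auto simp: quotient_zero)
next
  case (3 v)
  then obtain x where x: "x \<in> carrier V" "v = W +>\<^bsub>V\<^esub> x"
    by blast
  show ?case
  proof (rule bexI)
    show "v \<oplus>\<^bsub>quotient_space V W\<^esub> (W +>\<^bsub>V\<^esub> (\<ominus>\<^bsub>V\<^esub> x)) = \<zero>\<^bsub>quotient_space V W\<^esub>"
      using x by (simp add: quotient_add quotient_zero V.r_neg)
    show "W +>\<^bsub>V\<^esub> (\<ominus>\<^bsub>V\<^esub> x) \<in> (\<lambda>x. W +>\<^bsub>V\<^esub> x) ` carrier V"
      using x by blast
  qed
next
  case (5 v w)
  then show ?case by (elim imageE) (simp add: quotient_add V.a_comm)
next
  case (6 u v w)
  then show ?case by (elim imageE) (simp add: quotient_add V.a_assoc)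
next
  case (8 a b v)
  then show ?case using V.smult_assoc1[of a b] by (elim imageE) (simp add: quotient_smult)
next
  case (9 v)
  then show ?case using V.smult_one by (elim imageE) (simp add: quotient_smult)
next
  case (10 a b v)
  then show ?case using V.smult_l_distr[of a b]
    by (elim imageE) (simp add: quotient_smult quotient_add)
next
  case (11 a v w)
  then show ?case using V.smult_r_distr[of a]
    by (elim imageE) (simp add: quotient_smult quotient_add)
qed (elim imageE, simp add: quotient_add quotient_zero quotient_smult)+

lemma coset_hom: "(\<lambda>x. W +>\<^bsub>V\<^esub> x) \<in> module_hom class_ring V (quotient_space V W)"
  by (rule module_homI) (auto simp: carrier_quotient quotient_add quotient_smult)

lemma coset_eq_zero_iff:
  assumes "x \<in> carrier V"
  shows "W +>\<^bsub>V\<^esub> x = \<zero>\<^bsub>quotient_space V W\<^esub> \<longleftrightarrow> x \<in> W"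
proof -
  have "\<ominus>\<^bsub>V\<^esub> \<zero>\<^bsub>V\<^esub> = \<zero>\<^bsub>V\<^esub>"
    by (rule V.minus_equality) simp_all
  then have "x \<ominus>\<^bsub>V\<^esub> \<zero>\<^bsub>V\<^esub> = x"
    unfolding a_minus_def using assms by simp
  then show ?thesis
    unfolding quotient_zero using assms by (subst coset_eq_iff) simp_all
qed

text \<open>Cosets are equal or disjoint, so a coset containing another one is that one. This serves
  to evaluate a union that is known to be a coset when only one of its terms is at hand.\<close>

lemma coset_union_eq:
  assumes "P \<in> carrier (quotient_space V W)" "x \<in> carrier V" "W +>\<^bsub>V\<^esub> x \<subseteq> P"
  shows "P = W +>\<^bsub>V\<^esub> x"
proof -
  obtain y where y: "y \<in> carrier V" "P = W +>\<^bsub>V\<^esub> y"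
    using assms(1) unfolding carrier_quotient by blast
  then have "x \<in> W +>\<^bsub>V\<^esub> y"
    using assms coset_self by blast
  from coset_memD[OF this y(1)] show ?thesis
    using y by simp
qed

end

section \<open>Linear categories and their quotients\<close>

lemma (in abelian_group) minus_eq_zeroD:
  assumes "x \<ominus> y = \<zero>" "x \<in> carrier G" "y \<in> carrier G"
  shows "x = y"
proof -
  have "x = (x \<oplus> \<ominus> y) \<oplus> y"
    using assms(2,3) by (simp add: a_assoc l_neg)
  also have "x \<oplus> \<ominus> y = \<zero>"
    using assms(1) by (simp only: a_minus_def)
  finally show ?thesis using assms(3) by simp
qed

lemma inv_into_hom:
  fixes V :: "('k::field, 'a) module" and W :: "('k, 'b) module"
  assumes "vectorspace class_ring V" and f: "f \<in> module_hom class_ring V W"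
    and bij: "bij_betw f (carrier V) (carrier W)"
  shows "inv_into (carrier V) f \<in> module_hom class_ring W V"
proof -
  interpret V: vectorspace class_ring V by fact
  let ?g = "inv_into (carrier V) f"
  have g: "?g y \<in> carrier V" "f (?g y) = y" if "y \<in> carrier W" for y
    using bij that by (simp_all add: bij_betw_def inv_into_into f_inv_into_f)
  have gf: "?g (f x) = x" if "x \<in> carrier V" for x
    using bij that by (simp add: bij_betw_def)
  show ?thesis
  proof (rule module_homI)
    show "?g (x \<oplus>\<^bsub>W\<^esub> y) = ?g x \<oplus>\<^bsub>V\<^esub> ?g y" if "x \<in> carrier W" "y \<in> carrier W" for x y
      using gf[of "?g x \<oplus>\<^bsub>V\<^esub> ?g y"] hom_add[OF f, of "?g x" "?g y"] g that by simp
    show "?g (c \<odot>\<^bsub>W\<^esub> x) = c \<odot>\<^bsub>V\<^esub> ?g x" if "x \<in> carrier W" for c x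
      using gf[of "c \<odot>\<^bsub>V\<^esub> ?g x"] hom_smult[OF f, of "?g x" c] g that by simp
  qed (rule g)
qed

section \<open>Bilinearity of composition and generated ideals\<close>

context k_category
begin

lemma cmp_closed:
  "\<lbrakk>X \<in> objs C; Y \<in> objs C; Z \<in> objs C; f \<in> carrier (Hom C X Y); g \<in> carrier (Hom C Y Z)\<rbrakk>
    \<Longrightarrow> cmp C X Y Z g f \<in> carrier (Hom C X Z)"
  by (rule hom_closed[OF cmp_linear_right])

lemma cmp_add_right:
  "\<lbrakk>X \<in> objs C; Y \<in> objs C; Z \<in> objs C; f \<in> carrier (Hom C X Y); f' \<in> carrier (Hom C X Y);
    g \<in> carrier (Hom C Y Z)\<rbrakk>
    \<Longrightarrow> cmp C X Y Z g (f \<oplus>\<^bsub>Hom C X Y\<^esub> f') = cmp C X Y Z g f \<oplus>\<^bsub>Hom C X Z\<^esub> cmp C X Y Z g f'"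
  by (rule hom_add[OF cmp_linear_right])

lemma cmp_add_left:
  "\<lbrakk>X \<in> objs C; Y \<in> objs C; Z \<in> objs C; f \<in> carrier (Hom C X Y); g \<in> carrier (Hom C Y Z);
    g' \<in> carrier (Hom C Y Z)\<rbrakk>
    \<Longrightarrow> cmp C X Y Z (g \<oplus>\<^bsub>Hom C Y Z\<^esub> g') f = cmp C X Y Z g f \<oplus>\<^bsub>Hom C X Z\<^esub> cmp C X Y Z g' f"
  by (rule hom_add[OF cmp_linear_left])

lemma cmp_smult_right:
  "\<lbrakk>X \<in> objs C; Y \<in> objs C; Z \<in> objs C; f \<in> carrier (Hom C X Y); g \<in> carrier (Hom C Y Z)\<rbrakk>
    \<Longrightarrow> cmp C X Y Z g (c \<odot>\<^bsub>Hom C X Y\<^esub> f) = c \<odot>\<^bsub>Hom C X Z\<^esub> cmp C X Y Z g f"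
  by (rule hom_smult[OF cmp_linear_right])

lemma cmp_smult_left:
  "\<lbrakk>X \<in> objs C; Y \<in> objs C; Z \<in> objs C; f \<in> carrier (Hom C X Y); g \<in> carrier (Hom C Y Z)\<rbrakk>
    \<Longrightarrow> cmp C X Y Z (c \<odot>\<^bsub>Hom C Y Z\<^esub> g) f = c \<odot>\<^bsub>Hom C X Z\<^esub> cmp C X Y Z g f"
  by (rule hom_smult[OF cmp_linear_left])

lemma cmp_zero_right:
  "\<lbrakk>X \<in> objs C; Y \<in> objs C; Z \<in> objs C; g \<in> carrier (Hom C Y Z)\<rbrakk>
    \<Longrightarrow> cmp C X Y Z g \<zero>\<^bsub>Hom C X Y\<^esub> = \<zero>\<^bsub>Hom C X Z\<^esub>"
  by (rule hom_zero[OF Hom_space Hom_space cmp_linear_right])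

lemma cmp_zero_left:
  "\<lbrakk>X \<in> objs C; Y \<in> objs C; Z \<in> objs C; f \<in> carrier (Hom C X Y)\<rbrakk>
    \<Longrightarrow> cmp C X Y Z \<zero>\<^bsub>Hom C Y Z\<^esub> f = \<zero>\<^bsub>Hom C X Z\<^esub>"
  by (rule hom_zero[OF Hom_space Hom_space cmp_linear_left])

lemma cmp_minus_right:
  "\<lbrakk>X \<in> objs C; Y \<in> objs C; Z \<in> objs C; f \<in> carrier (Hom C X Y); f' \<in> carrier (Hom C X Y);
    g \<in> carrier (Hom C Y Z)\<rbrakk>
    \<Longrightarrow> cmp C X Y Z g (f \<ominus>\<^bsub>Hom C X Y\<^esub> f') = cmp C X Y Z g f \<ominus>\<^bsub>Hom C X Z\<^esub> cmp C X Y Z g f'"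
  by (rule hom_minus[OF Hom_space Hom_space cmp_linear_right])

lemma cmp_minus_left:
  "\<lbrakk>X \<in> objs C; Y \<in> objs C; Z \<in> objs C; f \<in> carrier (Hom C X Y); g \<in> carrier (Hom C Y Z);
    g' \<in> carrier (Hom C Y Z)\<rbrakk>
    \<Longrightarrow> cmp C X Y Z (g \<ominus>\<^bsub>Hom C Y Z\<^esub> g') f = cmp C X Y Z g f \<ominus>\<^bsub>Hom C X Z\<^esub> cmp C X Y Z g' f"
  by (rule hom_minus[OF Hom_space Hom_space cmp_linear_left])

lemma cmp_finsum_right:
  "\<lbrakk>X \<in> objs C; Y \<in> objs C; Z \<in> objs C; \<And>i. i \<in> A \<Longrightarrow> f i \<in> carrier (Hom C X Y);
    g \<in> carrier (Hom C Y Z)\<rbrakk>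
    \<Longrightarrow> cmp C X Y Z g (finsum (Hom C X Y) f A) = finsum (Hom C X Z) (\<lambda>i. cmp C X Y Z g (f i)) A"
  by (rule hom_finsum[OF Hom_space Hom_space cmp_linear_right])

lemma cmp_finsum_left:
  "\<lbrakk>X \<in> objs C; Y \<in> objs C; Z \<in> objs C; f \<in> carrier (Hom C X Y);
    \<And>i. i \<in> A \<Longrightarrow> g i \<in> carrier (Hom C Y Z)\<rbrakk>
    \<Longrightarrow> cmp C X Y Z (finsum (Hom C Y Z) g A) f = finsum (Hom C X Z) (\<lambda>i. cmp C X Y Z (g i) f) A"
  by (rule hom_finsum[OF Hom_space Hom_space cmp_linear_left])

lemma zero_ideal: "two_sided_ideal C (\<lambda>X Y. {\<zero>\<^bsub>Hom C X Y\<^esub>})"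
  by (simp add: two_sided_ideal_def subspace_zero Hom_space cmp_zero_left cmp_zero_right)

text \<open>Each closure condition passes to intersections. The generators are arbitrary triples: if
  one between objects lies outside its morphism space, no ideal contains it, and the intersection of
  the empty family is the whole morphism space, again an ideal.\<close>

lemma generated_ideal_ideal: "two_sided_ideal C (generated_ideal C S)"
  unfolding two_sided_ideal_def
proof (intro conjI ballI)
  fix X Y assume XY: "X \<in> objs C" "Y \<in> objs C"
  interpret H: vectorspace class_ring "Hom C X Y"
    using XY by (rule Hom_space)
  have sub: "VectorSpace.subspace class_ring (I X Y) (Hom C X Y)" if "two_sided_ideal C I" for I
    using that XY by (simp add: two_sided_ideal_def)
  show "VectorSpace.subspace class_ring (generated_ideal C S X Y) (Hom C X Y)"
  proof (rule subspaceI[OF H.vectorspace_axioms])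
    show "generated_ideal C S X Y \<subseteq> carrier (Hom C X Y)"
      by (auto simp: generated_ideal_def)
    show "\<zero>\<^bsub>Hom C X Y\<^esub> \<in> generated_ideal C S X Y"
      using subspaceD(2)[OF sub] by (auto simp: generated_ideal_def)
    show "x \<oplus>\<^bsub>Hom C X Y\<^esub> y \<in> generated_ideal C S X Y"
      if "x \<in> generated_ideal C S X Y" "y \<in> generated_ideal C S X Y" for x y
      using that subspaceD(3)[OF sub] by (auto simp: generated_ideal_def)
    show "c \<odot>\<^bsub>Hom C X Y\<^esub> x \<in> generated_ideal C S X Y"
      if "x \<in> generated_ideal C S X Y" for c x
      using that subspaceD(4)[OF sub] by (auto simp: generated_ideal_def)
  qed
next
  fix X Y Z f g
  assume "X \<in> objs C" "Y \<in> objs C" "Z \<in> objs C"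
    "f \<in> generated_ideal C S X Y" "g \<in> carrier (Hom C Y Z)"
  then show "cmp C X Y Z g f \<in> generated_ideal C S X Z"
    by (auto simp: generated_ideal_def two_sided_ideal_def cmp_closed)
next
  fix X Y Z f g
  assume "X \<in> objs C" "Y \<in> objs C" "Z \<in> objs C"
    "f \<in> carrier (Hom C X Y)" "g \<in> generated_ideal C S Y Z"
  then show "cmp C X Y Z g f \<in> generated_ideal C S X Z"
    by (auto simp: generated_ideal_def two_sided_ideal_def cmp_closed)
qed

end

lemma generated_ideal_least:
  "\<lbrakk>two_sided_ideal C I; \<And>A B h. (A, B, h) \<in> S \<Longrightarrow> h \<in> I A B; f \<in> generated_ideal C S X Y\<rbrakk>
    \<Longrightarrow> f \<in> I X Y"
  by (auto simp: generated_ideal_def)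

lemma generated_ideal_base:
  "\<lbrakk>(A, B, h) \<in> S; h \<in> carrier (Hom C A B)\<rbrakk> \<Longrightarrow> h \<in> generated_ideal C S A B"
  by (auto simp: generated_ideal_def)

lemma two_sided_idealD:
  assumes "two_sided_ideal C I"
  shows "\<lbrakk>X \<in> objs C; Y \<in> objs C\<rbrakk> \<Longrightarrow> VectorSpace.subspace class_ring (I X Y) (Hom C X Y)"
    and "\<lbrakk>X \<in> objs C; Y \<in> objs C; Z \<in> objs C; f \<in> I X Y; g \<in> carrier (Hom C Y Z)\<rbrakk>
      \<Longrightarrow> cmp C X Y Z g f \<in> I X Z"
    and "\<lbrakk>X \<in> objs C; Y \<in> objs C; Z \<in> objs C; f \<in> carrier (Hom C X Y); g \<in> I Y Z\<rbrakk>
      \<Longrightarrow> cmp C X Y Z g f \<in> I X Z"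
  using assms by (simp_all add: two_sided_ideal_def)

lemma quotient_cat_simps [simp]:
  "objs (quotient_cat C I) = objs C"
  "Hom (quotient_cat C I) X Y = quotient_space (Hom C X Y) (I X Y)"
  "idm (quotient_cat C I) X = cls C I X X (idm C X)"
  by (simp_all add: quotient_cat_def)

section \<open>Quotient of a linear category by an ideal\<close>

locale k_category_ideal = k_category C
  for C :: "('o, 'm, 'k::field) kcat" +
  fixes I
  assumes ideal: "two_sided_ideal C I"
begin

lemma quotient_of_Hom: "\<lbrakk>X \<in> objs C; Y \<in> objs C\<rbrakk> \<Longrightarrow> quotient_of_space (Hom C X Y) (I X Y)"
  by (simp add: quotient_of_space_def quotient_of_space_axioms_def Hom_space two_sided_idealD(1)[OF ideal])

context
  fixes X Y assumes XY: "X \<in> objs C" "Y \<in> objs C"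
begin

interpretation quotient_of_space "Hom C X Y" "I X Y"
  using XY by (rule quotient_of_Hom)

lemma carrier_quotient_Hom: "carrier (quotient_space (Hom C X Y) (I X Y)) = cls C I X Y ` carrier (Hom C X Y)"
  by (simp add: carrier_quotient cls_def)

lemma cls_hom: "cls C I X Y \<in> module_hom class_ring (Hom C X Y) (quotient_space (Hom C X Y) (I X Y))"
  using coset_hom by (simp add: cls_def[abs_def])

lemma cls_eq_iff:
  "\<lbrakk>f \<in> carrier (Hom C X Y); g \<in> carrier (Hom C X Y)\<rbrakk>
    \<Longrightarrow> cls C I X Y f = cls C I X Y g \<longleftrightarrow> f \<ominus>\<^bsub>Hom C X Y\<^esub> g \<in> I X Y"
  by (simp add: cls_def coset_eq_iff)

lemma cls_eq_zero_iff:
  "f \<in> carrier (Hom C X Y)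
    \<Longrightarrow> cls C I X Y f = \<zero>\<^bsub>quotient_space (Hom C X Y) (I X Y)\<^esub> \<longleftrightarrow> f \<in> I X Y"
  by (simp add: cls_def coset_eq_zero_iff)

lemma cls_memD:
  "\<lbrakk>g \<in> cls C I X Y f; f \<in> carrier (Hom C X Y)\<rbrakk>
    \<Longrightarrow> g \<in> carrier (Hom C X Y) \<and> cls C I X Y g = cls C I X Y f"
  using coset_memD[of g f] by (simp add: cls_def)

lemma cls_self: "f \<in> carrier (Hom C X Y) \<Longrightarrow> f \<in> cls C I X Y f"
  by (simp add: cls_def coset_self)

lemma quotient_Hom_space: "vectorspace class_ring (quotient_space (Hom C X Y) (I X Y))"
  by (rule vectorspace_quotient)

end

text \<open>The factors are exchanged one at a time: g f - g f' = g (f - f') and g f' - g' f' = (g -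
  g') f' both lie in the ideal.\<close>

lemma cls_cong_cmp:
  assumes "X \<in> objs C" "Y \<in> objs C" "Z \<in> objs C"
    and "f \<in> carrier (Hom C X Y)" "f' \<in> carrier (Hom C X Y)" "cls C I X Y f = cls C I X Y f'"
    and "g \<in> carrier (Hom C Y Z)" "g' \<in> carrier (Hom C Y Z)" "cls C I Y Z g = cls C I Y Z g'"
  shows "cls C I X Z (cmp C X Y Z g f) = cls C I X Z (cmp C X Y Z g' f')"
proof -
  have "f \<ominus>\<^bsub>Hom C X Y\<^esub> f' \<in> I X Y" "g \<ominus>\<^bsub>Hom C Y Z\<^esub> g' \<in> I Y Z"
    using assms by (simp_all add: cls_eq_iff)
  then have "cmp C X Y Z g (f \<ominus>\<^bsub>Hom C X Y\<^esub> f') \<in> I X Z" "cmp C X Y Z (g \<ominus>\<^bsub>Hom C Y Z\<^esub> g') f' \<in> I X Z"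
    using assms two_sided_idealD(2,3)[OF ideal] by blast+
  then have "cls C I X Z (cmp C X Y Z g f) = cls C I X Z (cmp C X Y Z g f')"
    "cls C I X Z (cmp C X Y Z g f') = cls C I X Z (cmp C X Y Z g' f')"
    using assms by (simp_all add: cls_eq_iff cmp_closed cmp_minus_left cmp_minus_right)
  then show ?thesis by simp
qed

text \<open>The composite of classes is a union over all pairs of representatives; by
  \<open>cls_cong_cmp\<close> every term of the union is the same class. All laws of the quotient
  category are then checked on representatives.\<close>

lemma cmp_cls:
  assumes "X \<in> objs C" "Y \<in> objs C" "Z \<in> objs C"
    and "f \<in> carrier (Hom C X Y)" "g \<in> carrier (Hom C Y Z)"
  shows "cmp (quotient_cat C I) X Y Z (cls C I Y Z g) (cls C I X Y f) = cls C I X Z (cmp C X Y Z g f)"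
proof -
  have "cls C I X Z (cmp C X Y Z g' f') = cls C I X Z (cmp C X Y Z g f)"
    if "g' \<in> cls C I Y Z g" "f' \<in> cls C I X Y f" for g' f'
    using cls_memD[of Y Z g' g] cls_memD[of X Y f' f] that assms by (intro cls_cong_cmp) simp_all
  then have "cmp (quotient_cat C I) X Y Z (cls C I Y Z g) (cls C I X Y f)
      = (\<Union>g'\<in>cls C I Y Z g. \<Union>f'\<in>cls C I X Y f. cls C I X Z (cmp C X Y Z g f))"
    by (auto simp: quotient_cat_def intro!: SUP_cong)
  also have "\<dots> = cls C I X Z (cmp C X Y Z g f)"
    using cls_self[of Y Z g] cls_self[of X Y f] assms by blast
  finally show ?thesis .
qed

sublocale quotient: k_category "quotient_cat C I"
proof (rule k_category.intro, goal_cases)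
  case (1 X Y)
  then show ?case by (simp add: quotient_Hom_space)
next
  case (2 X)
  then show ?case by (simp add: carrier_quotient_Hom idm_closed)
next
  case (3 X Y Z g)
  then obtain g' where g: "g' \<in> carrier (Hom C Y Z)" "g = cls C I Y Z g'"
    by (auto simp: carrier_quotient_Hom)
  show ?case
  proof (rule module_homI, goal_cases)
    case (1 f)
    then show ?case using 3 g by (auto simp: carrier_quotient_Hom cmp_cls cmp_closed)
  next
    case (2 f h)
    interpret H: vectorspace class_ring "Hom C X Y" using 3 by (simp add: Hom_space)
    from 2 3 g show ?case
      by (auto simp: carrier_quotient_Hom cmp_cls cmp_closed cmp_add_right
          simp flip: hom_add[OF cls_hom])
  next
    case (3 c f)
    interpret H: vectorspace class_ring "Hom C X Y" using \<open>X \<in> _\<close> \<open>Y \<in> _\<close> by (simp add: Hom_space)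
    from 3 \<open>X \<in> _\<close> \<open>Y \<in> _\<close> \<open>Z \<in> _\<close> g show ?case
      by (auto simp: carrier_quotient_Hom cmp_cls cmp_closed cmp_smult_right
          simp flip: hom_smult[OF cls_hom])
  qed
next
  case (4 X Y Z f)
  then obtain f' where f: "f' \<in> carrier (Hom C X Y)" "f = cls C I X Y f'"
    by (auto simp: carrier_quotient_Hom)
  show ?case
  proof (rule module_homI, goal_cases)
    case (1 g)
    then show ?case using 4 f by (auto simp: carrier_quotient_Hom cmp_cls cmp_closed)
  next
    case (2 g h)
    interpret H: vectorspace class_ring "Hom C Y Z" using 4 by (simp add: Hom_space)
    from 2 4 f show ?case
      by (auto simp: carrier_quotient_Hom cmp_cls cmp_closed cmp_add_left
          simp flip: hom_add[OF cls_hom])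
  next
    case (3 c g)
    interpret H: vectorspace class_ring "Hom C Y Z" using 4 by (simp add: Hom_space)
    from 3 4 f show ?case
      by (auto simp: carrier_quotient_Hom cmp_cls cmp_closed cmp_smult_left
          simp flip: hom_smult[OF cls_hom])
  qed
next
  case (5 X Y f)
  then show ?case by (auto simp: carrier_quotient_Hom cmp_cls idm_closed cmp_idm_left)
next
  case (6 X Y f)
  then show ?case by (auto simp: carrier_quotient_Hom cmp_cls idm_closed cmp_idm_right)
next
  case (7 W X Y Z f g h)
  then show ?case by (auto simp: carrier_quotient_Hom cmp_cls cmp_closed cmp_assoc)
qed

lemma cls_functor: "k_functor C (quotient_cat C I) \<lparr>on_obj = \<lambda>X. X, on_hom = cls C I\<rparr>"
  by unfold_locales (simp_all add: cls_hom cmp_cls)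

end

section \<open>Functors, ideals and factorization through quotients\<close>

context k_functor
begin

lemma on_hom_closed:
  "\<lbrakk>X \<in> objs C; Y \<in> objs C; f \<in> carrier (Hom C X Y)\<rbrakk>
    \<Longrightarrow> on_hom F X Y f \<in> carrier (Hom D (on_obj F X) (on_obj F Y))"
  by (rule hom_closed[OF on_hom_linear])

lemma preimage_ideal:
  assumes J: "two_sided_ideal D J"
  shows "two_sided_ideal C
    (\<lambda>X Y. {f \<in> carrier (Hom C X Y). on_hom F X Y f \<in> J (on_obj F X) (on_obj F Y)})"
  unfolding two_sided_ideal_def
proof (intro conjI ballI)
  fix X Y assume XY: "X \<in> objs C" "Y \<in> objs C"
  interpret H: vectorspace class_ring "Hom C X Y"
    using XY by (rule dom.Hom_space)
  have sub: "VectorSpace.subspace class_ring (J (on_obj F X) (on_obj F Y)) (Hom D (on_obj F X) (on_obj F Y))"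
    using J XY by (simp add: two_sided_idealD(1) on_obj_closed)
  note lin = on_hom_linear[OF XY]
  show "VectorSpace.subspace class_ring
      {f \<in> carrier (Hom C X Y). on_hom F X Y f \<in> J (on_obj F X) (on_obj F Y)} (Hom C X Y)"
  proof (rule subspaceI[OF H.vectorspace_axioms], goal_cases)
    case 2
    have "on_hom F X Y \<zero>\<^bsub>Hom C X Y\<^esub> = \<zero>\<^bsub>Hom D (on_obj F X) (on_obj F Y)\<^esub>"
      using XY by (intro hom_zero[OF _ _ lin]) (simp_all add: dom.Hom_space cod.Hom_space on_obj_closed)
    then show ?case using subspaceD(2)[OF sub] by simp
  next
    case (3 x y)
    then show ?case using subspaceD(3)[OF sub] by (simp add: hom_add[OF lin])
  next
    case (4 c x)
    then show ?case using subspaceD(4)[OF sub] by (simp add: hom_smult[OF lin])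
  qed auto
next
  fix X Y Z f g
  assume *: "X \<in> objs C" "Y \<in> objs C" "Z \<in> objs C" "g \<in> carrier (Hom C Y Z)"
    "f \<in> {f \<in> carrier (Hom C X Y). on_hom F X Y f \<in> J (on_obj F X) (on_obj F Y)}"
  then show "cmp C X Y Z g f \<in> {f \<in> carrier (Hom C X Z). on_hom F X Z f \<in> J (on_obj F X) (on_obj F Z)}"
    by (simp add: dom.cmp_closed on_hom_cmp two_sided_idealD(2)[OF J] on_obj_closed on_hom_closed)
next
  fix X Y Z f g
  assume *: "X \<in> objs C" "Y \<in> objs C" "Z \<in> objs C" "f \<in> carrier (Hom C X Y)"
    "g \<in> {f \<in> carrier (Hom C Y Z). on_hom F Y Z f \<in> J (on_obj F Y) (on_obj F Z)}"
  then show "cmp C X Y Z g f \<in> {f \<in> carrier (Hom C X Z). on_hom F X Z f \<in> J (on_obj F X) (on_obj F Z)}"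
    by (simp add: dom.cmp_closed on_hom_cmp two_sided_idealD(3)[OF J] on_obj_closed on_hom_closed)
qed

text \<open>The preimage of \<open>J\<close> is an ideal that contains the generators, hence
  everything they generate. With \<open>J\<close> zero this shows that a functor kills an ideal,
  with other \<open>J\<close> that it carries one ideal into another; elements of a generated ideal
  never have to be written as sums.\<close>

lemma generated_ideal_preimage:
  assumes "two_sided_ideal D J"
    and "\<And>A B h. (A, B, h) \<in> S
      \<Longrightarrow> h \<in> carrier (Hom C A B) \<and> on_hom F A B h \<in> J (on_obj F A) (on_obj F B)"
    and "f \<in> generated_ideal C S X Y"
  shows "on_hom F X Y f \<in> J (on_obj F X) (on_obj F Y)"
  using generated_ideal_least[OF preimage_ideal[OF assms(1)], of S f X Y] assms(2,3) by blast

lemma factor_quotient: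
  assumes I: "two_sided_ideal C I"
    and van: "\<And>X Y f. \<lbrakk>X \<in> objs C; Y \<in> objs C; f \<in> I X Y\<rbrakk>
      \<Longrightarrow> on_hom F X Y f = \<zero>\<^bsub>Hom D (on_obj F X) (on_obj F Y)\<^esub>"
  shows "\<exists>F'. k_functor (quotient_cat C I) D F' \<and> on_obj F' = on_obj F \<and>
    (\<forall>X\<in>objs C. \<forall>Y\<in>objs C. \<forall>f\<in>carrier (Hom C X Y).
      on_hom F' X Y (cls C I X Y f) = on_hom F X Y f)"
proof -
  interpret CI: k_category_ideal C I
    using I dom.k_category_axioms by (simp add: k_category_ideal_def k_category_ideal_axioms_def)
  \<comment> \<open>Any representative will do: two of them differ by an element of
    \<open>I\<close>, which \<open>F\<close> sends to zero.\<close>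
  define F' where "F' = \<lparr>on_obj = on_obj F, on_hom = (\<lambda>X Y P. on_hom F X Y (SOME f. f \<in> P))\<rparr>"
  have obj: "on_obj F' = on_obj F"
    by (simp add: F'_def)
  have hom: "on_hom F' X Y (cls C I X Y f) = on_hom F X Y f"
    if XY: "X \<in> objs C" "Y \<in> objs C" and f: "f \<in> carrier (Hom C X Y)" for X Y f
  proof -
    interpret H: vectorspace class_ring "Hom D (on_obj F X) (on_obj F Y)"
      using XY by (simp add: cod.Hom_space on_obj_closed)
    define g where "g = (SOME f'. f' \<in> cls C I X Y f)"
    have "g \<in> cls C I X Y f"
      unfolding g_def using CI.cls_self[OF XY f] by (rule someI)
    from CI.cls_memD[OF XY this f] have g: "g \<in> carrier (Hom C X Y)" "cls C I X Y g = cls C I X Y f"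
      by auto
    then have "g \<ominus>\<^bsub>Hom C X Y\<^esub> f \<in> I X Y"
      using CI.cls_eq_iff[OF XY g(1) f] by simp
    then have "on_hom F X Y (g \<ominus>\<^bsub>Hom C X Y\<^esub> f) = \<zero>\<^bsub>Hom D (on_obj F X) (on_obj F Y)\<^esub>"
      by (rule van[OF XY])
    then have "on_hom F X Y g \<ominus>\<^bsub>Hom D (on_obj F X) (on_obj F Y)\<^esub> on_hom F X Y f
        = \<zero>\<^bsub>Hom D (on_obj F X) (on_obj F Y)\<^esub>"
      using hom_minus[OF dom.Hom_space[OF XY] H.vectorspace_axioms on_hom_linear[OF XY] g(1) f] by simp
    then have "on_hom F X Y g = on_hom F X Y f"
      using H.minus_eq_zeroD on_hom_closed XY f g(1) by blast
    then show ?thesis by (simp add: F'_def g_def)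
  qed
  have "k_functor (quotient_cat C I) D F'"
  proof (unfold_locales, goal_cases)
    case (1 X)
    then show ?case by (simp add: obj on_obj_closed)
  next
    case (2 X Y)
    then have XY: "X \<in> objs C" "Y \<in> objs C" by auto
    interpret H: vectorspace class_ring "Hom C X Y" using XY by (rule dom.Hom_space)
    note [simp] = XY hom obj
    show ?case
    proof (rule module_homI, goal_cases)
      case (1 f)
      then show ?case by (auto simp: CI.carrier_quotient_Hom on_hom_closed)
    next
      case (2 f g)
      then show ?case
        by (auto simp: CI.carrier_quotient_Hom hom_add[OF on_hom_linear]
          simp flip: hom_add[OF CI.cls_hom])
    next
      case (3 c f)
      then show ?case
        by (auto simp: CI.carrier_quotient_Hom hom_smult[OF on_hom_linear]
          simp flip: hom_smult[OF CI.cls_hom])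
    qed
  next
    case (3 X)
    then show ?case by (simp add: hom obj dom.idm_closed on_hom_idm)
  next
    case (4 X Y Z f g)
    then show ?case
      by (auto simp: CI.carrier_quotient_Hom CI.cmp_cls hom obj dom.cmp_closed on_hom_cmp)
  qed
  with obj hom show ?thesis by blast
qed

text \<open>The functor that can be constructed ends in the triangular category, while the
  isomorphism wanted starts there. Hence the conclusion concerns the inverse, whose functor laws
  follow from those of \<open>F\<close> by injectivity.\<close>

lemma inverse_isomorphism:
  assumes obj: "bij_betw (on_obj F) (objs C) (objs D)"
    and hom: "\<And>X Y. \<lbrakk>X \<in> objs C; Y \<in> objs C\<rbrakk>
      \<Longrightarrow> bij_betw (on_hom F X Y) (carrier (Hom C X Y)) (carrier (Hom D (on_obj F X) (on_obj F Y)))"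
  shows "\<exists>G. k_isomorphism D C G"
proof -
  define g where "g = inv_into (objs C) (on_obj F)"
  \<comment> \<open>The inverse is taken separately for every pair of objects, because morphism
    spaces may overlap and a morphism does not determine its ends.\<close>
  define h where "h X Y = inv_into (carrier (Hom C (g X) (g Y))) (on_hom F (g X) (g Y))" for X Y
  define G where "G = \<lparr>on_obj = g, on_hom = h\<rparr>"
  have g: "g X \<in> objs C" "on_obj F (g X) = X" if "X \<in> objs D" for X
    using obj that by (simp_all add: g_def bij_betw_def inv_into_into f_inv_into_f)
  have gF: "g (on_obj F X) = X" if "X \<in> objs C" for X
    using obj that by (simp add: g_def bij_betw_def)
  have bij: "bij_betw (on_hom F (g X) (g Y)) (carrier (Hom C (g X) (g Y))) (carrier (Hom D X Y))"
    if "X \<in> objs D" "Y \<in> objs D" for X Y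
    using hom[of "g X" "g Y"] g that by simp
  have h: "h X Y f \<in> carrier (Hom C (g X) (g Y))" "on_hom F (g X) (g Y) (h X Y f) = f"
    if "X \<in> objs D" "Y \<in> objs D" "f \<in> carrier (Hom D X Y)" for X Y f
    using bij[of X Y] that by (simp_all add: h_def bij_betw_def inv_into_into f_inv_into_f)
  have h_eq: "h X Y f' = f"
    if "X \<in> objs D" "Y \<in> objs D" "f \<in> carrier (Hom C (g X) (g Y))" "on_hom F (g X) (g Y) f = f'" for X Y f f'
    using bij[of X Y] that by (auto simp: h_def bij_betw_def)
  have "k_functor D C G"
  proof (unfold_locales, goal_cases)
    case (2 X Y)
    have "inv_into (carrier (Hom C (g X) (g Y))) (on_hom F (g X) (g Y))
        \<in> module_hom class_ring (Hom D X Y) (Hom C (g X) (g Y))"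
      using on_hom_linear[of "g X" "g Y"] 2 g bij
      by (intro inv_into_hom dom.Hom_space) simp_all
    then show ?case by (simp add: G_def h_def)
  next
    case (3 X)
    then show ?case
      by (simp add: G_def, intro h_eq) (simp_all add: g dom.idm_closed on_hom_idm)
  next
    case (4 X Y Z f g')
    then show ?case
      by (simp add: G_def, intro h_eq) (simp_all add: g h dom.cmp_closed on_hom_cmp)
  qed (simp add: G_def g)
  then show ?thesis
    unfolding k_isomorphism_def
    by (intro exI[of _ G] conjI exI[of _ F] k_functor_axioms)
      (auto simp: G_def g gF h on_hom_closed on_obj_closed intro!: h_eq)
qed

end

section \<open>Formal linear combinations\<close>

abbreviation (input) "keys \<equiv> Poly_Mapping.keys"
abbreviation (input) "single \<equiv> Poly_Mapping.single"
abbreviation (input) "lookup \<equiv> Poly_Mapping.lookup"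

lemma lookup_scale [simp]: "lookup (scale c x) a = c * lookup x a"
  by (simp add: scale_def Poly_Mapping.map.rep_eq when_def)

lemma scale_simps [simp]:
  fixes x :: "'a \<Rightarrow>\<^sub>0 'k::field"
  shows "scale c 0 = (0 :: 'a \<Rightarrow>\<^sub>0 'k)" "scale 0 x = 0" "scale 1 x = x"
    "scale c (single a d) = single a (c * d)"
    "scale c (scale d x) = scale (c * d) x"
  by (auto intro!: poly_mapping_eqI simp: lookup_single when_def)

lemma scale_add: "scale c (x + y) = scale c x + scale c (y :: 'a \<Rightarrow>\<^sub>0 'k::field)"
  by (rule poly_mapping_eqI) (simp add: lookup_add algebra_simps)

lemma scale_add_left: "scale (c + d) x = scale c x + scale d (x :: 'a \<Rightarrow>\<^sub>0 'k::field)"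
  by (rule poly_mapping_eqI) (simp add: lookup_add algebra_simps)

lemma scale_minus_one: "x + scale (- 1) x = (0 :: 'a \<Rightarrow>\<^sub>0 'k::field)"
  by (rule poly_mapping_eqI) (simp add: lookup_add)

lemma scale_sum: "scale c (sum f A) = (\<Sum>i\<in>A. scale c (f i :: 'a \<Rightarrow>\<^sub>0 'k::field))"
  by (rule poly_mapping_eqI) (simp add: lookup_sum sum_distrib_left)

lemma keys_scale: "keys (scale c x) \<subseteq> keys (x :: 'a \<Rightarrow>\<^sub>0 'k::field)"
  by (auto simp: in_keys_iff)

lemma keys_subset_add:
  "\<lbrakk>keys x \<subseteq> S; keys y \<subseteq> S\<rbrakk> \<Longrightarrow> keys (x + y) \<subseteq> S"
  using Poly_Mapping.keys_add[of x y] by blast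

lemma keys_subset_scale:
  "keys x \<subseteq> S \<Longrightarrow> keys (scale c (x :: 'a \<Rightarrow>\<^sub>0 'k::field)) \<subseteq> S"
  using keys_scale[of c x] by blast

lemma keys_subset_sum:
  "(\<And>i. i \<in> A \<Longrightarrow> keys (f i) \<subseteq> S) \<Longrightarrow> keys (sum f A) \<subseteq> S"
  by (induct A rule: infinite_finite_induct) (simp_all add: keys_subset_add)

lemma keys_subset_single: "a \<in> S \<Longrightarrow> keys (single a c) \<subseteq> S"
  by (simp add: keys_single)

lemma sum_singles:
  "(\<Sum>a\<in>keys x. single a (lookup x a)) = x"
proof (rule poly_mapping_eqI)
  fix b
  have "(\<Sum>a\<in>keys x. lookup (single a (lookup x a)) b)
      = (\<Sum>a\<in>keys x. if a = b then lookup x b else 0)"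
    by (intro sum.cong) (auto simp: lookup_single when_def)
  then show "lookup (\<Sum>a\<in>keys x. single a (lookup x a)) b
      = lookup x b"
    by (simp add: lookup_sum in_keys_iff)
qed

lemma keys_induct [consumes 1, case_names zero single add]:
  fixes x :: "'a \<Rightarrow>\<^sub>0 'k::comm_monoid_add"
  assumes "keys x \<subseteq> S"
    and "P 0"
    and "\<And>a c. a \<in> S \<Longrightarrow> P (single a c)"
    and "\<And>x y. \<lbrakk>keys x \<subseteq> S; keys y \<subseteq> S; P x; P y\<rbrakk> \<Longrightarrow> P (x + y)"
  shows "P x"
proof -
  have "keys (\<Sum>a\<in>A. single a (lookup x a)) \<subseteq> S
      \<and> P (\<Sum>a\<in>A. single a (lookup x a))" if "finite A" "A \<subseteq> S" for A
    using that
  proof induct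
    case (insert a A)
    then show ?case
      using assms(3,4) by (simp add: keys_subset_add keys_subset_single del: keys_single)
  qed (simp add: assms(2))
  from this[OF finite_keys assms(1)] show ?thesis
    by (simp only: sum_singles)
qed

text \<open>The definition sums over the exact supports, which may shrink under addition and under
  scaling by zero. Over any larger finite sets the extra coefficients vanish, so two arguments can
  be expanded over a common set and compared term by term.\<close>

lemma bilinear_ext_superset:
  assumes "finite A" "finite B" "keys x \<subseteq> A" "keys y \<subseteq> B"
  shows "bilinear_ext \<phi> x y
    = (\<Sum>a\<in>A. \<Sum>b\<in>B. single (\<phi> a b) (lookup x a * lookup y b))"
proof -
  have "(\<Sum>b\<in>B. single (\<phi> a b) (lookup x a * lookup y b))
      = (\<Sum>b\<in>keys y. single (\<phi> a b) (lookup x a * lookup y b))" for a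
    using assms by (intro sum.mono_neutral_right) (auto simp: in_keys_iff)
  moreover have "(\<Sum>a\<in>A. \<Sum>b\<in>keys y. single (\<phi> a b) (lookup x a * lookup y b))
      = bilinear_ext \<phi> x y"
    unfolding bilinear_ext_def using assms
    by (intro sum.mono_neutral_right) (auto simp: in_keys_iff)
  ultimately show ?thesis by simp
qed

context
  fixes \<phi> :: "'a \<Rightarrow> 'b \<Rightarrow> 'c"
begin

lemma bilinear_ext_zero [simp]:
  "bilinear_ext \<phi> (0 :: 'a \<Rightarrow>\<^sub>0 'k::field) y = 0" "bilinear_ext \<phi> x (0 :: 'b \<Rightarrow>\<^sub>0 'k) = 0"
  by (simp_all add: bilinear_ext_def)

lemma bilinear_ext_add_left:
  "bilinear_ext \<phi> (x + x') y = bilinear_ext \<phi> x y + bilinear_ext \<phi> x' (y :: 'b \<Rightarrow>\<^sub>0 'k::field)"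
proof -
  let ?A = "keys x \<union> keys x'" and ?B = "keys y"
  have "keys (x + x') \<subseteq> ?A"
    by (rule Poly_Mapping.keys_add)
  then show ?thesis
    by (simp add: bilinear_ext_superset[of ?A ?B] lookup_add algebra_simps single_add sum.distrib)
qed

lemma bilinear_ext_add_right:
  "bilinear_ext \<phi> x (y + y') = bilinear_ext \<phi> x y + bilinear_ext \<phi> x (y' :: 'b \<Rightarrow>\<^sub>0 'k::field)"
proof -
  let ?A = "keys x" and ?B = "keys y \<union> keys y'"
  have "keys (y + y') \<subseteq> ?B"
    by (rule Poly_Mapping.keys_add)
  then show ?thesis
    by (simp add: bilinear_ext_superset[of ?A ?B] lookup_add algebra_simps single_add sum.distrib)
qed

lemma bilinear_ext_scale_left:
  "bilinear_ext \<phi> (scale c x) y = scale c (bilinear_ext \<phi> x (y :: 'b \<Rightarrow>\<^sub>0 'k::field))"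
  by (simp add: bilinear_ext_superset[OF finite_keys finite_keys keys_scale order_refl]
      bilinear_ext_def[of \<phi> x y] scale_sum mult.assoc)

lemma bilinear_ext_scale_right:
  "bilinear_ext \<phi> x (scale c y) = scale c (bilinear_ext \<phi> x (y :: 'b \<Rightarrow>\<^sub>0 'k::field))"
  by (simp add: bilinear_ext_superset[OF finite_keys finite_keys order_refl keys_scale]
      bilinear_ext_def[of \<phi> x y] scale_sum mult.left_commute)

lemma bilinear_ext_sum_left:
  "bilinear_ext \<phi> (sum f A) y = (\<Sum>i\<in>A. bilinear_ext \<phi> (f i) (y :: 'b \<Rightarrow>\<^sub>0 'k::field))"
  by (induct A rule: infinite_finite_induct) (simp_all add: bilinear_ext_add_left)

lemma bilinear_ext_sum_right:
  "bilinear_ext \<phi> x (sum f A) = (\<Sum>i\<in>A. bilinear_ext \<phi> x (f i :: 'b \<Rightarrow>\<^sub>0 'k::field))"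
  by (induct A rule: infinite_finite_induct) (simp_all add: bilinear_ext_add_right)

lemma bilinear_ext_single [simp]:
  "bilinear_ext \<phi> (single a c) (single b (d :: 'k::field))
    = single (\<phi> a b) (c * d)"
proof -
  have "bilinear_ext \<phi> (single a c) (single b d)
    = (\<Sum>a'\<in>{a}. \<Sum>b'\<in>{b}. single (\<phi> a' b')
        (lookup (single a c) a' * lookup (single b d) b'))"
    by (rule bilinear_ext_superset) (simp_all add: keys_single)
  then show ?thesis by simp
qed

lemma keys_bilinear_ext:
  assumes "keys x \<subseteq> A" "keys (y :: 'b \<Rightarrow>\<^sub>0 'k::field) \<subseteq> B"
    "\<And>a b. a \<in> A \<Longrightarrow> b \<in> B \<Longrightarrow> \<phi> a b \<in> S"
  shows "keys (bilinear_ext \<phi> x y) \<subseteq> S"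
  unfolding bilinear_ext_def using assms by (intro keys_subset_sum keys_subset_single) blast

end

section \<open>Multiplication of combinations of paths\<close>

abbreviation path_mult :: "('e list \<Rightarrow>\<^sub>0 'k::field) \<Rightarrow> ('e list \<Rightarrow>\<^sub>0 'k) \<Rightarrow> ('e list \<Rightarrow>\<^sub>0 'k)" where
  "path_mult \<equiv> bilinear_ext (\<lambda>q p. p @ q)"

lemma path_mult_assoc: "path_mult z (path_mult y x) = path_mult (path_mult z y) x"
proof (induct x rule: keys_induct[OF subset_UNIV])
  case (2 a c)
  show ?case
  proof (induct y rule: keys_induct[OF subset_UNIV])
    case (2 b d)
    show ?case
      by (induct z rule: keys_induct[OF subset_UNIV]) (simp_all add: bilinear_ext_add_left mult.assoc)
  qed (simp_all add: bilinear_ext_add_left bilinear_ext_add_right)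
qed (simp_all add: bilinear_ext_add_right)

lemma path_mult_one [simp]:
  "path_mult x (single [] 1) = x" "path_mult (single [] 1) x = x"
  by (induct x rule: keys_induct[OF subset_UNIV]; simp add: bilinear_ext_add_left bilinear_ext_add_right)+

lemma linear_ext_superset:
  assumes "finite A" "keys x \<subseteq> A"
  shows "linear_ext \<phi> x = (\<Sum>a\<in>A. single (\<phi> a) (lookup x a))"
  unfolding linear_ext_def using assms by (intro sum.mono_neutral_left) (auto simp: in_keys_iff)

lemma linear_ext_zero [simp]: "linear_ext \<phi> 0 = 0"
  by (simp add: linear_ext_def)

lemma linear_ext_single [simp]: "linear_ext \<phi> (single a c) = single (\<phi> a) c"
  using linear_ext_superset[of "{a}" "single a c" \<phi>] by (simp add: keys_single)

lemma linear_ext_add: "linear_ext \<phi> (x + y) = linear_ext \<phi> x + linear_ext \<phi> y"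
proof -
  let ?A = "keys x \<union> keys y"
  have "keys (x + y) \<subseteq> ?A"
    by (rule Poly_Mapping.keys_add)
  then show ?thesis
    by (simp add: linear_ext_superset[of ?A] lookup_add single_add sum.distrib)
qed

lemma linear_ext_scale: "linear_ext \<phi> (scale c x) = scale c (linear_ext \<phi> (x :: 'a \<Rightarrow>\<^sub>0 'k::field))"
  by (simp add: linear_ext_superset[OF finite_keys keys_scale] linear_ext_def[of \<phi> x] scale_sum)

lemma linear_ext_sum: "linear_ext \<phi> (sum f A) = (\<Sum>i\<in>A. linear_ext \<phi> (f i))"
  by (induct A rule: infinite_finite_induct) (simp_all add: linear_ext_add)

lemma keys_linear_ext: "keys (linear_ext \<phi> x) \<subseteq> \<phi> ` keys x"
  unfolding linear_ext_def by (intro keys_subset_sum keys_subset_single) simp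

lemma linear_ext_path_mult:
  "linear_ext (map h) (path_mult y x) = path_mult (linear_ext (map h) y) (linear_ext (map h) x)"
proof (induct x rule: keys_induct[OF subset_UNIV])
  case (2 a c)
  show ?case
    by (induct y rule: keys_induct[OF subset_UNIV]) (simp_all add: bilinear_ext_add_left linear_ext_add)
qed (simp_all add: bilinear_ext_add_right linear_ext_add)

lemma linear_ext_surj:
  assumes "keys x \<subseteq> \<phi> ` S"
  shows "\<exists>y. keys y \<subseteq> S \<and> linear_ext \<phi> y = x"
  using assms
proof (induct x rule: keys_induct)
  case zero
  show ?case by (intro exI[of _ 0]) simp
next
  case (single a c)
  then obtain b where "b \<in> S" "a = \<phi> b" by blast
  then show ?case by (intro exI[of _ "single b c"]) (simp add: keys_single)
next
  case (add x y)
  then obtain x' y' where "keys x' \<subseteq> S" "linear_ext \<phi> x' = x"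
    "keys y' \<subseteq> S" "linear_ext \<phi> y' = y" by blast
  then show ?case by (intro exI[of _ "x' + y'"]) (simp add: linear_ext_add keys_subset_add)
qed

lemma free_space_vectorspace: "vectorspace class_ring (free_space S :: ('k::field, 'a \<Rightarrow>\<^sub>0 'k) module)"
proof (rule class_vectorspaceI, goal_cases)
  case (3 v)
  then show ?case
    by (intro bexI[of _ "scale (- 1) v"]) (simp_all add: free_space_def scale_minus_one keys_subset_scale)
qed (simp_all add: free_space_def keys_subset_add keys_subset_scale scale_add scale_add_left add_ac)


section \<open>The path category\<close>

lemma fst_slot: "x \<in> slots X \<Longrightarrow> fst x \<in># X"
  by (auto simp: slots_def count_greater_zero_iff[symmetric] simp del: count_greater_zero_iff)

lemma finite_slots [simp]: "finite (slots X)"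
proof -
  have "slots X \<subseteq> Sigma (set_mset X) (\<lambda>a. {..<count X a})"
    using fst_slot[of _ X] by (fastforce simp: slots_def)
  then show ?thesis by (rule finite_subset) auto
qed

lemma slots_single [simp]: "slots {#a#} = {(a, 0)}"
  by (auto simp: slots_def split: if_splits)

lemma path_cat_simps:
  "objs (path_cat G) = {X. set_mset X \<subseteq> verts G}"
  "f \<in> carrier (Hom (path_cat G) X Y) \<longleftrightarrow>
    (\<forall>x\<in>slots X. \<forall>y\<in>slots Y. keys (f x y) \<subseteq> {p. pre_digraph.awalk G (fst x) p (fst y)}) \<and>
    (\<forall>x y. x \<notin> slots X \<or> y \<notin> slots Y \<longrightarrow> f x y = 0)"
  "\<zero>\<^bsub>Hom (path_cat G) X Y\<^esub> = (\<lambda>x y. 0)"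
  "f \<oplus>\<^bsub>Hom (path_cat G) X Y\<^esub> g = (\<lambda>x y. f x y + g x y)"
  "c \<odot>\<^bsub>Hom (path_cat G) X Y\<^esub> f = (\<lambda>x y. scale c (f x y))"
  "idm (path_cat G) X = (\<lambda>x y. if x = y \<and> x \<in> slots X then single [] 1 else 0)"
  "cmp (path_cat G) X Y Z g f = (\<lambda>x z. \<Sum>y\<in>slots Y. path_mult (g y z) (f x y))"
  by (auto simp: path_cat_def simp del: split_paired_All)

lemma path_cat_homI:
  assumes "\<And>x y. x \<in> slots X \<Longrightarrow> y \<in> slots Y
      \<Longrightarrow> keys (f x y) \<subseteq> {p. pre_digraph.awalk G (fst x) p (fst y)}"
    and "\<And>x y. x \<notin> slots X \<or> y \<notin> slots Y \<Longrightarrow> f x y = 0"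
  shows "f \<in> carrier (Hom (path_cat G) X Y)"
  using assms unfolding path_cat_simps by blast

lemma path_cat_homD:
  assumes "f \<in> carrier (Hom (path_cat G) X Y)"
  shows "\<lbrakk>x \<in> slots X; y \<in> slots Y\<rbrakk>
      \<Longrightarrow> keys (f x y) \<subseteq> {p. pre_digraph.awalk G (fst x) p (fst y)}"
    and "x \<notin> slots X \<Longrightarrow> f x y = 0" and "y \<notin> slots Y \<Longrightarrow> f x y = 0"
  using assms unfolding path_cat_simps by blast+

lemma path_cat_Hom_space: "vectorspace class_ring (Hom (path_cat G) X Y :: ('k::field, _) module)"
proof (rule class_vectorspaceI, goal_cases)
  case (3 f)
  then show ?case
    by (intro bexI[of _ "\<lambda>x y. scale (- 1) (f x y)"])
      (simp_all add: path_cat_simps scale_minus_one keys_subset_scale)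
qed (simp_all add: path_cat_simps fun_eq_iff keys_subset_add keys_subset_scale scale_add scale_add_left add_ac)

context wf_digraph
begin

lemma path_cat_cmp_closed:
  assumes f: "f \<in> carrier (Hom (path_cat G) X Y)" and g: "g \<in> carrier (Hom (path_cat G) Y Z)"
  shows "cmp (path_cat G) X Y Z g f \<in> carrier (Hom (path_cat G) X Z)"
  unfolding path_cat_simps(7)
proof (rule path_cat_homI)
  fix x z assume xz: "x \<in> slots X" "z \<in> slots Z"
  show "keys (\<Sum>y\<in>slots Y. path_mult (g y z) (f x y)) \<subseteq> {p. awalk (fst x) p (fst z)}"
  proof (rule keys_subset_sum)
    fix y assume "y \<in> slots Y"
    with xz show "keys (path_mult (g y z) (f x y)) \<subseteq> {p. awalk (fst x) p (fst z)}"
      by (intro keys_bilinear_ext[OF path_cat_homD(1)[OF g] path_cat_homD(1)[OF f]])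
        (simp_all del: awalk_append_iff add: awalk_appendI)
  qed
next
  fix x z assume "x \<notin> slots X \<or> z \<notin> slots Z"
  then show "(\<Sum>y\<in>slots Y. path_mult (g y z) (f x y)) = 0"
    by (elim disjE) (simp_all add: path_cat_homD(2)[OF f] path_cat_homD(3)[OF g])
qed

lemma path_cat_category: "k_category (path_cat G :: ('a multiset, ('a, 'b, 'k::field) path_mor, 'k) kcat)"
proof (rule k_category.intro, goal_cases)
  case (1 X Y)
  show ?case by (rule path_cat_Hom_space)
next
  case (2 X)
  then show ?case
    by (intro path_cat_homI) (auto simp: path_cat_simps awalk_Nil_iff dest: fst_slot split: if_splits)
next
  case (3 X Y Z g)
  note path_cat_cmp_closed[where X = X and Y = Y and Z = Z, OF _ 3(4)]
  then show ?case
    by (rule module_homI) (simp_all add: path_cat_simps(4,5,7) bilinear_ext_add_right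
        bilinear_ext_scale_right sum.distrib scale_sum)
next
  case (4 X Y Z f)
  note path_cat_cmp_closed[where X = X and Y = Y and Z = Z, OF 4(4)]
  then show ?case
    by (rule module_homI) (simp_all add: path_cat_simps(4,5,7) bilinear_ext_add_left
        bilinear_ext_scale_left sum.distrib scale_sum)
next
  case (5 X Y f)
  have "(\<Sum>y'\<in>slots Y. path_mult (idm (path_cat G) Y y' y) (f x y')) = f x y" for x y
  proof -
    have "(\<Sum>y'\<in>slots Y. path_mult (idm (path_cat G) Y y' y) (f x y'))
        = (\<Sum>y'\<in>slots Y. if y' = y then f x y else 0)"
      by (intro sum.cong) (auto simp: path_cat_simps(6))
    then show ?thesis using path_cat_homD(3)[OF 5(3)] by simp
  qed
  then show ?case by (simp add: path_cat_simps(7))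
next
  case (6 X Y f)
  have "(\<Sum>x'\<in>slots X. path_mult (f x' y) (idm (path_cat G) X x x')) = f x y" for x y
  proof -
    have "(\<Sum>x'\<in>slots X. path_mult (f x' y) (idm (path_cat G) X x x'))
        = (\<Sum>x'\<in>slots X. if x' = x then f x y else 0)"
      by (intro sum.cong) (auto simp: path_cat_simps(6))
    then show ?thesis using path_cat_homD(2)[OF 6(3)] by simp
  qed
  then show ?case by (simp add: path_cat_simps(7))
next
  case (7 W X Y Z f g h)
  \<comment> \<open>Associativity of a matrix product: after distributing, the two sides differ only
    in the order of summation over the slots of the two middle objects.\<close>
  show ?case
    unfolding path_cat_simps(7) bilinear_ext_sum_right bilinear_ext_sum_left path_mult_assoc
    by (subst sum.swap) (rule refl)
qed

end

lemma finsum_path_cat: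
  assumes "finite A" "\<And>i. i \<in> A \<Longrightarrow> f i \<in> carrier (Hom (path_cat G) X Y)"
  shows "finsum (Hom (path_cat G) X Y) f A = (\<lambda>x y. \<Sum>i\<in>A. f i x y :: _ \<Rightarrow>\<^sub>0 'k::field)"
proof -
  interpret H: vectorspace class_ring "Hom (path_cat G) X Y"
    by (rule path_cat_Hom_space)
  show ?thesis using assms
  proof (induct A)
    case empty
    then show ?case by (simp add: path_cat_simps(3))
  next
    case (insert a A)
    then have "f \<in> A \<rightarrow> carrier (Hom (path_cat G) X Y)" "f a \<in> carrier (Hom (path_cat G) X Y)" by auto
    with insert show ?case by (simp add: H.finsum_insert path_cat_simps(4))
  qed
qed

section \<open>Matrix units of the path category\<close>

definition entry :: "'v \<times> nat \<Rightarrow> 'v \<times> nat \<Rightarrow> ('e list \<Rightarrow>\<^sub>0 'k::zero) \<Rightarrow> ('v, 'e, 'k) path_mor" where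
  "entry x y h = (\<lambda>x' y'. if x' = x \<and> y' = y then h else 0)"

lemma path_mor_entry: "path_mor a b = entry (a, 0) (b, 0)"
  by (simp add: fun_eq_iff path_mor_def entry_def)

lemma idm_single: "idm (path_cat G) {#a#} = entry (a, 0) (a, 0) (single [] 1)"
  by (auto simp: path_cat_simps entry_def fun_eq_iff)

lemma entry_closed:
  "\<lbrakk>x \<in> slots X; y \<in> slots Y; keys h \<subseteq> {p. pre_digraph.awalk G (fst x) p (fst y)}\<rbrakk>
    \<Longrightarrow> entry x y h \<in> carrier (Hom (path_cat G) X Y)"
  by (auto simp: path_cat_simps entry_def)

lemma cmp_entry:
  assumes "y \<in> slots Y"
  shows "cmp (path_cat G) X Y Z (entry y' z h') (entry x y h)
    = (if y = y' then entry x z (path_mult h' h) else (\<lambda>x y. 0))"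
proof -
  have "(\<Sum>y''\<in>slots Y. path_mult (entry y' z h' y'' z'') (entry x y h x'' y''))
      = (if y = y' then entry x z (path_mult h' h) x'' z'' else 0)" for x'' z''
  proof -
    have "(\<Sum>y''\<in>slots Y. path_mult (entry y' z h' y'' z'') (entry x y h x'' y''))
        = (\<Sum>y''\<in>slots Y. if y'' = y then path_mult (entry y' z h' y z'') (entry x y h x'' y) else 0)"
      by (intro sum.cong) (auto simp: entry_def)
    also have "\<dots> = path_mult (entry y' z h' y z'') (entry x y h x'' y)"
      using assms by simp
    finally show ?thesis by (auto simp: entry_def)
  qed
  then show ?thesis by (simp add: path_cat_simps(7) fun_eq_iff)
qed

text \<open>A category in which the object assigned to a multiset of vertices is a biproduct of the
  objects assigned to its elements.\<close>

locale vertex_biproducts = k_category D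
  for D :: "('p, 'n, 'k::field) kcat" +
  fixes Vs :: "'v set" and ob :: "'v multiset \<Rightarrow> 'p" and inc prj :: "'v multiset \<Rightarrow> 'v \<times> nat \<Rightarrow> 'n"
  assumes ob_closed: "set_mset X \<subseteq> Vs \<Longrightarrow> ob X \<in> objs D"
    and inc_closed: "\<lbrakk>set_mset X \<subseteq> Vs; x \<in> slots X\<rbrakk> \<Longrightarrow> inc X x \<in> carrier (Hom D (ob {#fst x#}) (ob X))"
    and prj_closed: "\<lbrakk>set_mset X \<subseteq> Vs; x \<in> slots X\<rbrakk> \<Longrightarrow> prj X x \<in> carrier (Hom D (ob X) (ob {#fst x#}))"
    and prj_inc: "\<lbrakk>set_mset X \<subseteq> Vs; x \<in> slots X\<rbrakk>
      \<Longrightarrow> cmp D (ob {#fst x#}) (ob X) (ob {#fst x#}) (prj X x) (inc X x) = idm D (ob {#fst x#})"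
    and prj_inc_zero: "\<lbrakk>set_mset X \<subseteq> Vs; x \<in> slots X; y \<in> slots X; x \<noteq> y\<rbrakk>
      \<Longrightarrow> cmp D (ob {#fst x#}) (ob X) (ob {#fst y#}) (prj X y) (inc X x)
          = \<zero>\<^bsub>Hom D (ob {#fst x#}) (ob {#fst y#})\<^esub>"
    and sum_inc_prj: "set_mset X \<subseteq> Vs \<Longrightarrow> finsum (Hom D (ob X) (ob X))
        (\<lambda>x. cmp D (ob X) (ob {#fst x#}) (ob X) (inc X x) (prj X x)) (slots X) = idm D (ob X)"
    and inc_single: "a \<in> Vs \<Longrightarrow> inc {#a#} (a, 0) = idm D (ob {#a#})"
    and prj_single: "a \<in> Vs \<Longrightarrow> prj {#a#} (a, 0) = idm D (ob {#a#})"

lemma (in vertex_biproducts) ob_slot_closed: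
  "\<lbrakk>x \<in> slots X; set_mset X \<subseteq> Vs\<rbrakk> \<Longrightarrow> ob {#fst x#} \<in> objs D"
  using fst_slot[of x X] by (intro ob_closed) auto

definition path_inc :: "'v multiset \<Rightarrow> 'v \<times> nat \<Rightarrow> ('v, 'e, 'k::field) path_mor" where
  "path_inc X x = entry (fst x, 0) x (single [] 1)"

definition path_prj :: "'v multiset \<Rightarrow> 'v \<times> nat \<Rightarrow> ('v, 'e, 'k::field) path_mor" where
  "path_prj X x = entry x (fst x, 0) (single [] 1)"

lemma (in wf_digraph) path_cat_biproducts:
  "vertex_biproducts (path_cat G :: ('a multiset, ('a, 'b, 'k::field) path_mor, 'k) kcat)
    (verts G) (\<lambda>X. X) path_inc path_prj"
proof (intro vertex_biproducts.intro path_cat_category vertex_biproducts_axioms.intro, goal_cases)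
  case (1 X)
  then show ?case by (simp add: path_cat_simps)
next
  case (2 X x)
  then show ?case
    by (auto simp: path_inc_def keys_single awalk_Nil_iff dest: fst_slot intro!: entry_closed)
next
  case (3 X x)
  then show ?case
    by (auto simp: path_prj_def keys_single awalk_Nil_iff dest: fst_slot intro!: entry_closed)
next
  case (4 X x)
  then show ?case
    by (simp add: path_inc_def path_prj_def cmp_entry idm_single)
next
  case (5 X x y)
  then show ?case
    by (simp add: path_inc_def path_prj_def cmp_entry path_cat_simps(3))
next
  case (6 X)
  have eq: "cmp (path_cat G) X {#fst x#} X (path_inc X x) (path_prj X x) = entry x x (single [] (1::'k))"
    for x by (simp add: path_inc_def path_prj_def cmp_entry)
  have "entry x x (single [] (1::'k)) \<in> carrier (Hom (path_cat G) X X)" if "x \<in> slots X" for x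
    using 6 that by (auto simp: keys_single awalk_Nil_iff dest: fst_slot intro!: entry_closed)
  then have "finsum (Hom (path_cat G) X X) (\<lambda>x. entry x x (single [] (1::'k))) (slots X)
      = (\<lambda>x' y'. \<Sum>x\<in>slots X. entry x x (single [] 1) x' y')"
    by (intro finsum_path_cat) simp_all
  also have "\<dots> = idm (path_cat G) X"
  proof (intro ext)
    fix x' y' :: "'a \<times> nat"
    have "(\<Sum>x\<in>slots X. entry x x (single [] 1) x' y')
        = (\<Sum>x\<in>slots X. if x = x' then (if x' = y' then single [] (1::'k) else 0) else 0)"
      by (intro sum.cong) (auto simp: entry_def)
    also have "\<dots> = idm (path_cat G) X x' y'"
      by (simp add: path_cat_simps(6))
    finally show "(\<Sum>x\<in>slots X. entry x x (single [] (1::'k)) x' y') = idm (path_cat G) X x' y'" .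
  qed
  finally show ?case by (simp only: eq)
next
  case (7 a)
  show ?case by (simp add: path_inc_def idm_single)
next
  case (8 a)
  show ?case by (simp add: path_prj_def idm_single)
qed

text \<open>Biproducts are described by equations between sums, composites and identities, which
  every linear functor preserves. Applied to the quotient functors, this equips the bound path
  categories of both quivers with biproducts.\<close>

lemma (in k_functor) biproducts_image:
  assumes "vertex_biproducts C Vs ob inc prj"
  shows "vertex_biproducts D Vs (\<lambda>X. on_obj F (ob X)) (\<lambda>X x. on_hom F (ob {#fst x#}) (ob X) (inc X x))
    (\<lambda>X x. on_hom F (ob X) (ob {#fst x#}) (prj X x))"
proof -
  interpret B: vertex_biproducts C Vs ob inc prj by fact
  note [simp] = on_obj_closed on_hom_closed B.ob_closed B.inc_closed B.prj_closed B.ob_slot_closed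
  show ?thesis
  proof (intro vertex_biproducts.intro cod.k_category_axioms vertex_biproducts_axioms.intro, goal_cases)
    case (4 X x)
    then show ?case
      using on_hom_cmp[of "ob {#fst x#}" "ob X" "ob {#fst x#}" "inc X x" "prj X x"]
      by (simp add: B.prj_inc on_hom_idm)
  next
    case (5 X x y)
    then have "on_hom F (ob {#fst x#}) (ob {#fst y#}) \<zero>\<^bsub>Hom C (ob {#fst x#}) (ob {#fst y#})\<^esub>
      = \<zero>\<^bsub>Hom D (on_obj F (ob {#fst x#})) (on_obj F (ob {#fst y#}))\<^esub>"
      by (intro hom_zero dom.Hom_space cod.Hom_space on_hom_linear) simp_all
    with 5 show ?case
      using on_hom_cmp[of "ob {#fst x#}" "ob X" "ob {#fst y#}" "inc X x" "prj X y"]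
      by (simp add: B.prj_inc_zero)
  next
    case (6 X)
    let ?e = "\<lambda>x. cmp C (ob X) (ob {#fst x#}) (ob X) (inc X x) (prj X x)"
    interpret H: vectorspace class_ring "Hom D (on_obj F (ob X)) (on_obj F (ob X))"
      using 6 by (intro cod.Hom_space) simp_all
    have e: "?e x \<in> carrier (Hom C (ob X) (ob X))" if "x \<in> slots X" for x
      using that 6 by (intro dom.cmp_closed) simp_all
    have "finsum (Hom D (on_obj F (ob X)) (on_obj F (ob X))) (\<lambda>x. cmp D (on_obj F (ob X)) (on_obj F (ob {#fst x#})) (on_obj F (ob X))
        (on_hom F (ob {#fst x#}) (ob X) (inc X x)) (on_hom F (ob X) (ob {#fst x#}) (prj X x))) (slots X)
      = finsum (Hom D (on_obj F (ob X)) (on_obj F (ob X))) (\<lambda>x. on_hom F (ob X) (ob X) (?e x)) (slots X)"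
      using 6 e by (intro H.finsum_cong') (auto simp: on_hom_cmp)
    also have "\<dots> = on_hom F (ob X) (ob X) (finsum (Hom C (ob X) (ob X)) ?e (slots X))"
      using 6 e by (intro hom_finsum[symmetric] dom.Hom_space cod.Hom_space on_hom_linear) simp_all
    also have "\<dots> = idm D (on_obj F (ob X))"
      using 6 by (simp add: B.sum_inc_prj on_hom_idm)
    finally show ?case .
  qed (simp_all add: B.inc_single B.prj_single on_hom_idm)
qed

lemma (in abelian_monoid) finsum_only:
  assumes "finite A" "a \<in> A" "f a \<in> carrier G" "\<And>i. i \<in> A \<Longrightarrow> i \<noteq> a \<Longrightarrow> f i = \<zero>"
  shows "finsum G f A = f a"
proof -
  have "finsum G f A = finsum G (\<lambda>i. if i = a then f a else \<zero>) A"
    using assms by (intro finsum_cong') auto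
  also have "\<dots> = f a"
    using finsum_singleton[of a A "\<lambda>_. f a"] assms by (simp add: eq_commute)
  finally show ?thesis .
qed

section \<open>Matrix calculus in a category with biproducts\<close>

context vertex_biproducts
begin

lemma slot_simps:
  assumes "set_mset X \<subseteq> Vs" "x \<in> slots X"
  shows "ob X \<in> objs D" "ob {#fst x#} \<in> objs D" "inc X x \<in> carrier (Hom D (ob {#fst x#}) (ob X))"
    "prj X x \<in> carrier (Hom D (ob X) (ob {#fst x#}))"
  using assms by (simp_all add: ob_closed ob_slot_closed inc_closed prj_closed)

text \<open>Writing the identity of the source as the sum of all \<open>inc\<close> after
  \<open>prj\<close> recovers a morphism from its composites with the inclusions, that is, from its
  columns. \<open>eq_if_prj_eq\<close> is the dual statement for rows, and both together determine a
  morphism by its matrix.\<close>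

lemma eq_if_inc_eq:
  assumes X: "set_mset X \<subseteq> Vs" and A: "A \<in> objs D"
    and h: "h \<in> carrier (Hom D (ob X) A)" "h' \<in> carrier (Hom D (ob X) A)"
    and eq: "\<And>x. x \<in> slots X \<Longrightarrow> cmp D (ob {#fst x#}) (ob X) A h (inc X x) = cmp D (ob {#fst x#}) (ob X) A h' (inc X x)"
  shows "h = h'"
proof -
  interpret H: vectorspace class_ring "Hom D (ob X) A"
    using X A by (intro Hom_space ob_closed)
  have "k = finsum (Hom D (ob X) A) (\<lambda>x. cmp D (ob X) (ob {#fst x#}) A
      (cmp D (ob {#fst x#}) (ob X) A k (inc X x)) (prj X x)) (slots X)"
    if k: "k \<in> carrier (Hom D (ob X) A)" for k
  proof -
    have "k = cmp D (ob X) (ob X) A k (finsum (Hom D (ob X) (ob X))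
        (\<lambda>x. cmp D (ob X) (ob {#fst x#}) (ob X) (inc X x) (prj X x)) (slots X))"
      using X A k by (simp add: sum_inc_prj cmp_idm_right ob_closed)
    also have "\<dots> = finsum (Hom D (ob X) A) (\<lambda>x. cmp D (ob X) (ob X) A k
        (cmp D (ob X) (ob {#fst x#}) (ob X) (inc X x) (prj X x))) (slots X)"
      using X A k by (intro cmp_finsum_right cmp_closed) (simp_all add: ob_closed slot_simps[OF X])
    also have "\<dots> = finsum (Hom D (ob X) A) (\<lambda>x. cmp D (ob X) (ob {#fst x#}) A
      (cmp D (ob {#fst x#}) (ob X) A k (inc X x)) (prj X x)) (slots X)"
      using X A k by (intro H.finsum_cong' Pi_I) (simp_all add: cmp_assoc cmp_closed ob_closed slot_simps[OF X])
    finally show ?thesis .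
  qed
  note key = this
  have "finsum (Hom D (ob X) A) (\<lambda>x. cmp D (ob X) (ob {#fst x#}) A
      (cmp D (ob {#fst x#}) (ob X) A h (inc X x)) (prj X x)) (slots X)
    = finsum (Hom D (ob X) A) (\<lambda>x. cmp D (ob X) (ob {#fst x#}) A
      (cmp D (ob {#fst x#}) (ob X) A h' (inc X x)) (prj X x)) (slots X)"
    using X A h by (intro H.finsum_cong' Pi_I) (simp_all add: eq cmp_closed ob_closed slot_simps[OF X])
  then show ?thesis
    by (rule trans[OF key[OF h(1)] trans[OF _ key[OF h(2), symmetric]]])
qed

lemma eq_if_prj_eq:
  assumes X: "set_mset X \<subseteq> Vs" and A: "A \<in> objs D"
    and h: "h \<in> carrier (Hom D A (ob X))" "h' \<in> carrier (Hom D A (ob X))"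
    and eq: "\<And>x. x \<in> slots X \<Longrightarrow> cmp D A (ob X) (ob {#fst x#}) (prj X x) h = cmp D A (ob X) (ob {#fst x#}) (prj X x) h'"
  shows "h = h'"
proof -
  interpret H: vectorspace class_ring "Hom D A (ob X)"
    using X A by (intro Hom_space ob_closed)
  have "k = finsum (Hom D A (ob X)) (\<lambda>x. cmp D A (ob {#fst x#}) (ob X) (inc X x)
      (cmp D A (ob X) (ob {#fst x#}) (prj X x) k)) (slots X)"
    if k: "k \<in> carrier (Hom D A (ob X))" for k
  proof -
    have "k = cmp D A (ob X) (ob X) (finsum (Hom D (ob X) (ob X))
        (\<lambda>x. cmp D (ob X) (ob {#fst x#}) (ob X) (inc X x) (prj X x)) (slots X)) k"
      using X A k by (simp add: sum_inc_prj cmp_idm_left ob_closed)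
    also have "\<dots> = finsum (Hom D A (ob X)) (\<lambda>x. cmp D A (ob X) (ob X)
        (cmp D (ob X) (ob {#fst x#}) (ob X) (inc X x) (prj X x)) k) (slots X)"
      using X A k by (intro cmp_finsum_left cmp_closed) (simp_all add: ob_closed slot_simps[OF X])
    also have "\<dots> = finsum (Hom D A (ob X)) (\<lambda>x. cmp D A (ob {#fst x#}) (ob X) (inc X x)
      (cmp D A (ob X) (ob {#fst x#}) (prj X x) k)) (slots X)"
      using X A k
      by (intro H.finsum_cong' Pi_I) (simp_all add: cmp_assoc cmp_closed ob_closed slot_simps[OF X])
    finally show ?thesis .
  qed
  note key = this
  have "finsum (Hom D A (ob X)) (\<lambda>x. cmp D A (ob {#fst x#}) (ob X) (inc X x)
      (cmp D A (ob X) (ob {#fst x#}) (prj X x) h)) (slots X)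
    = finsum (Hom D A (ob X)) (\<lambda>x. cmp D A (ob {#fst x#}) (ob X) (inc X x)
      (cmp D A (ob X) (ob {#fst x#}) (prj X x) h')) (slots X)"
    using X A h by (intro H.finsum_cong' Pi_I) (simp_all add: eq cmp_closed ob_closed slot_simps[OF X])
  then show ?thesis
    by (rule trans[OF key[OF h(1)] trans[OF _ key[OF h(2), symmetric]]])
qed

definition component :: "'v multiset \<Rightarrow> 'v multiset \<Rightarrow> 'n \<Rightarrow> 'v \<times> nat \<Rightarrow> 'v \<times> nat \<Rightarrow> 'n" where
  "component X Y h x y = cmp D (ob {#fst x#}) (ob Y) (ob {#fst y#}) (prj Y y)
     (cmp D (ob {#fst x#}) (ob X) (ob Y) h (inc X x))"

lemma component_closed:
  assumes "set_mset X \<subseteq> Vs" "set_mset Y \<subseteq> Vs" "x \<in> slots X" "y \<in> slots Y" "h \<in> carrier (Hom D (ob X) (ob Y))"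
  shows "component X Y h x y \<in> carrier (Hom D (ob {#fst x#}) (ob {#fst y#}))"
  unfolding component_def using assms slot_simps[of X x] slot_simps[of Y y]
  by (intro cmp_closed)

lemma component_hom:
  assumes X: "set_mset X \<subseteq> Vs" and Y: "set_mset Y \<subseteq> Vs" and x: "x \<in> slots X" and y: "y \<in> slots Y"
  shows "(\<lambda>h. component X Y h x y) \<in> module_hom class_ring (Hom D (ob X) (ob Y)) (Hom D (ob {#fst x#}) (ob {#fst y#}))"
  unfolding component_def using slot_simps[OF X x] slot_simps[OF Y y]
  by (intro hom_compose[OF cmp_linear_left cmp_linear_right])

lemma eq_if_component_eq:
  assumes X: "set_mset X \<subseteq> Vs" and Y: "set_mset Y \<subseteq> Vs"
    and h: "h \<in> carrier (Hom D (ob X) (ob Y))" "h' \<in> carrier (Hom D (ob X) (ob Y))"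
    and eq: "\<And>x y. x \<in> slots X \<Longrightarrow> y \<in> slots Y \<Longrightarrow> component X Y h x y = component X Y h' x y"
  shows "h = h'"
proof (rule eq_if_inc_eq[OF X ob_closed[OF Y] h])
  fix x assume x: "x \<in> slots X"
  show "cmp D (ob {#fst x#}) (ob X) (ob Y) h (inc X x) = cmp D (ob {#fst x#}) (ob X) (ob Y) h' (inc X x)"
    by (rule eq_if_prj_eq[OF Y slot_simps(2)[OF X x]])
      (use h eq[OF x] in \<open>simp_all add: component_def cmp_closed slot_simps[OF X x] ob_closed[OF Y]\<close>)
qed

text \<open>A morphism with the prescribed matrix is assembled in two stages. All entries ending at
  \<open>y\<close> are first joined to a row \<open>r y\<close> defined on the whole of
  \<open>X\<close>, then the rows are joined through the inclusions into \<open>Y\<close>. The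
  relations between \<open>prj\<close> and \<open>inc\<close> leave one summand in each
  stage.\<close>

lemma ex_component:
  assumes X: "set_mset X \<subseteq> Vs" and Y: "set_mset Y \<subseteq> Vs"
    and m: "\<And>x y. x \<in> slots X \<Longrightarrow> y \<in> slots Y \<Longrightarrow> m x y \<in> carrier (Hom D (ob {#fst x#}) (ob {#fst y#}))"
  shows "\<exists>h\<in>carrier (Hom D (ob X) (ob Y)). \<forall>x\<in>slots X. \<forall>y\<in>slots Y. component X Y h x y = m x y"
proof -
  define r where "r y = finsum (Hom D (ob X) (ob {#fst y#}))
    (\<lambda>x. cmp D (ob X) (ob {#fst x#}) (ob {#fst y#}) (m x y) (prj X x)) (slots X)" for y
  have summand: "cmp D (ob X) (ob {#fst x#}) (ob {#fst y#}) (m x y) (prj X x)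
      \<in> carrier (Hom D (ob X) (ob {#fst y#}))" if "x \<in> slots X" "y \<in> slots Y" for x y
    using m[OF that] slot_simps[OF X that(1)] slot_simps[OF Y that(2)] by (intro cmp_closed)
  have r_closed: "r y \<in> carrier (Hom D (ob X) (ob {#fst y#}))" if y: "y \<in> slots Y" for y
  proof -
    interpret H: vectorspace class_ring "Hom D (ob X) (ob {#fst y#})"
      using ob_closed[OF X] slot_simps[OF Y y] by (intro Hom_space)
    show ?thesis
      unfolding r_def using summand[OF _ y] by (intro H.finsum_closed) auto
  qed
  have r_inc: "cmp D (ob {#fst x#}) (ob X) (ob {#fst y#}) (r y) (inc X x) = m x y"
    if x: "x \<in> slots X" and y: "y \<in> slots Y" for x y
  proof -
    note [simp] = slot_simps[OF X x] slot_simps[OF Y y]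
    interpret H: vectorspace class_ring "Hom D (ob {#fst x#}) (ob {#fst y#})"
      by (intro Hom_space) simp_all
    have "cmp D (ob {#fst x#}) (ob X) (ob {#fst y#}) (r y) (inc X x)
      = finsum (Hom D (ob {#fst x#}) (ob {#fst y#})) (\<lambda>x'. cmp D (ob {#fst x#}) (ob X) (ob {#fst y#})
        (cmp D (ob X) (ob {#fst x'#}) (ob {#fst y#}) (m x' y) (prj X x')) (inc X x)) (slots X)"
      unfolding r_def using summand[OF _ y] by (intro cmp_finsum_left) simp_all
    also have "\<dots> = finsum (Hom D (ob {#fst x#}) (ob {#fst y#})) (\<lambda>x'. cmp D (ob {#fst x#}) (ob {#fst x'#}) (ob {#fst y#})
        (m x' y) (cmp D (ob {#fst x#}) (ob X) (ob {#fst x'#}) (prj X x') (inc X x))) (slots X)"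
      using m y by (intro H.finsum_cong' Pi_I) (simp_all add: slot_simps[OF X] cmp_assoc cmp_closed)
    also have "\<dots> = cmp D (ob {#fst x#}) (ob {#fst x#}) (ob {#fst y#})
        (m x y) (cmp D (ob {#fst x#}) (ob X) (ob {#fst x#}) (prj X x) (inc X x))"
      using m[OF _ y] x X
      by (intro H.finsum_only) (simp_all add: slot_simps[OF X] prj_inc_zero prj_inc cmp_zero_right cmp_closed idm_closed)
    also have "\<dots> = m x y"
      using m[OF x y] x X by (simp add: prj_inc cmp_idm_right)
    finally show ?thesis .
  qed
  define h where "h = finsum (Hom D (ob X) (ob Y))
    (\<lambda>y. cmp D (ob X) (ob {#fst y#}) (ob Y) (inc Y y) (r y)) (slots Y)"
  have summand': "cmp D (ob X) (ob {#fst y#}) (ob Y) (inc Y y) (r y) \<in> carrier (Hom D (ob X) (ob Y))"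
    if "y \<in> slots Y" for y
    using r_closed[OF that] ob_closed[OF X] slot_simps[OF Y that] by (intro cmp_closed)
  have h_closed: "h \<in> carrier (Hom D (ob X) (ob Y))"
  proof -
    interpret H: vectorspace class_ring "Hom D (ob X) (ob Y)"
      using ob_closed[OF X] ob_closed[OF Y] by (intro Hom_space)
    show ?thesis
      unfolding h_def using summand' by (intro H.finsum_closed) auto
  qed
  have prj_h: "cmp D (ob X) (ob Y) (ob {#fst y#}) (prj Y y) h = r y" if y: "y \<in> slots Y" for y
  proof -
    note [simp] = slot_simps[OF Y y] ob_closed[OF X]
    interpret H: vectorspace class_ring "Hom D (ob X) (ob {#fst y#})"
      by (intro Hom_space) simp_all
    have "cmp D (ob X) (ob Y) (ob {#fst y#}) (prj Y y) h
      = finsum (Hom D (ob X) (ob {#fst y#})) (\<lambda>y'. cmp D (ob X) (ob Y) (ob {#fst y#}) (prj Y y)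
        (cmp D (ob X) (ob {#fst y'#}) (ob Y) (inc Y y') (r y'))) (slots Y)"
      unfolding h_def using summand' by (intro cmp_finsum_right) simp_all
    also have "\<dots> = finsum (Hom D (ob X) (ob {#fst y#})) (\<lambda>y'. cmp D (ob X) (ob {#fst y'#}) (ob {#fst y#})
        (cmp D (ob {#fst y'#}) (ob Y) (ob {#fst y#}) (prj Y y) (inc Y y')) (r y')) (slots Y)"
      using r_closed by (intro H.finsum_cong' Pi_I) (simp_all add: slot_simps[OF Y] cmp_assoc cmp_closed)
    also have "\<dots> = cmp D (ob X) (ob {#fst y#}) (ob {#fst y#})
        (cmp D (ob {#fst y#}) (ob Y) (ob {#fst y#}) (prj Y y) (inc Y y)) (r y)"
      using r_closed y Y
      by (intro H.finsum_only) (simp_all add: slot_simps[OF Y] prj_inc_zero prj_inc cmp_zero_left cmp_closed idm_closed)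
    also have "\<dots> = r y"
      using r_closed[OF y] y Y by (simp add: prj_inc cmp_idm_left)
    finally show ?thesis .
  qed
  have "component X Y h x y = m x y" if x: "x \<in> slots X" and y: "y \<in> slots Y" for x y
  proof -
    have "component X Y h x y = cmp D (ob {#fst x#}) (ob X) (ob {#fst y#}) (cmp D (ob X) (ob Y) (ob {#fst y#}) (prj Y y) h) (inc X x)"
      unfolding component_def using slot_simps[OF X x] slot_simps[OF Y y] h_closed by (intro cmp_assoc)
    then show ?thesis using r_inc[OF x y] prj_h[OF y] by simp
  qed
  then show ?thesis using h_closed by blast
qed

text \<open>The rule for matrix products: the identity of the middle object, written as the sum of
  all \<open>inc\<close> after \<open>prj\<close>, is inserted between \<open>g\<close> and
  \<open>f\<close>.\<close>

lemma component_cmp: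
  assumes X: "set_mset X \<subseteq> Vs" and Y: "set_mset Y \<subseteq> Vs" and Z: "set_mset Z \<subseteq> Vs"
    and f: "f \<in> carrier (Hom D (ob X) (ob Y))" and g: "g \<in> carrier (Hom D (ob Y) (ob Z))"
    and x: "x \<in> slots X" and z: "z \<in> slots Z"
  shows "component X Z (cmp D (ob X) (ob Y) (ob Z) g f) x z = finsum (Hom D (ob {#fst x#}) (ob {#fst z#}))
    (\<lambda>y. cmp D (ob {#fst x#}) (ob {#fst y#}) (ob {#fst z#}) (component Y Z g y z) (component X Y f x y)) (slots Y)"
proof -
  note [simp] = slot_simps[OF X x] slot_simps[OF Z z] ob_closed[OF Y]
  interpret H: vectorspace class_ring "Hom D (ob {#fst x#}) (ob {#fst z#})"
    by (intro Hom_space) simp_all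
  define k where "k = cmp D (ob {#fst x#}) (ob X) (ob Y) f (inc X x)"
  define l where "l = cmp D (ob Y) (ob Z) (ob {#fst z#}) (prj Z z) g"
  have kl: "k \<in> carrier (Hom D (ob {#fst x#}) (ob Y))" "l \<in> carrier (Hom D (ob Y) (ob {#fst z#}))"
    using f g by (auto simp: k_def l_def intro!: cmp_closed)
  have "component X Z (cmp D (ob X) (ob Y) (ob Z) g f) x z = cmp D (ob {#fst x#}) (ob Y) (ob {#fst z#}) l k"
    using f g by (simp add: component_def k_def l_def cmp_closed flip: cmp_assoc)
  also have "\<dots> = cmp D (ob {#fst x#}) (ob Y) (ob {#fst z#}) l (cmp D (ob {#fst x#}) (ob Y) (ob Y) (finsum (Hom D (ob Y) (ob Y))
        (\<lambda>y. cmp D (ob Y) (ob {#fst y#}) (ob Y) (inc Y y) (prj Y y)) (slots Y)) k)"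
    using kl by (simp add: sum_inc_prj[OF Y] cmp_idm_left)
  also have "cmp D (ob {#fst x#}) (ob Y) (ob Y) (finsum (Hom D (ob Y) (ob Y))
        (\<lambda>y. cmp D (ob Y) (ob {#fst y#}) (ob Y) (inc Y y) (prj Y y)) (slots Y)) k
      = finsum (Hom D (ob {#fst x#}) (ob Y)) (\<lambda>y. cmp D (ob {#fst x#}) (ob Y) (ob Y)
        (cmp D (ob Y) (ob {#fst y#}) (ob Y) (inc Y y) (prj Y y)) k) (slots Y)"
    using kl by (intro cmp_finsum_left) (simp_all add: slot_simps[OF Y] cmp_closed)
  also have "cmp D (ob {#fst x#}) (ob Y) (ob {#fst z#}) l \<dots>
      = finsum (Hom D (ob {#fst x#}) (ob {#fst z#})) (\<lambda>y. cmp D (ob {#fst x#}) (ob Y) (ob {#fst z#}) l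
        (cmp D (ob {#fst x#}) (ob Y) (ob Y)
          (cmp D (ob Y) (ob {#fst y#}) (ob Y) (inc Y y) (prj Y y)) k)) (slots Y)"
    using kl by (intro cmp_finsum_right) (simp_all add: slot_simps[OF Y] cmp_closed)
  also have "\<dots> = finsum (Hom D (ob {#fst x#}) (ob {#fst z#}))
    (\<lambda>y. cmp D (ob {#fst x#}) (ob {#fst y#}) (ob {#fst z#}) (component Y Z g y z) (component X Y f x y)) (slots Y)"
  proof (rule H.finsum_cong', rule refl)
    show "(\<lambda>y. cmp D (ob {#fst x#}) (ob {#fst y#}) (ob {#fst z#}) (component Y Z g y z) (component X Y f x y))
        \<in> slots Y \<rightarrow> carrier (Hom D (ob {#fst x#}) (ob {#fst z#}))"
      using f g x z X Y Z by (intro Pi_I cmp_closed component_closed) (simp_all add: slot_simps[OF Y])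
  next
    fix y assume y: "y \<in> slots Y"
    note [simp] = slot_simps[OF Y y]
    have "cmp D (ob {#fst x#}) (ob {#fst y#}) (ob {#fst z#}) (component Y Z g y z) (component X Y f x y)
      = cmp D (ob {#fst x#}) (ob {#fst y#}) (ob {#fst z#}) (cmp D (ob {#fst y#}) (ob Y) (ob {#fst z#}) l (inc Y y))
          (cmp D (ob {#fst x#}) (ob Y) (ob {#fst y#}) (prj Y y) k)"
      using g by (simp add: component_def k_def l_def cmp_assoc)
    also have "\<dots> = cmp D (ob {#fst x#}) (ob Y) (ob {#fst z#}) l
        (cmp D (ob {#fst x#}) (ob Y) (ob Y)
          (cmp D (ob Y) (ob {#fst y#}) (ob Y) (inc Y y) (prj Y y)) k)"
      using kl by (simp add: cmp_closed flip: cmp_assoc)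
    finally show "cmp D (ob {#fst x#}) (ob Y) (ob {#fst z#}) l
        (cmp D (ob {#fst x#}) (ob Y) (ob Y)
          (cmp D (ob Y) (ob {#fst y#}) (ob Y) (inc Y y) (prj Y y)) k)
      = cmp D (ob {#fst x#}) (ob {#fst y#}) (ob {#fst z#}) (component Y Z g y z) (component X Y f x y)" by simp
  qed
  finally show ?thesis .
qed

lemma component_idm:
  assumes X: "set_mset X \<subseteq> Vs" and x: "x \<in> slots X" and y: "y \<in> slots X"
  shows "component X X (idm D (ob X)) x y
    = (if x = y then idm D (ob {#fst x#}) else \<zero>\<^bsub>Hom D (ob {#fst x#}) (ob {#fst y#})\<^esub>)"
  using slot_simps[OF X x] X x y by (simp add: component_def cmp_idm_left prj_inc prj_inc_zero)

lemma component_single: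
  assumes "a \<in> Vs" "b \<in> Vs" "h \<in> carrier (Hom D (ob {#a#}) (ob {#b#}))"
  shows "component {#a#} {#b#} h (a, 0) (b, 0) = h"
  using assms by (simp add: component_def inc_single prj_single cmp_idm_left cmp_idm_right ob_closed)

end

lemma (in wf_digraph) path_mor_closed:
  "keys h \<subseteq> {p. awalk a p b} \<Longrightarrow> path_mor a b h \<in> carrier (Hom (path_cat G) {#a#} {#b#})"
  unfolding path_mor_entry by (intro entry_closed) simp_all

text \<open>A matrix is the sum of its entries, each placed in an otherwise zero matrix. Such a
  matrix is the entry itself, as a morphism between vertices, composed with an inclusion and a
  projection, so the ideal absorbs it. Ideals of the path category thus need to be examined on
  vertices only.\<close>

lemma (in wf_digraph) ideal_memI:
  assumes N: "two_sided_ideal (path_cat G :: ('a multiset, ('a, 'b, 'k::field) path_mor, 'k) kcat) N"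
    and X: "set_mset X \<subseteq> verts G" and Y: "set_mset Y \<subseteq> verts G"
    and f: "f \<in> carrier (Hom (path_cat G) X Y)"
    and entries: "\<And>x y. x \<in> slots X \<Longrightarrow> y \<in> slots Y
      \<Longrightarrow> path_mor (fst x) (fst y) (f x y) \<in> N {#fst x#} {#fst y#}"
  shows "f \<in> N X Y"
proof -
  interpret vertex_biproducts "path_cat G :: ('a multiset, ('a, 'b, 'k) path_mor, 'k) kcat"
    "verts G" "\<lambda>X. X" path_inc path_prj
    by (rule path_cat_biproducts)
  have sub: "VectorSpace.subspace class_ring (N X Y) (Hom (path_cat G) X Y)"
    using two_sided_idealD(1)[OF N] ob_closed[OF X] ob_closed[OF Y] by simp
  have entry: "entry x y (f x y) \<in> N X Y" if x: "x \<in> slots X" and y: "y \<in> slots Y" for x y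
  proof -
    note [simp] = slot_simps[OF X x] slot_simps[OF Y y]
    have "cmp (path_cat G) {#fst x#} {#fst y#} Y (path_inc Y y) (path_mor (fst x) (fst y) (f x y)) \<in> N {#fst x#} Y"
      by (rule two_sided_idealD(2)[OF N]) (simp_all add: entries x y)
    then have "cmp (path_cat G) X {#fst x#} Y
        (cmp (path_cat G) {#fst x#} {#fst y#} Y (path_inc Y y) (path_mor (fst x) (fst y) (f x y)))
        (path_prj X x) \<in> N X Y"
      by (rule two_sided_idealD(3)[OF N, rotated -1]) simp_all
    then show ?thesis
      by (simp add: path_inc_def path_prj_def path_mor_entry cmp_entry)
  qed
  \<comment> \<open>The matrix is filled up one position at a time; \<open>S\<close> is the set of
    positions already filled.\<close>
  have "(\<lambda>x y. if (x, y) \<in> S then f x y else 0) \<in> N X Y"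
    if "finite S" "S \<subseteq> slots X \<times> slots Y" for S
    using that
  proof induct
    case empty
    then show ?case using subspaceD(2)[OF sub] by (simp add: path_cat_simps(3))
  next
    case (insert s S)
    obtain x y where s: "s = (x, y)" by (cases s)
    have "(\<lambda>x y. if (x, y) \<in> insert s S then f x y else 0)
      = (\<lambda>x' y'. entry x y (f x y) x' y' + (if (x', y') \<in> S then f x' y' else 0))"
      using insert(2) by (auto simp: fun_eq_iff entry_def s)
    also have "\<dots> \<in> N X Y"
      using subspaceD(3)[OF sub entry insert(3), of x y] insert(4)
      by (simp add: path_cat_simps(4) s)
    finally show ?case .
  qed
  from this[of "slots X \<times> slots Y"]
  have "(\<lambda>x y. if (x, y) \<in> slots X \<times> slots Y then f x y else 0) \<in> N X Y" by simp
  also have "(\<lambda>x y. if (x, y) \<in> slots X \<times> slots Y then f x y else 0) = f"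
    using path_cat_homD(2,3)[OF f] by (intro ext) (simp, blast)
  finally show ?thesis .
qed

section \<open>Functors out of a path category\<close>

locale path_functor = wf_digraph G + vertex_biproducts D "verts G" ob inc prj
  for G :: "('v, 'e) pre_digraph" and D :: "('p, 'n, 'k::field) kcat" and ob inc prj +
  fixes arr :: "'e \<Rightarrow> 'n"
  assumes arr_closed: "e \<in> arcs G \<Longrightarrow> arr e \<in> carrier (Hom D (ob {#tail G e#}) (ob {#head G e#}))"
begin

lemma vertex_closed: "a \<in> verts G \<Longrightarrow> ob {#a#} \<in> objs D"
  by (simp add: ob_closed)

text \<open>The endpoints are arguments because the empty walk does not determine its vertex and
  composition takes its objects explicitly. The value on the empty list is meant for
  \<open>a = b\<close>.\<close>

primrec path_val :: "'e list \<Rightarrow> 'v \<Rightarrow> 'v \<Rightarrow> 'n" where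
  "path_val [] a b = idm D (ob {#a#})"
| "path_val (e # p) a b = cmp D (ob {#a#}) (ob {#head G e#}) (ob {#b#}) (path_val p (head G e) b) (arr e)"

lemma path_val_closed: "awalk a p b \<Longrightarrow> path_val p a b \<in> carrier (Hom D (ob {#a#}) (ob {#b#}))"
proof (induct p arbitrary: a)
  case Nil
  then show ?case by (auto simp: awalk_Nil_iff idm_closed vertex_closed)
next
  case (Cons e p)
  then have "e \<in> arcs G" "a = tail G e" "awalk (head G e) p b" "b \<in> verts G"
    by (auto simp: awalk_Cons_iff)
  with Cons(1) arr_closed[of e] show ?case
    by (auto intro!: cmp_closed simp: vertex_closed)
qed

lemma path_val_append:
  "\<lbrakk>awalk a p b; awalk b q c\<rbrakk>
    \<Longrightarrow> path_val (p @ q) a c = cmp D (ob {#a#}) (ob {#b#}) (ob {#c#}) (path_val q b c) (path_val p a b)"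
proof (induct p arbitrary: a)
  case Nil
  then have "a = b" "b \<in> verts G" "c \<in> verts G" by (auto simp: awalk_Nil_iff)
  with Nil show ?case by (simp add: cmp_idm_right vertex_closed path_val_closed)
next
  case (Cons e p)
  then have "e \<in> arcs G" "a = tail G e" "awalk (head G e) p b" "b \<in> verts G" "c \<in> verts G"
    by (auto simp: awalk_Cons_iff)
  with Cons arr_closed[of e] show ?case
    by (simp add: cmp_assoc vertex_closed path_val_closed)
qed

definition lin :: "'v \<Rightarrow> 'v \<Rightarrow> ('e list \<Rightarrow>\<^sub>0 'k) \<Rightarrow> 'n" where
  "lin a b h = finsum (Hom D (ob {#a#}) (ob {#b#}))
     (\<lambda>p. lookup h p \<odot>\<^bsub>Hom D (ob {#a#}) (ob {#b#})\<^esub> path_val p a b) (keys h)"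

context
  fixes a b assumes ab: "a \<in> verts G" "b \<in> verts G"
begin

interpretation H: vectorspace class_ring "Hom D (ob {#a#}) (ob {#b#})"
  using ab by (intro Hom_space vertex_closed)

lemma smult_path_val_closed:
  "awalk a p b \<Longrightarrow> c \<odot>\<^bsub>Hom D (ob {#a#}) (ob {#b#})\<^esub> path_val p a b \<in> carrier (Hom D (ob {#a#}) (ob {#b#}))"
  by (intro H.smult_closed path_val_closed) simp

lemma lin_superset:
  assumes "finite S" "keys h \<subseteq> S" "S \<subseteq> {p. awalk a p b}"
  shows "lin a b h = finsum (Hom D (ob {#a#}) (ob {#b#}))
     (\<lambda>p. lookup h p \<odot>\<^bsub>Hom D (ob {#a#}) (ob {#b#})\<^esub> path_val p a b) S"
proof -
  have "(0 :: 'k) \<odot>\<^bsub>Hom D (ob {#a#}) (ob {#b#})\<^esub> path_val p a b = \<zero>\<^bsub>Hom D (ob {#a#}) (ob {#b#})\<^esub>"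
    if "p \<in> S" for p
    using H.lmult_0[OF path_val_closed[of a p b]] that assms(3) by auto
  then show ?thesis
    unfolding lin_def using assms smult_path_val_closed
    by (intro H.add.finprod_mono_neutral_cong_left) (auto simp: in_keys_iff)
qed

lemma lin_closed:
  assumes "keys h \<subseteq> {p. awalk a p b}"
  shows "lin a b h \<in> carrier (Hom D (ob {#a#}) (ob {#b#}))"
  unfolding lin_def using assms by (intro H.finsum_closed) (auto intro!: smult_path_val_closed)

lemma lin_zero: "lin a b 0 = \<zero>\<^bsub>Hom D (ob {#a#}) (ob {#b#})\<^esub>"
  by (simp add: lin_def)

lemma lin_single: "awalk a p b \<Longrightarrow> lin a b (single p c) = c \<odot>\<^bsub>Hom D (ob {#a#}) (ob {#b#})\<^esub> path_val p a b"
  using lin_superset[of "{p}" "single p c"] smult_path_val_closed[of p c] by simp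

lemma lin_single_one: "awalk a p b \<Longrightarrow> lin a b (single p 1) = path_val p a b"
  using H.smult_one[OF path_val_closed[of a p b]] by (simp add: lin_single)

lemma lin_add:
  assumes "keys h \<subseteq> {p. awalk a p b}" "keys h' \<subseteq> {p. awalk a p b}"
  shows "lin a b (h + h') = lin a b h \<oplus>\<^bsub>Hom D (ob {#a#}) (ob {#b#})\<^esub> lin a b h'"
proof -
  let ?S = "keys h \<union> keys h'"
  have S: "?S \<subseteq> {p. awalk a p b}" "keys (h + h') \<subseteq> ?S"
    using assms by (auto simp: Poly_Mapping.keys_add)
  have "(lookup h p + lookup h' p) \<odot>\<^bsub>Hom D (ob {#a#}) (ob {#b#})\<^esub> path_val p a b
    = lookup h p \<odot>\<^bsub>Hom D (ob {#a#}) (ob {#b#})\<^esub> path_val p a b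
      \<oplus>\<^bsub>Hom D (ob {#a#}) (ob {#b#})\<^esub> lookup h' p \<odot>\<^bsub>Hom D (ob {#a#}) (ob {#b#})\<^esub> path_val p a b"
    if "p \<in> ?S" for p
    using H.smult_l_distr[of "lookup h p" "lookup h' p" "path_val p a b"]
      path_val_closed[of a p b] that S by auto
  then have "finsum (Hom D (ob {#a#}) (ob {#b#})) (\<lambda>p. lookup (h + h') p
        \<odot>\<^bsub>Hom D (ob {#a#}) (ob {#b#})\<^esub> path_val p a b) ?S
      = finsum (Hom D (ob {#a#}) (ob {#b#})) (\<lambda>p. lookup h p \<odot>\<^bsub>Hom D (ob {#a#}) (ob {#b#})\<^esub> path_val p a b
      \<oplus>\<^bsub>Hom D (ob {#a#}) (ob {#b#})\<^esub> lookup h' p \<odot>\<^bsub>Hom D (ob {#a#}) (ob {#b#})\<^esub> path_val p a b) ?S"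
    using S by (intro H.finsum_cong' Pi_I H.a_closed smult_path_val_closed) (auto simp: lookup_add)
  also have "\<dots> = finsum (Hom D (ob {#a#}) (ob {#b#})) (\<lambda>p. lookup h p \<odot>\<^bsub>Hom D (ob {#a#}) (ob {#b#})\<^esub> path_val p a b) ?S
      \<oplus>\<^bsub>Hom D (ob {#a#}) (ob {#b#})\<^esub>
      finsum (Hom D (ob {#a#}) (ob {#b#})) (\<lambda>p. lookup h' p \<odot>\<^bsub>Hom D (ob {#a#}) (ob {#b#})\<^esub> path_val p a b) ?S"
    using S by (intro H.finsum_addf Pi_I smult_path_val_closed) auto
  finally show ?thesis
    using S by (simp add: lin_superset[of ?S])
qed

lemma lin_scale:
  assumes h: "keys h \<subseteq> {p. awalk a p b}"
  shows "lin a b (scale c h) = c \<odot>\<^bsub>Hom D (ob {#a#}) (ob {#b#})\<^esub> lin a b h"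
  using h
proof (induct h rule: keys_induct)
  case zero
  show ?case using H.smult_r_null[of c] by (simp add: lin_zero)
next
  case (single p d)
  then show ?case
    using H.smult_assoc1[of c d "path_val p a b"] path_val_closed[of a p b] by (simp add: lin_single)
next
  case (add h h')
  then show ?case
    using H.smult_r_distr[of c "lin a b h" "lin a b h'"]
    by (simp add: scale_add lin_add lin_closed keys_subset_scale)
qed

lemma lin_sum:
  assumes "finite A" "\<And>i. i \<in> A \<Longrightarrow> keys (h i) \<subseteq> {p. awalk a p b}"
  shows "lin a b (\<Sum>i\<in>A. h i) = finsum (Hom D (ob {#a#}) (ob {#b#})) (\<lambda>i. lin a b (h i)) A"
  using assms
proof (induct A)
  case empty
  then show ?case by (simp add: lin_zero)
next
  case (insert i A)
  then have "(\<lambda>i. lin a b (h i)) \<in> A \<rightarrow> carrier (Hom D (ob {#a#}) (ob {#b#}))"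
    "lin a b (h i) \<in> carrier (Hom D (ob {#a#}) (ob {#b#}))"
    by (auto intro!: lin_closed)
  with insert show ?case
    by (simp add: H.finsum_insert lin_add keys_subset_sum)
qed

end

lemma lin_one: "a \<in> verts G \<Longrightarrow> lin a a (single [] 1) = idm D (ob {#a#})"
  by (simp add: lin_single_one awalk_Nil_iff)

text \<open>Both sides are bilinear, so two nested inductions reduce the claim to a pair of paths,
  where it is \<open>path_val_append\<close>. The coefficients come out in opposite orders, and
  commutativity of the field reconciles them.\<close>

lemma lin_mult:
  assumes abc: "a \<in> verts G" "b \<in> verts G" "c \<in> verts G"
    and f: "keys f \<subseteq> {p. awalk a p b}" and g: "keys g \<subseteq> {p. awalk b p c}"
  shows "lin a c (path_mult g f) = cmp D (ob {#a#}) (ob {#b#}) (ob {#c#}) (lin b c g) (lin a b f)"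
  using f
proof (induct f rule: keys_induct)
  case zero
  show ?case using abc lin_closed[OF abc(2,3) g] by (simp add: lin_zero cmp_zero_right vertex_closed)
next
  case (single p d)
  then have p: "awalk a p b" by simp
  note [simp] = abc vertex_closed p path_val_closed[OF p]
  from g show ?case
  proof (induct g rule: keys_induct)
    case zero
    show ?case by (simp add: lin_zero cmp_zero_left lin_single smult_path_val_closed)
  next
    case (single q e)
    then have q: "awalk b q c" by simp
    interpret H: vectorspace class_ring "Hom D (ob {#a#}) (ob {#c#})"
      by (intro Hom_space) simp_all
    have pq: "awalk a (p @ q) c" using p q by (rule awalk_appendI)
    have cl: "cmp D (ob {#a#}) (ob {#b#}) (ob {#c#}) (path_val q b c) (path_val p a b) \<in> carrier (Hom D (ob {#a#}) (ob {#c#}))"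
      using path_val_closed[OF q] by (simp add: cmp_closed)
    show ?case
      using q pq path_val_closed[OF q] H.smult_assoc1[OF _ _ cl, of d e]
      by (simp add: mult.commute[of e d] lin_single smult_path_val_closed path_val_append[OF p q] cmp_smult_left cmp_smult_right
          del: awalk_append_iff)
  next
    case (add g g')
    have "keys (path_mult k (single p d)) \<subseteq> {p. awalk a p c}"
      if "keys k \<subseteq> {p. awalk b p c}" for k
      by (intro keys_bilinear_ext[OF that keys_subset_single[of p "{p}"]])
        (simp_all del: awalk_append_iff add: awalk_appendI[OF p])
    with add show ?case
      by (simp add: bilinear_ext_add_left lin_add lin_closed cmp_add_left lin_single smult_path_val_closed)
  qed
next
  case (add f f')
  have "keys (path_mult g f) \<subseteq> {p. awalk a p c}" "keys (path_mult g f') \<subseteq> {p. awalk a p c}"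
    by (rule keys_bilinear_ext[OF g add(1)] keys_bilinear_ext[OF g add(2)];
        simp del: awalk_append_iff add: awalk_appendI)+
  with add abc g show ?case
    by (simp add: bilinear_ext_add_right lin_add lin_closed cmp_add_right vertex_closed)
qed

text \<open>Chosen through its matrix, which exists by \<open>ex_component\<close> and determines
  the morphism by \<open>eq_if_component_eq\<close>. An explicit double sum is avoided, and every
  later identity is checked entrywise by \<open>Phi_eqI\<close>.\<close>

definition Phi :: "'v multiset \<Rightarrow> 'v multiset \<Rightarrow> ('v, 'e, 'k) path_mor \<Rightarrow> 'n" where
  "Phi X Y f = (SOME h. h \<in> carrier (Hom D (ob X) (ob Y)) \<and>
    (\<forall>x\<in>slots X. \<forall>y\<in>slots Y. component X Y h x y = lin (fst x) (fst y) (f x y)))"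

lemma slot_vertex: "\<lbrakk>x \<in> slots X; set_mset X \<subseteq> verts G\<rbrakk> \<Longrightarrow> fst x \<in> verts G"
  using fst_slot[of x X] by auto

lemma Phi:
  assumes "set_mset X \<subseteq> verts G" "set_mset Y \<subseteq> verts G" "f \<in> carrier (Hom (path_cat G) X Y)"
  shows Phi_closed: "Phi X Y f \<in> carrier (Hom D (ob X) (ob Y))"
    and component_Phi: "\<And>x y. x \<in> slots X \<Longrightarrow> y \<in> slots Y
      \<Longrightarrow> component X Y (Phi X Y f) x y = lin (fst x) (fst y) (f x y)"
proof -
  have "\<exists>h\<in>carrier (Hom D (ob X) (ob Y)).
      \<forall>x\<in>slots X. \<forall>y\<in>slots Y. component X Y h x y = lin (fst x) (fst y) (f x y)"
    using assms path_cat_homD(1)[OF assms(3)] by (intro ex_component lin_closed) (simp_all add: slot_vertex)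
  then have "\<exists>h. h \<in> carrier (Hom D (ob X) (ob Y)) \<and>
      (\<forall>x\<in>slots X. \<forall>y\<in>slots Y. component X Y h x y = lin (fst x) (fst y) (f x y))" by blast
  from someI_ex[OF this] show "Phi X Y f \<in> carrier (Hom D (ob X) (ob Y))"
    "\<And>x y. x \<in> slots X \<Longrightarrow> y \<in> slots Y \<Longrightarrow> component X Y (Phi X Y f) x y = lin (fst x) (fst y) (f x y)"
    unfolding Phi_def by auto
qed

lemma Phi_eqI:
  assumes "set_mset X \<subseteq> verts G" "set_mset Y \<subseteq> verts G" "f \<in> carrier (Hom (path_cat G) X Y)"
    "h \<in> carrier (Hom D (ob X) (ob Y))"
    "\<And>x y. x \<in> slots X \<Longrightarrow> y \<in> slots Y \<Longrightarrow> component X Y h x y = lin (fst x) (fst y) (f x y)"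
  shows "Phi X Y f = h"
proof (rule eq_if_component_eq[OF assms(1,2) Phi_closed[OF assms(1-3)] assms(4)])
  show "component X Y (Phi X Y f) x y = component X Y h x y" if "x \<in> slots X" "y \<in> slots Y" for x y
    using that by (simp only: component_Phi[OF assms(1-3)] assms(5))
qed

text \<open>All laws are compared on matrices. Linearity and identities hold entry by entry; for
  composites both categories multiply matrices, by definition in the path category and by
  \<open>component_cmp\<close> in \<open>D\<close>, and \<open>lin\<close> is multiplicative on
  entries.\<close>

lemma Phi_functor: "k_functor (path_cat G) D \<lparr>on_obj = ob, on_hom = Phi\<rparr>"
proof (intro k_functor.intro path_cat_category k_category_axioms k_functor_axioms.intro, goal_cases)
  case (1 X)
  then show ?case by (simp add: path_cat_simps ob_closed)
next
  case (2 X Y)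
  then have XY: "set_mset X \<subseteq> verts G" "set_mset Y \<subseteq> verts G" by (simp_all add: path_cat_simps)
  interpret P: vectorspace class_ring "Hom (path_cat G) X Y :: ('k, ('v, 'e, 'k) path_mor) module"
    by (rule path_cat_Hom_space)
  interpret H: vectorspace class_ring "Hom D (ob X) (ob Y)"
    using XY by (intro Hom_space ob_closed)
  have "Phi X Y \<in> module_hom class_ring (Hom (path_cat G) X Y) (Hom D (ob X) (ob Y))"
  proof (rule module_homI)
    show "Phi X Y f \<in> carrier (Hom D (ob X) (ob Y))" if "f \<in> carrier (Hom (path_cat G) X Y)" for f
      using XY that by (rule Phi_closed)
    show "Phi X Y (f \<oplus>\<^bsub>Hom (path_cat G) X Y\<^esub> f') = Phi X Y f \<oplus>\<^bsub>Hom D (ob X) (ob Y)\<^esub> Phi X Y f'"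
      if f: "f \<in> carrier (Hom (path_cat G) X Y)" "f' \<in> carrier (Hom (path_cat G) X Y)" for f f'
    proof (rule Phi_eqI[OF XY])
      show "component X Y (Phi X Y f \<oplus>\<^bsub>Hom D (ob X) (ob Y)\<^esub> Phi X Y f') x y
          = lin (fst x) (fst y) ((f \<oplus>\<^bsub>Hom (path_cat G) X Y\<^esub> f') x y)" if "x \<in> slots X" "y \<in> slots Y" for x y
        using that XY f path_cat_homD(1)[OF f(1) that] path_cat_homD(1)[OF f(2) that]
        by (simp add: hom_add[OF component_hom] Phi_closed component_Phi path_cat_simps(4) lin_add slot_vertex)
    qed (use XY f in \<open>simp_all add: Phi_closed\<close>)
    show "Phi X Y (c \<odot>\<^bsub>Hom (path_cat G) X Y\<^esub> f) = c \<odot>\<^bsub>Hom D (ob X) (ob Y)\<^esub> Phi X Y f"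
      if f: "f \<in> carrier (Hom (path_cat G) X Y)" for c f
    proof (rule Phi_eqI[OF XY])
      show "component X Y (c \<odot>\<^bsub>Hom D (ob X) (ob Y)\<^esub> Phi X Y f) x y
          = lin (fst x) (fst y) ((c \<odot>\<^bsub>Hom (path_cat G) X Y\<^esub> f) x y)" if "x \<in> slots X" "y \<in> slots Y" for x y
        using that XY f path_cat_homD(1)[OF f(1) that]
        by (simp add: hom_smult[OF component_hom] Phi_closed component_Phi path_cat_simps(5) lin_scale slot_vertex)
    qed (use XY f in \<open>simp_all add: Phi_closed\<close>)
  qed
  then show ?case by simp
next
  case (3 X)
  then have X: "set_mset X \<subseteq> verts G" "X \<in> objs (path_cat G)" by (simp_all add: path_cat_simps)
  have "Phi X X (idm (path_cat G) X) = idm D (ob X)"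
  proof (rule Phi_eqI[OF X(1) X(1)])
    show "idm (path_cat G) X \<in> carrier (Hom (path_cat G) X X)"
      by (rule k_category.idm_closed[OF path_cat_category X(2)])
    show "component X X (idm D (ob X)) x y = lin (fst x) (fst y) (idm (path_cat G) X x y)"
      if "x \<in> slots X" "y \<in> slots X" for x y
      using that X(1) by (simp add: component_idm path_cat_simps(6) lin_one lin_zero slot_vertex)
  qed (simp add: X idm_closed ob_closed)
  then show ?case by simp
next
  case (4 X Y Z f g)
  then have XYZ: "set_mset X \<subseteq> verts G" "set_mset Y \<subseteq> verts G" "set_mset Z \<subseteq> verts G"
    and f: "f \<in> carrier (Hom (path_cat G) X Y)" and g: "g \<in> carrier (Hom (path_cat G) Y Z)"
    by (simp_all add: path_cat_simps(1))
  have "Phi X Z (cmp (path_cat G) X Y Z g f) = cmp D (ob X) (ob Y) (ob Z) (Phi Y Z g) (Phi X Y f)"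
  proof (rule Phi_eqI[OF XYZ(1,3) path_cat_cmp_closed[OF f g]])
    show "cmp D (ob X) (ob Y) (ob Z) (Phi Y Z g) (Phi X Y f) \<in> carrier (Hom D (ob X) (ob Z))"
      using XYZ f g by (intro cmp_closed ob_closed Phi_closed)
    fix x z assume x: "x \<in> slots X" and z: "z \<in> slots Z"
    note [simp] = slot_vertex[OF x XYZ(1)] slot_vertex[OF z XYZ(3)]
    interpret H: vectorspace class_ring "Hom D (ob {#fst x#}) (ob {#fst z#})"
      by (intro Hom_space vertex_closed) simp_all
    have y: "keys (f x y) \<subseteq> {p. awalk (fst x) p (fst y)}"
      "keys (g y z) \<subseteq> {p. awalk (fst y) p (fst z)}" "fst y \<in> verts G"
      if "y \<in> slots Y" for y
      using path_cat_homD(1)[OF f x that] path_cat_homD(1)[OF g that z] slot_vertex[OF that XYZ(2)] by auto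
    have keys: "keys (path_mult (g y z) (f x y)) \<subseteq> {p. awalk (fst x) p (fst z)}" if "y \<in> slots Y" for y
      using y[OF that] by (intro keys_bilinear_ext[OF y(2)[OF that] y(1)[OF that]])
        (simp del: awalk_append_iff add: awalk_appendI)
    have "lin (fst x) (fst z) (cmp (path_cat G) X Y Z g f x z)
      = finsum (Hom D (ob {#fst x#}) (ob {#fst z#})) (\<lambda>y. lin (fst x) (fst z) (path_mult (g y z) (f x y))) (slots Y)"
      unfolding path_cat_simps(7) by (intro lin_sum keys) simp_all
    also have "\<dots> = finsum (Hom D (ob {#fst x#}) (ob {#fst z#})) (\<lambda>y. cmp D (ob {#fst x#}) (ob {#fst y#}) (ob {#fst z#})
        (component Y Z (Phi Y Z g) y z) (component X Y (Phi X Y f) x y)) (slots Y)"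
      using x z y XYZ f g
      by (intro H.finsum_cong' Pi_I cmp_closed component_closed Phi_closed vertex_closed)
        (simp_all add: lin_mult component_Phi)
    also have "\<dots> = component X Z (cmp D (ob X) (ob Y) (ob Z) (Phi Y Z g) (Phi X Y f)) x z"
      using XYZ f g x z by (intro component_cmp[symmetric] Phi_closed)
    finally show "component X Z (cmp D (ob X) (ob Y) (ob Z) (Phi Y Z g) (Phi X Y f)) x z
        = lin (fst x) (fst z) (cmp (path_cat G) X Y Z g f x z)" by simp
  qed
  then show ?case by simp
qed

text \<open>For one-vertex objects the inclusion and the projection are identities, so the single
  entry of a matrix is the morphism itself.\<close>

lemma Phi_path_mor:
  assumes "a \<in> verts G" "b \<in> verts G" "keys h \<subseteq> {p. awalk a p b}"
  shows "Phi {#a#} {#b#} (path_mor a b h) = lin a b h"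
proof (rule Phi_eqI)
  have lin: "lin a b h \<in> carrier (Hom D (ob {#a#}) (ob {#b#}))"
    using assms by (rule lin_closed)
  then show "lin a b h \<in> carrier (Hom D (ob {#a#}) (ob {#b#}))" .
  show "path_mor a b h \<in> carrier (Hom (path_cat G) {#a#} {#b#})"
    using assms(3) by (rule path_mor_closed)
  show "component {#a#} {#b#} (lin a b h) x y = lin (fst x) (fst y) (path_mor a b h x y)"
    if "x \<in> slots {#a#}" "y \<in> slots {#b#}" for x y
    using that component_single[OF assms(1,2) lin] by (simp add: path_mor_def)
qed (simp_all add: assms(1,2))

text \<open>A morphism with image zero has every entry annihilated by \<open>lin\<close>. The
  hypothesis puts these entries into the ideal, and \<open>ideal_memI\<close> reassembles them.
  \<open>Phi_surj\<close> makes the same passage from vertices to multisets for fullness.\<close>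

lemma Phi_kernel:
  assumes N: "two_sided_ideal (path_cat G) N"
    and kernel: "\<And>a b h. \<lbrakk>a \<in> verts G; b \<in> verts G; keys h \<subseteq> {p. awalk a p b};
        lin a b h = \<zero>\<^bsub>Hom D (ob {#a#}) (ob {#b#})\<^esub>\<rbrakk> \<Longrightarrow> path_mor a b h \<in> N {#a#} {#b#}"
    and X: "set_mset X \<subseteq> verts G" and Y: "set_mset Y \<subseteq> verts G"
    and f: "f \<in> carrier (Hom (path_cat G) X Y)" and zero: "Phi X Y f = \<zero>\<^bsub>Hom D (ob X) (ob Y)\<^esub>"
  shows "f \<in> N X Y"
proof (rule ideal_memI[OF N X Y f])
  fix x y assume x: "x \<in> slots X" and y: "y \<in> slots Y"
  have "lin (fst x) (fst y) (f x y) = component X Y \<zero>\<^bsub>Hom D (ob X) (ob Y)\<^esub> x y"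
    using component_Phi[OF X Y f x y] zero by simp
  also have "\<dots> = \<zero>\<^bsub>Hom D (ob {#fst x#}) (ob {#fst y#})\<^esub>"
    using X Y x y by (intro hom_zero[OF _ _ component_hom] Hom_space) (simp_all add: ob_closed ob_slot_closed)
  finally show "path_mor (fst x) (fst y) (f x y) \<in> N {#fst x#} {#fst y#}"
    using x y X Y path_cat_homD(1)[OF f x y] by (intro kernel) (simp_all add: slot_vertex)
qed

lemma Phi_surj:
  assumes full: "\<And>a b k. \<lbrakk>a \<in> verts G; b \<in> verts G; k \<in> carrier (Hom D (ob {#a#}) (ob {#b#}))\<rbrakk>
      \<Longrightarrow> \<exists>h. keys h \<subseteq> {p. awalk a p b} \<and> lin a b h = k"
    and X: "set_mset X \<subseteq> verts G" and Y: "set_mset Y \<subseteq> verts G" and k: "k \<in> carrier (Hom D (ob X) (ob Y))"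
  shows "\<exists>f\<in>carrier (Hom (path_cat G) X Y). Phi X Y f = k"
proof -
  have "\<exists>h. keys h \<subseteq> {p. awalk (fst x) p (fst y)} \<and> lin (fst x) (fst y) h = component X Y k x y"
    if "x \<in> slots X" "y \<in> slots Y" for x y
    using that X Y k by (intro full component_closed) (simp_all add: slot_vertex)
  then obtain m where m: "keys (m x y) \<subseteq> {p. awalk (fst x) p (fst y)}"
    "lin (fst x) (fst y) (m x y) = component X Y k x y" if "x \<in> slots X" "y \<in> slots Y" for x y
    by metis
  \<comment> \<open>The choice of \<open>m\<close> is arbitrary outside the slots, where a morphism
    of the path category has to vanish.\<close>
  define f where "f x y = (if x \<in> slots X \<and> y \<in> slots Y then m x y else 0)" for x y
  have f: "f \<in> carrier (Hom (path_cat G) X Y)"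
  proof (rule path_cat_homI)
    show "keys (f x y) \<subseteq> {p. awalk (fst x) p (fst y)}" if "x \<in> slots X" "y \<in> slots Y" for x y
      using m(1)[OF that] that by (simp add: f_def)
    show "f x y = 0" if "x \<notin> slots X \<or> y \<notin> slots Y" for x y
      using that unfolding f_def by (simp only: if_False de_Morgan_conj[symmetric])
  qed
  moreover have "Phi X Y f = k"
    using X Y f k by (rule Phi_eqI) (simp add: f_def m(2))
  ultimately show ?thesis by blast
qed

end

section \<open>Tensor products and bimodule actions\<close>

lemma keys_subset_diff:
  fixes x y :: "'a \<Rightarrow>\<^sub>0 'k::field"
  assumes "keys x \<subseteq> S" "keys y \<subseteq> S"
  shows "keys (x - y) \<subseteq> S"
proof
  fix a assume "a \<in> keys (x - y)"
  then have "lookup x a \<noteq> 0 \<or> lookup y a \<noteq> 0"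
    by (auto simp: in_keys_iff lookup_minus)
  then show "a \<in> S" using assms unfolding in_keys_iff[symmetric] by blast
qed

text \<open>The tensor relations are written with the subtraction of finitely supported functions,
  whereas equality of cosets is decided by the subtraction of the module; the two agree.\<close>

lemma free_space_minus:
  assumes "x \<in> carrier (free_space S :: ('k::field, _) module)" "y \<in> carrier (free_space S)"
  shows "x \<ominus>\<^bsub>free_space S\<^esub> y = x - y"
proof -
  interpret F: vectorspace class_ring "free_space S :: ('k, _) module"
    by (rule free_space_vectorspace)
  have "\<ominus>\<^bsub>free_space S\<^esub> y = scale (- 1) y"
    using assms by (intro F.minus_equality) (simp_all add: free_space_def scale_minus_one add.commute keys_subset_scale)
  then have "x \<ominus>\<^bsub>free_space S\<^esub> y = x + scale (- 1) y"
    by (simp add: a_minus_def free_space_def)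
  also have "\<dots> = x - y"
    by (rule poly_mapping_eqI) (simp add: lookup_add lookup_minus)
  finally show ?thesis .
qed

section \<open>Tensor product of two spaces\<close>

locale tensor_spaces = V: vectorspace class_ring V + W: vectorspace class_ring W
  for V :: "('k::field, 'a) module" and W :: "('k, 'b) module"
begin

abbreviation "pairs \<equiv> free_space (carrier V \<times> carrier W) :: ('k, 'a \<times> 'b \<Rightarrow>\<^sub>0 'k) module"

definition generators :: "('a \<times> 'b \<Rightarrow>\<^sub>0 'k) set" where
  "generators =
    {pair (v \<oplus>\<^bsub>V\<^esub> v') w - pair v w - pair v' w | v v' w.
        v \<in> carrier V \<and> v' \<in> carrier V \<and> w \<in> carrier W} \<union>
    {pair v (w \<oplus>\<^bsub>W\<^esub> w') - pair v w - pair v w' | v w w'.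
        v \<in> carrier V \<and> w \<in> carrier W \<and> w' \<in> carrier W} \<union>
    {pair (c \<odot>\<^bsub>V\<^esub> v) w - scale c (pair v w) | c v w.
        v \<in> carrier V \<and> w \<in> carrier W} \<union>
    {pair v (c \<odot>\<^bsub>W\<^esub> w) - scale c (pair v w) | c v w.
        v \<in> carrier V \<and> w \<in> carrier W}"

lemma pair_closed: "\<lbrakk>v \<in> carrier V; w \<in> carrier W\<rbrakk> \<Longrightarrow> single (v, w) c \<in> carrier pairs"
  by (simp add: free_space_def)

lemma generators_closed: "generators \<subseteq> carrier pairs"
proof -
  have 1: "pair (v \<oplus>\<^bsub>V\<^esub> v') w - pair v w - pair v' w \<in> carrier pairs"
    if "v \<in> carrier V" "v' \<in> carrier V" "w \<in> carrier W" for v v' w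
    using that by (simp add: free_space_def keys_subset_diff)
  have 2: "pair v (w \<oplus>\<^bsub>W\<^esub> w') - pair v w - pair v w' \<in> carrier pairs"
    if "v \<in> carrier V" "w \<in> carrier W" "w' \<in> carrier W" for v w w'
    using that by (simp add: free_space_def keys_subset_diff)
  have 3: "pair (c \<odot>\<^bsub>V\<^esub> v) w - scale c (pair v w) \<in> carrier pairs"
    if "v \<in> carrier V" "w \<in> carrier W" for c v w
    using that V.smult_closed[of c v] by (simp add: free_space_def keys_subset_diff)
  have 4: "pair v (c \<odot>\<^bsub>W\<^esub> w) - scale c (pair v w) \<in> carrier pairs"
    if "v \<in> carrier V" "w \<in> carrier W" for c v w
    using that W.smult_closed[of c w] by (simp add: free_space_def keys_subset_diff)
  show ?thesis
    unfolding generators_def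
    by (intro Un_least subsetI; elim CollectE exE conjE; hypsubst) (rule 1 2 3 4; assumption)+
qed

sublocale F: vectorspace class_ring pairs
  by (rule free_space_vectorspace)

lemma tensor_relations_span: "tensor_relations V W = F.span generators"
  by (simp add: tensor_relations_def generators_def)

sublocale Q: quotient_of_space pairs "tensor_relations V W"
  by (intro quotient_of_space.intro quotient_of_space_axioms.intro F.vectorspace_axioms)
    (unfold tensor_relations_span, rule F.span_is_subspace[OF generators_closed])

lemma tensor_cls_eq:
  assumes "x - y \<in> generators" "x \<in> carrier pairs" "y \<in> carrier pairs"
  shows "tensor_cls V W x = tensor_cls V W y"
proof -
  have "x - y \<in> tensor_relations V W"
    using F.in_own_span[OF generators_closed] assms(1) unfolding tensor_relations_span by (rule subsetD)
  then show ?thesis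
    unfolding tensor_cls_def Q.coset_eq_iff[OF assms(2,3)] free_space_minus[OF assms(2,3)] .
qed

lemma tensor_cls_hom: "tensor_cls V W \<in> module_hom class_ring pairs (tensor_space V W)"
  using Q.coset_hom by (simp add: tensor_cls_def[abs_def] tensor_space_def)

lemma pure_tensor_closed: "\<lbrakk>v \<in> carrier V; w \<in> carrier W\<rbrakk> \<Longrightarrow> pure_tensor V W v w \<in> carrier (tensor_space V W)"
  unfolding pure_tensor_def by (intro hom_closed[OF tensor_cls_hom] pair_closed)

lemma pairs_add: "x \<oplus>\<^bsub>pairs\<^esub> y = x + y" and pairs_smult: "c \<odot>\<^bsub>pairs\<^esub> x = scale c x"
  by (simp_all add: free_space_def)

lemma pure_tensor_hom_left:
  assumes w: "w \<in> carrier W"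
  shows "(\<lambda>v. pure_tensor V W v w) \<in> module_hom class_ring V (tensor_space V W)"
proof (rule module_homI)
  show "pure_tensor V W v w \<in> carrier (tensor_space V W)" if "v \<in> carrier V" for v
    using that w by (rule pure_tensor_closed)
  show "pure_tensor V W (v \<oplus>\<^bsub>V\<^esub> v') w = pure_tensor V W v w \<oplus>\<^bsub>tensor_space V W\<^esub> pure_tensor V W v' w"
    if v: "v \<in> carrier V" "v' \<in> carrier V" for v v'
  proof -
    have "pair (v \<oplus>\<^bsub>V\<^esub> v') w - (pair v w \<oplus>\<^bsub>pairs\<^esub> pair v' w) \<in> generators"
      using v w unfolding generators_def pairs_add diff_diff_eq[symmetric] by blast
    then have "tensor_cls V W (pair (v \<oplus>\<^bsub>V\<^esub> v') w) = tensor_cls V W (pair v w \<oplus>\<^bsub>pairs\<^esub> pair v' w)"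
      using v w by (intro tensor_cls_eq F.a_closed pair_closed) simp_all
    then show ?thesis
      using v w by (simp add: pure_tensor_def hom_add[OF tensor_cls_hom] pair_closed)
  qed
  show "pure_tensor V W (c \<odot>\<^bsub>V\<^esub> v) w = c \<odot>\<^bsub>tensor_space V W\<^esub> pure_tensor V W v w"
    if v: "v \<in> carrier V" for c v
  proof -
    have "pair (c \<odot>\<^bsub>V\<^esub> v) w - (c \<odot>\<^bsub>pairs\<^esub> pair v w) \<in> generators"
      using v w unfolding generators_def pairs_smult by blast
    then have "tensor_cls V W (pair (c \<odot>\<^bsub>V\<^esub> v) w) = tensor_cls V W (c \<odot>\<^bsub>pairs\<^esub> pair v w)"
      using v w V.smult_closed[of c v] by (intro tensor_cls_eq F.smult_closed pair_closed) simp_all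
    then show ?thesis
      using v w by (simp add: pure_tensor_def hom_smult[OF tensor_cls_hom] pair_closed)
  qed
qed

lemma pure_tensor_hom_right:
  assumes v: "v \<in> carrier V"
  shows "(\<lambda>w. pure_tensor V W v w) \<in> module_hom class_ring W (tensor_space V W)"
proof (rule module_homI)
  show "pure_tensor V W v w \<in> carrier (tensor_space V W)" if "w \<in> carrier W" for w
    using v that by (rule pure_tensor_closed)
  show "pure_tensor V W v (w \<oplus>\<^bsub>W\<^esub> w') = pure_tensor V W v w \<oplus>\<^bsub>tensor_space V W\<^esub> pure_tensor V W v w'"
    if w: "w \<in> carrier W" "w' \<in> carrier W" for w w'
  proof -
    have "pair v (w \<oplus>\<^bsub>W\<^esub> w') - (pair v w \<oplus>\<^bsub>pairs\<^esub> pair v w') \<in> generators"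
      using v w unfolding generators_def pairs_add diff_diff_eq[symmetric] by blast
    then have "tensor_cls V W (pair v (w \<oplus>\<^bsub>W\<^esub> w')) = tensor_cls V W (pair v w \<oplus>\<^bsub>pairs\<^esub> pair v w')"
      using v w by (intro tensor_cls_eq F.a_closed pair_closed) simp_all
    then show ?thesis
      using v w by (simp add: pure_tensor_def hom_add[OF tensor_cls_hom] pair_closed)
  qed
  show "pure_tensor V W v (c \<odot>\<^bsub>W\<^esub> w) = c \<odot>\<^bsub>tensor_space V W\<^esub> pure_tensor V W v w"
    if w: "w \<in> carrier W" for c w
  proof -
    have "pair v (c \<odot>\<^bsub>W\<^esub> w) - (c \<odot>\<^bsub>pairs\<^esub> pair v w) \<in> generators"
      using v w unfolding generators_def pairs_smult by blast
    then have "tensor_cls V W (pair v (c \<odot>\<^bsub>W\<^esub> w)) = tensor_cls V W (c \<odot>\<^bsub>pairs\<^esub> pair v w)"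
      using v w W.smult_closed[of c w] by (intro tensor_cls_eq F.smult_closed pair_closed) simp_all
    then show ?thesis
      using v w by (simp add: pure_tensor_def hom_smult[OF tensor_cls_hom] pair_closed)
  qed
qed

lemma pure_tensor_rep: "\<lbrakk>v \<in> carrier V; w \<in> carrier W\<rbrakk> \<Longrightarrow> pair v w \<in> pure_tensor V W v w"
  unfolding pure_tensor_def tensor_cls_def by (intro Q.coset_self pair_closed)

lemma tensor_eqI:
  "\<lbrakk>P \<in> carrier (tensor_space V W); v \<in> carrier V; w \<in> carrier W; pure_tensor V W v w \<subseteq> P\<rbrakk>
    \<Longrightarrow> P = pure_tensor V W v w"
  unfolding pure_tensor_def tensor_cls_def tensor_space_def by (intro Q.coset_union_eq pair_closed)

end

lemma op_cat_simps [simp]: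
  "objs (op_cat C) = objs C" "Hom (op_cat C) X Y = Hom C Y X" "idm (op_cat C) = idm C"
  "cmp (op_cat C) X Y Z g f = cmp C Z Y X f g"
  by (simp_all add: op_cat_def)

lemma tensor_cat_simps [simp]:
  "objs (tensor_cat C D) = objs C \<times> objs D"
  "Hom (tensor_cat C D) (X, X') (Y, Y') = tensor_space (Hom C X Y) (Hom D X' Y')"
  "idm (tensor_cat C D) (X, X') = pure_tensor (Hom C X X) (Hom D X' X') (idm C X) (idm D X')"
  by (simp_all add: tensor_cat_def)

text \<open>The composite in the tensor category is a union of cosets. Since it is again a coset when the
  tensor category is a category, each of these cosets equals the whole union.\<close>

lemma cmp_pure_tensor:
  assumes C: "k_category C" and D: "k_category D" and CD: "k_category (tensor_cat C D)"
    and X: "X \<in> objs C" "Y \<in> objs C" "Z \<in> objs C" and X': "X' \<in> objs D" "Y' \<in> objs D" "Z' \<in> objs D"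
    and f: "f \<in> carrier (Hom C X Y)" "f' \<in> carrier (Hom D X' Y')"
    and g: "g \<in> carrier (Hom C Y Z)" "g' \<in> carrier (Hom D Y' Z')"
  shows "cmp (tensor_cat C D) (X, X') (Y, Y') (Z, Z')
      (pure_tensor (Hom C Y Z) (Hom D Y' Z') g g') (pure_tensor (Hom C X Y) (Hom D X' Y') f f')
    = pure_tensor (Hom C X Z) (Hom D X' Z') (cmp C X Y Z g f) (cmp D X' Y' Z' g' f')"
proof -
  interpret C: k_category C by fact
  interpret D: k_category D by fact
  interpret CD: k_category "tensor_cat C D" by fact
  interpret XY: tensor_spaces "Hom C X Y" "Hom D X' Y'"
    using X X' by (intro tensor_spaces.intro C.Hom_space D.Hom_space)
  interpret YZ: tensor_spaces "Hom C Y Z" "Hom D Y' Z'"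
    using X X' by (intro tensor_spaces.intro C.Hom_space D.Hom_space)
  interpret XZ: tensor_spaces "Hom C X Z" "Hom D X' Z'"
    using X X' by (intro tensor_spaces.intro C.Hom_space D.Hom_space)
  let ?F = "pure_tensor (Hom C X Y) (Hom D X' Y') f f'" and ?G = "pure_tensor (Hom C Y Z) (Hom D Y' Z') g g'"
  let ?phi = "\<lambda>(g, g') (f, f'). (cmp C X Y Z g f, cmp D X' Y' Z' g' f')"
  have "cmp (tensor_cat C D) (X, X') (Y, Y') (Z, Z') ?G ?F \<in> carrier (Hom (tensor_cat C D) (X, X') (Z, Z'))"
    using X X' f g XY.pure_tensor_closed YZ.pure_tensor_closed by (intro CD.cmp_closed) simp_all
  then have closed: "cmp (tensor_cat C D) (X, X') (Y, Y') (Z, Z') ?G ?F \<in> carrier (tensor_space (Hom C X Z) (Hom D X' Z'))"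
    by simp
  have "tensor_cls (Hom C X Z) (Hom D X' Z') (bilinear_ext ?phi (pair g g') (pair f f'))
      \<subseteq> cmp (tensor_cat C D) (X, X') (Y, Y') (Z, Z') ?G ?F"
    unfolding tensor_cat_def using XY.pure_tensor_rep[OF f] YZ.pure_tensor_rep[OF g] by force
  then have "pure_tensor (Hom C X Z) (Hom D X' Z') (cmp C X Y Z g f) (cmp D X' Y' Z' g' f')
      \<subseteq> cmp (tensor_cat C D) (X, X') (Y, Y') (Z, Z') ?G ?F"
    by (simp add: pure_tensor_def)
  with closed X X' f g show ?thesis
    by (intro XZ.tensor_eqI C.cmp_closed D.cmp_closed)
qed

lemma (in k_category) op_category: "k_category (op_cat C)"
  by (intro k_category.intro)
    (simp_all add: Hom_space idm_closed cmp_linear_left cmp_linear_right cmp_idm_left cmp_idm_right cmp_assoc)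

lemma fd_spaces_simps [simp]:
  "objs fd_spaces = {V. vectorspace class_ring V \<and> vectorspace.fin_dim class_ring V}"
  "Hom fd_spaces = linear_maps"
  "idm fd_spaces V = (\<lambda>v\<in>carrier V. v)"
  "cmp fd_spaces U V W g f = compose (carrier U) g f"
  by (simp_all add: fd_spaces_def)

section \<open>The actions on a bimodule\<close>

locale bimodule = T: k_category T + U: k_category U + M: k_functor "tensor_cat U (op_cat T)" fd_spaces M
  for T :: "('t, 'm, 'k::field) kcat" and U :: "('u, 'n, 'k) kcat" and M :: "('u, 'n, 't, 'm, 'x, 'k) bimod"
begin

lemma M_space: "\<lbrakk>t \<in> objs T; u \<in> objs U\<rbrakk> \<Longrightarrow> vectorspace class_ring (on_obj M (u, t))"
  and M_fin_dim: "\<lbrakk>t \<in> objs T; u \<in> objs U\<rbrakk> \<Longrightarrow> vectorspace.fin_dim class_ring (on_obj M (u, t))"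
  using M.on_obj_closed[of "(u, t)"] by simp_all

text \<open>The simultaneous action of \<open>g\<close> from the left and of \<open>f\<close> from
  the right. The one-sided actions are the cases where the other morphism is an identity, so all
  bimodule laws follow from \<open>act_idm\<close> and \<open>act_cmp\<close>.\<close>

definition act :: "'u \<Rightarrow> 't \<Rightarrow> 'u \<Rightarrow> 't \<Rightarrow> 'n \<Rightarrow> 'm \<Rightarrow> 'x \<Rightarrow> 'x" where
  "act u t u' t' g f = on_hom M (u, t) (u', t') (pure_tensor (Hom U u u') (Hom T t' t) g f)"

context
  fixes u u' t t' assumes objs [simp]: "u \<in> objs U" "u' \<in> objs U" "t \<in> objs T" "t' \<in> objs T"
begin

interpretation tensor_spaces "Hom U u u'" "Hom T t' t"
  by (intro tensor_spaces.intro U.Hom_space T.Hom_space) simp_all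

lemma act_mem: "\<lbrakk>g \<in> carrier (Hom U u u'); f \<in> carrier (Hom T t' t)\<rbrakk>
    \<Longrightarrow> act u t u' t' g f \<in> carrier (linear_maps (on_obj M (u, t)) (on_obj M (u', t')))"
  using M.on_hom_closed[of "(u, t)" "(u', t')" "pure_tensor (Hom U u u') (Hom T t' t) g f"]
  by (simp add: act_def pure_tensor_closed)

lemma act_hom: "\<lbrakk>g \<in> carrier (Hom U u u'); f \<in> carrier (Hom T t' t)\<rbrakk>
    \<Longrightarrow> act u t u' t' g f \<in> module_hom class_ring (on_obj M (u, t)) (on_obj M (u', t'))"
  using act_mem[of g f] by (simp add: linear_maps_def)

text \<open>A composite of three linear maps: tensoring with \<open>f\<close>, the functor
  \<open>M\<close> on morphisms, and evaluation at \<open>m\<close>.\<close>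

lemma act_hom_left:
  assumes f: "f \<in> carrier (Hom T t' t)" and m: "m \<in> carrier (on_obj M (u, t))"
  shows "(\<lambda>g. act u t u' t' g f m) \<in> module_hom class_ring (Hom U u u') (on_obj M (u', t'))"
proof -
  have "(\<lambda>g. act u t u' t' g f) \<in> module_hom class_ring (Hom U u u') (linear_maps (on_obj M (u, t)) (on_obj M (u', t')))"
    unfolding act_def using M.on_hom_linear[of "(u, t)" "(u', t')"]
    by (intro hom_compose[OF pure_tensor_hom_left[OF f]]) simp_all
  moreover have "(\<lambda>h. h m) \<in> module_hom class_ring (linear_maps (on_obj M (u, t)) (on_obj M (u', t'))) (on_obj M (u', t'))"
    using m by (intro module_homI) (auto simp: linear_maps_def intro: hom_closed)
  ultimately show ?thesis by (rule hom_compose)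
qed

lemma act_hom_right:
  assumes g: "g \<in> carrier (Hom U u u')" and m: "m \<in> carrier (on_obj M (u, t))"
  shows "(\<lambda>f. act u t u' t' g f m) \<in> module_hom class_ring (Hom T t' t) (on_obj M (u', t'))"
proof -
  have "(\<lambda>f. act u t u' t' g f) \<in> module_hom class_ring (Hom T t' t) (linear_maps (on_obj M (u, t)) (on_obj M (u', t')))"
    unfolding act_def using M.on_hom_linear[of "(u, t)" "(u', t')"]
    by (intro hom_compose[OF pure_tensor_hom_right[OF g]]) simp_all
  moreover have "(\<lambda>h. h m) \<in> module_hom class_ring (linear_maps (on_obj M (u, t)) (on_obj M (u', t'))) (on_obj M (u', t'))"
    using m by (intro module_homI) (auto simp: linear_maps_def intro: hom_closed)
  ultimately show ?thesis by (rule hom_compose)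
qed

end

lemma act_idm:
  assumes "u \<in> objs U" "t \<in> objs T" "m \<in> carrier (on_obj M (u, t))"
  shows "act u t u t (idm U u) (idm T t) m = m"
  using M.on_hom_idm[of "(u, t)"] assms by (simp add: act_def)

text \<open>Functoriality of \<open>M\<close> on composites of pure tensors. The second variable is
  contravariant, hence \<open>f1\<close> and \<open>f2\<close> are composed in the reverse
  order.\<close>

lemma act_cmp:
  assumes obj [simp]: "u1 \<in> objs U" "u2 \<in> objs U" "u3 \<in> objs U" "t1 \<in> objs T" "t2 \<in> objs T" "t3 \<in> objs T"
    and g: "g1 \<in> carrier (Hom U u1 u2)" "g2 \<in> carrier (Hom U u2 u3)"
    and f: "f1 \<in> carrier (Hom T t2 t1)" "f2 \<in> carrier (Hom T t3 t2)"
    and m: "m \<in> carrier (on_obj M (u1, t1))"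
  shows "act u2 t2 u3 t3 g2 f2 (act u1 t1 u2 t2 g1 f1 m) = act u1 t1 u3 t3 (cmp U u1 u2 u3 g2 g1) (cmp T t3 t2 t1 f1 f2) m"
proof -
  interpret H12: tensor_spaces "Hom U u1 u2" "Hom T t2 t1"
    by (intro tensor_spaces.intro U.Hom_space T.Hom_space) simp_all
  interpret H23: tensor_spaces "Hom U u2 u3" "Hom T t3 t2"
    by (intro tensor_spaces.intro U.Hom_space T.Hom_space) simp_all
  have "cmp (tensor_cat U (op_cat T)) (u1, t1) (u2, t2) (u3, t3)
      (pure_tensor (Hom U u2 u3) (Hom T t3 t2) g2 f2) (pure_tensor (Hom U u1 u2) (Hom T t2 t1) g1 f1)
    = pure_tensor (Hom U u1 u3) (Hom T t3 t1) (cmp U u1 u2 u3 g2 g1) (cmp T t3 t2 t1 f1 f2)"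
    using cmp_pure_tensor[OF U.k_category_axioms T.op_category M.dom.k_category_axioms, of u1 u2 u3 t1 t2 t3 g1 f1 g2 f2]
      g f by simp
  then have "act u1 t1 u3 t3 (cmp U u1 u2 u3 g2 g1) (cmp T t3 t2 t1 f1 f2)
      = compose (carrier (on_obj M (u1, t1))) (act u2 t2 u3 t3 g2 f2) (act u1 t1 u2 t2 g1 f1)"
    using M.on_hom_cmp[of "(u1, t1)" "(u2, t2)" "(u3, t3)" "pure_tensor (Hom U u1 u2) (Hom T t2 t1) g1 f1"
        "pure_tensor (Hom U u2 u3) (Hom T t3 t2) g2 f2"] g f
    by (simp add: act_def H12.pure_tensor_closed H23.pure_tensor_closed)
  then show ?thesis using m by (simp add: compose_eq)
qed

abbreviation lact :: "'t \<Rightarrow> 'u \<Rightarrow> 'u \<Rightarrow> 'n \<Rightarrow> 'x \<Rightarrow> 'x" where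
  "lact \<equiv> left_act T U M"

abbreviation ract :: "'u \<Rightarrow> 't \<Rightarrow> 't \<Rightarrow> 'x \<Rightarrow> 'm \<Rightarrow> 'x" where
  "ract \<equiv> right_act T U M"

lemma lact_eq: "lact t u u' g m = act u t u' t g (idm T t) m"
  and ract_eq: "ract u t t' m f = act u t' u t (idm U u) f m"
  by (simp_all add: left_act_def right_act_def act_def)

lemma lact_hom:
  assumes "u \<in> objs U" "u' \<in> objs U" "t \<in> objs T"
  shows "g \<in> carrier (Hom U u u') \<Longrightarrow> (\<lambda>m. lact t u u' g m) \<in> module_hom class_ring (on_obj M (u, t)) (on_obj M (u', t))"
    and "m \<in> carrier (on_obj M (u, t)) \<Longrightarrow> (\<lambda>g. lact t u u' g m) \<in> module_hom class_ring (Hom U u u') (on_obj M (u', t))"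
  unfolding lact_eq using assms by (auto intro!: act_hom_left T.idm_closed act_hom)

lemma ract_hom:
  assumes "u \<in> objs U" "t \<in> objs T" "t' \<in> objs T"
  shows "f \<in> carrier (Hom T t t') \<Longrightarrow> (\<lambda>m. ract u t t' m f) \<in> module_hom class_ring (on_obj M (u, t')) (on_obj M (u, t))"
    and "m \<in> carrier (on_obj M (u, t')) \<Longrightarrow> (\<lambda>f. ract u t t' m f) \<in> module_hom class_ring (Hom T t t') (on_obj M (u, t))"
  unfolding ract_eq using assms by (auto intro!: act_hom_right U.idm_closed act_hom)

lemma lact_closed:
  "\<lbrakk>u \<in> objs U; u' \<in> objs U; t \<in> objs T; g \<in> carrier (Hom U u u'); m \<in> carrier (on_obj M (u, t))\<rbrakk>
    \<Longrightarrow> lact t u u' g m \<in> carrier (on_obj M (u', t))"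
  by (rule hom_closed[OF lact_hom(1)])

lemma ract_closed:
  "\<lbrakk>u \<in> objs U; t \<in> objs T; t' \<in> objs T; f \<in> carrier (Hom T t t'); m \<in> carrier (on_obj M (u, t'))\<rbrakk>
    \<Longrightarrow> ract u t t' m f \<in> carrier (on_obj M (u, t))"
  by (rule hom_closed[OF ract_hom(1)])

lemma lact_zero:
  assumes "u \<in> objs U" "u' \<in> objs U" "t \<in> objs T"
  shows "g \<in> carrier (Hom U u u') \<Longrightarrow> lact t u u' g \<zero>\<^bsub>on_obj M (u, t)\<^esub> = \<zero>\<^bsub>on_obj M (u', t)\<^esub>"
    and "m \<in> carrier (on_obj M (u, t)) \<Longrightarrow> lact t u u' \<zero>\<^bsub>Hom U u u'\<^esub> m = \<zero>\<^bsub>on_obj M (u', t)\<^esub>"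
  using assms
  by (auto intro!: hom_zero[OF _ _ lact_hom(1)] hom_zero[OF _ _ lact_hom(2)] M_space U.Hom_space)

lemma ract_zero:
  assumes "u \<in> objs U" "t \<in> objs T" "t' \<in> objs T"
  shows "f \<in> carrier (Hom T t t') \<Longrightarrow> ract u t t' \<zero>\<^bsub>on_obj M (u, t')\<^esub> f = \<zero>\<^bsub>on_obj M (u, t)\<^esub>"
    and "m \<in> carrier (on_obj M (u, t')) \<Longrightarrow> ract u t t' m \<zero>\<^bsub>Hom T t t'\<^esub> = \<zero>\<^bsub>on_obj M (u, t)\<^esub>"
  using assms
  by (auto intro!: hom_zero[OF _ _ ract_hom(1)] hom_zero[OF _ _ ract_hom(2)] M_space T.Hom_space)

lemma lact_idm: "\<lbrakk>u \<in> objs U; t \<in> objs T; m \<in> carrier (on_obj M (u, t))\<rbrakk> \<Longrightarrow> lact t u u (idm U u) m = m"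
  and ract_idm: "\<lbrakk>u \<in> objs U; t \<in> objs T; m \<in> carrier (on_obj M (u, t))\<rbrakk> \<Longrightarrow> ract u t t m (idm T t) = m"
  by (simp_all add: lact_eq ract_eq act_idm)

lemma lact_cmp:
  "\<lbrakk>u1 \<in> objs U; u2 \<in> objs U; u3 \<in> objs U; t \<in> objs T; g1 \<in> carrier (Hom U u1 u2);
    g2 \<in> carrier (Hom U u2 u3); m \<in> carrier (on_obj M (u1, t))\<rbrakk>
    \<Longrightarrow> lact t u1 u3 (cmp U u1 u2 u3 g2 g1) m = lact t u2 u3 g2 (lact t u1 u2 g1 m)"
  by (simp add: lact_eq act_cmp T.idm_closed T.cmp_idm_left)

lemma ract_cmp:
  "\<lbrakk>u \<in> objs U; t1 \<in> objs T; t2 \<in> objs T; t3 \<in> objs T; f1 \<in> carrier (Hom T t1 t2);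
    f2 \<in> carrier (Hom T t2 t3); m \<in> carrier (on_obj M (u, t3))\<rbrakk>
    \<Longrightarrow> ract u t1 t3 m (cmp T t1 t2 t3 f2 f1) = ract u t1 t2 (ract u t2 t3 m f2) f1"
  by (simp add: ract_eq act_cmp U.idm_closed U.cmp_idm_left)

text \<open>Both sides are the simultaneous action of \<open>g\<close> and \<open>f\<close>. This
  interchange is what makes composition of triangular matrices associative.\<close>

lemma lact_ract:
  "\<lbrakk>u \<in> objs U; u' \<in> objs U; t \<in> objs T; t' \<in> objs T; g \<in> carrier (Hom U u u'); f \<in> carrier (Hom T t t');
    m \<in> carrier (on_obj M (u, t'))\<rbrakk>
    \<Longrightarrow> lact t u u' g (ract u t t' m f) = ract u' t t' (lact t' u u' g m) f"
  by (simp add: lact_eq ract_eq act_cmp U.idm_closed T.idm_closed U.cmp_idm_left T.cmp_idm_left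
      U.cmp_idm_right T.cmp_idm_right)

end

section \<open>The triangular matrix category\<close>

lemma (in abelian_monoid) add_swap:
  "\<lbrakk>a \<in> carrier G; b \<in> carrier G; c \<in> carrier G; d \<in> carrier G\<rbrakk>
    \<Longrightarrow> (a \<oplus> b) \<oplus> (c \<oplus> d) = (a \<oplus> c) \<oplus> (b \<oplus> d)"
  by (simp add: a_ac)

context bimodule
begin

abbreviation "Tri \<equiv> triangular_cat T U M"

lemma Tri_simps:
  "objs Tri = objs T \<times> objs U"
  "(f, m, g) \<in> carrier (Hom Tri (t, u) (t', u'))
    \<longleftrightarrow> f \<in> carrier (Hom T t t') \<and> m \<in> carrier (on_obj M (u', t)) \<and> g \<in> carrier (Hom U u u')"
  "\<zero>\<^bsub>Hom Tri (t, u) (t', u')\<^esub> = (\<zero>\<^bsub>Hom T t t'\<^esub>, \<zero>\<^bsub>on_obj M (u', t)\<^esub>, \<zero>\<^bsub>Hom U u u'\<^esub>)"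
  "(f, m, g) \<oplus>\<^bsub>Hom Tri (t, u) (t', u')\<^esub> (f', m', g')
    = (f \<oplus>\<^bsub>Hom T t t'\<^esub> f', m \<oplus>\<^bsub>on_obj M (u', t)\<^esub> m', g \<oplus>\<^bsub>Hom U u u'\<^esub> g')"
  "c \<odot>\<^bsub>Hom Tri (t, u) (t', u')\<^esub> (f, m, g)
    = (c \<odot>\<^bsub>Hom T t t'\<^esub> f, c \<odot>\<^bsub>on_obj M (u', t)\<^esub> m, c \<odot>\<^bsub>Hom U u u'\<^esub> g)"
  "idm Tri (t, u) = (idm T t, \<zero>\<^bsub>on_obj M (u, t)\<^esub>, idm U u)"
  "cmp Tri (t1, u1) (t2, u2) (t3, u3) (f2, m2, g2) (f1, m1, g1)
    = (cmp T t1 t2 t3 f2 f1, ract u3 t1 t2 m2 f1 \<oplus>\<^bsub>on_obj M (u3, t1)\<^esub> lact t1 u2 u3 g2 m1, cmp U u1 u2 u3 g2 g1)"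
  by (simp_all add: triangular_cat_def direct_sum_def)

lemma Tri_Hom_space:
  assumes "t \<in> objs T" "u \<in> objs U" "t' \<in> objs T" "u' \<in> objs U"
  shows "vectorspace class_ring (Hom Tri (t, u) (t', u'))"
  using assms unfolding triangular_cat_def
  by (simp add: direct_sum_is_vs T.Hom_space U.Hom_space M_space)

lemma Tri_cmp_closed:
  assumes "t1 \<in> objs T" "u1 \<in> objs U" "t2 \<in> objs T" "u2 \<in> objs U" "t3 \<in> objs T" "u3 \<in> objs U"
    and p: "p \<in> carrier (Hom Tri (t1, u1) (t2, u2))" and q: "q \<in> carrier (Hom Tri (t2, u2) (t3, u3))"
  shows "cmp Tri (t1, u1) (t2, u2) (t3, u3) q p \<in> carrier (Hom Tri (t1, u1) (t3, u3))"
proof -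
  interpret H: vectorspace class_ring "on_obj M (u3, t1)"
    using assms by (intro M_space)
  obtain f m g f' m' g' where "p = (f, m, g)" "q = (f', m', g')"
    by (cases p; cases q)
  with assms show ?thesis
    by (simp add: Tri_simps T.cmp_closed U.cmp_closed lact_closed ract_closed)
qed

lemma Tri_category: "k_category Tri"
proof (rule k_category.intro, goal_cases)
  case (1 X Y)
  then show ?case by (cases X; cases Y) (simp add: Tri_simps(1) Tri_Hom_space)
next
  case (2 X)
  then obtain t u where X: "X = (t, u)" "t \<in> objs T" "u \<in> objs U" by (auto simp: Tri_simps(1))
  interpret H: vectorspace class_ring "on_obj M (u, t)"
    using X by (intro M_space)
  show ?case using X by (simp add: Tri_simps T.idm_closed U.idm_closed)
next
  case (3 X Y Z q)
  then obtain t1 u1 t2 u2 t3 u3 f2 m2 g2 where XYZ: "X = (t1, u1)" "Y = (t2, u2)" "Z = (t3, u3)"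
    and [simp]: "t1 \<in> objs T" "u1 \<in> objs U" "t2 \<in> objs T" "u2 \<in> objs U" "t3 \<in> objs T" "u3 \<in> objs U"
    and q: "q = (f2, m2, g2)"
    by (cases X; cases Y; cases Z; cases q) (simp add: Tri_simps(1))
  with 3 have [simp]: "f2 \<in> carrier (Hom T t2 t3)" "m2 \<in> carrier (on_obj M (u3, t2))" "g2 \<in> carrier (Hom U u2 u3)"
    by (simp_all add: Tri_simps)
  interpret H: vectorspace class_ring "on_obj M (u3, t1)"
    by (intro M_space) simp_all
  interpret H1: vectorspace class_ring "on_obj M (u2, t1)"
    by (intro M_space) simp_all
  show ?case unfolding XYZ
  proof (rule module_homI)
    show "cmp Tri (t1, u1) (t2, u2) (t3, u3) q p \<in> carrier (Hom Tri (t1, u1) (t3, u3))"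
      if "p \<in> carrier (Hom Tri (t1, u1) (t2, u2))" for p
      using that 3(4) unfolding XYZ by (intro Tri_cmp_closed) simp_all
    show "cmp Tri (t1, u1) (t2, u2) (t3, u3) q (p \<oplus>\<^bsub>Hom Tri (t1, u1) (t2, u2)\<^esub> p')
        = cmp Tri (t1, u1) (t2, u2) (t3, u3) q p \<oplus>\<^bsub>Hom Tri (t1, u1) (t3, u3)\<^esub> cmp Tri (t1, u1) (t2, u2) (t3, u3) q p'"
      if p: "p \<in> carrier (Hom Tri (t1, u1) (t2, u2))" "p' \<in> carrier (Hom Tri (t1, u1) (t2, u2))" for p p'
    proof -
      obtain f m g f' m' g' where eq: "p = (f, m, g)" "p' = (f', m', g')"
        by (cases p; cases p')
      with p have "f \<in> carrier (Hom T t1 t2)" "m \<in> carrier (on_obj M (u2, t1))" "g \<in> carrier (Hom U u1 u2)"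
        "f' \<in> carrier (Hom T t1 t2)" "m' \<in> carrier (on_obj M (u2, t1))" "g' \<in> carrier (Hom U u1 u2)"
        by (simp_all add: Tri_simps)
      then show ?thesis
        by (simp add: eq q Tri_simps T.cmp_add_right U.cmp_add_right hom_add[OF ract_hom(2)] hom_add[OF lact_hom(1)]
            H.add_swap ract_closed lact_closed)
    qed
    show "cmp Tri (t1, u1) (t2, u2) (t3, u3) q (c \<odot>\<^bsub>Hom Tri (t1, u1) (t2, u2)\<^esub> p)
        = c \<odot>\<^bsub>Hom Tri (t1, u1) (t3, u3)\<^esub> cmp Tri (t1, u1) (t2, u2) (t3, u3) q p"
      if p: "p \<in> carrier (Hom Tri (t1, u1) (t2, u2))" for c p
    proof -
      obtain f m g where eq: "p = (f, m, g)"
        by (cases p)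
      with p have "f \<in> carrier (Hom T t1 t2)" "m \<in> carrier (on_obj M (u2, t1))" "g \<in> carrier (Hom U u1 u2)"
        by (simp_all add: Tri_simps)
      then show ?thesis
        using H.smult_r_distr[of c "ract u3 t1 t2 m2 f" "lact t1 u2 u3 g2 m"]
        by (simp add: eq q Tri_simps T.cmp_smult_right U.cmp_smult_right hom_smult[OF ract_hom(2)] hom_smult[OF lact_hom(1)]
            ract_closed lact_closed)
    qed
  qed
next
  case (4 X Y Z p)
  then obtain t1 u1 t2 u2 t3 u3 f1 m1 g1 where XYZ: "X = (t1, u1)" "Y = (t2, u2)" "Z = (t3, u3)"
    and [simp]: "t1 \<in> objs T" "u1 \<in> objs U" "t2 \<in> objs T" "u2 \<in> objs U" "t3 \<in> objs T" "u3 \<in> objs U"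
    and p: "p = (f1, m1, g1)"
    by (cases X; cases Y; cases Z; cases p) (simp add: Tri_simps(1))
  with 4 have [simp]: "f1 \<in> carrier (Hom T t1 t2)" "m1 \<in> carrier (on_obj M (u2, t1))" "g1 \<in> carrier (Hom U u1 u2)"
    by (simp_all add: Tri_simps)
  interpret H: vectorspace class_ring "on_obj M (u3, t1)"
    by (intro M_space) simp_all
  show ?case unfolding XYZ
  proof (rule module_homI)
    show "cmp Tri (t1, u1) (t2, u2) (t3, u3) q p \<in> carrier (Hom Tri (t1, u1) (t3, u3))"
      if "q \<in> carrier (Hom Tri (t2, u2) (t3, u3))" for q
      using that 4(4) unfolding XYZ by (intro Tri_cmp_closed) simp_all
    show "cmp Tri (t1, u1) (t2, u2) (t3, u3) (q \<oplus>\<^bsub>Hom Tri (t2, u2) (t3, u3)\<^esub> q') p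
        = cmp Tri (t1, u1) (t2, u2) (t3, u3) q p \<oplus>\<^bsub>Hom Tri (t1, u1) (t3, u3)\<^esub> cmp Tri (t1, u1) (t2, u2) (t3, u3) q' p"
      if q: "q \<in> carrier (Hom Tri (t2, u2) (t3, u3))" "q' \<in> carrier (Hom Tri (t2, u2) (t3, u3))" for q q'
    proof -
      obtain f m g f' m' g' where eq: "q = (f, m, g)" "q' = (f', m', g')"
        by (cases q; cases q')
      with q have "f \<in> carrier (Hom T t2 t3)" "m \<in> carrier (on_obj M (u3, t2))" "g \<in> carrier (Hom U u2 u3)"
        "f' \<in> carrier (Hom T t2 t3)" "m' \<in> carrier (on_obj M (u3, t2))" "g' \<in> carrier (Hom U u2 u3)"
        by (simp_all add: Tri_simps)
      then show ?thesis
        by (simp add: eq p Tri_simps T.cmp_add_left U.cmp_add_left hom_add[OF ract_hom(1)] hom_add[OF lact_hom(2)]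
            H.add_swap ract_closed lact_closed)
    qed
    show "cmp Tri (t1, u1) (t2, u2) (t3, u3) (c \<odot>\<^bsub>Hom Tri (t2, u2) (t3, u3)\<^esub> q) p
        = c \<odot>\<^bsub>Hom Tri (t1, u1) (t3, u3)\<^esub> cmp Tri (t1, u1) (t2, u2) (t3, u3) q p"
      if q: "q \<in> carrier (Hom Tri (t2, u2) (t3, u3))" for c q
    proof -
      obtain f m g where eq: "q = (f, m, g)"
        by (cases q)
      with q have "f \<in> carrier (Hom T t2 t3)" "m \<in> carrier (on_obj M (u3, t2))" "g \<in> carrier (Hom U u2 u3)"
        by (simp_all add: Tri_simps)
      then show ?thesis
        using H.smult_r_distr[of c "ract u3 t1 t2 m f1" "lact t1 u2 u3 g m1"]
        by (simp add: eq p Tri_simps T.cmp_smult_left U.cmp_smult_left hom_smult[OF ract_hom(1)] hom_smult[OF lact_hom(2)]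
            ract_closed lact_closed)
    qed
  qed
next
  case (5 X Y p)
  then obtain t u t' u' f m g where XY: "X = (t, u)" "Y = (t', u')" "p = (f, m, g)"
    and [simp]: "t \<in> objs T" "u \<in> objs U" "t' \<in> objs T" "u' \<in> objs U"
    by (cases X; cases Y; cases p) (simp add: Tri_simps(1))
  interpret H: vectorspace class_ring "on_obj M (u', t)"
    by (intro M_space) simp_all
  show ?case
    using 5(3) by (simp add: XY Tri_simps T.cmp_idm_left U.cmp_idm_left ract_zero lact_idm)
next
  case (6 X Y p)
  then obtain t u t' u' f m g where XY: "X = (t, u)" "Y = (t', u')" "p = (f, m, g)"
    and [simp]: "t \<in> objs T" "u \<in> objs U" "t' \<in> objs T" "u' \<in> objs U"
    by (cases X; cases Y; cases p) (simp add: Tri_simps(1))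
  interpret H: vectorspace class_ring "on_obj M (u', t)"
    by (intro M_space) simp_all
  show ?case
    using 6(3) by (simp add: XY Tri_simps T.cmp_idm_right U.cmp_idm_right lact_zero ract_idm)
next
  case (7 W X Y Z p q r)
  then obtain t0 u0 t1 u1 t2 u2 t3 u3 f m g f' m' g' f'' m'' g''
    where eq: "W = (t0, u0)" "X = (t1, u1)" "Y = (t2, u2)" "Z = (t3, u3)"
      "p = (f, m, g)" "q = (f', m', g')" "r = (f'', m'', g'')"
    and [simp]: "t0 \<in> objs T" "u0 \<in> objs U" "t1 \<in> objs T" "u1 \<in> objs U"
      "t2 \<in> objs T" "u2 \<in> objs U" "t3 \<in> objs T" "u3 \<in> objs U"
    by (cases W; cases X; cases Y; cases Z; cases p; cases q; cases r) (simp add: Tri_simps(1))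
  with 7 have [simp]: "f \<in> carrier (Hom T t0 t1)" "m \<in> carrier (on_obj M (u1, t0))" "g \<in> carrier (Hom U u0 u1)"
    "f' \<in> carrier (Hom T t1 t2)" "m' \<in> carrier (on_obj M (u2, t1))" "g' \<in> carrier (Hom U u1 u2)"
    "f'' \<in> carrier (Hom T t2 t3)" "m'' \<in> carrier (on_obj M (u3, t2))" "g'' \<in> carrier (Hom U u2 u3)"
    by (simp_all add: Tri_simps)
  interpret H: vectorspace class_ring "on_obj M (u3, t0)"
    by (intro M_space) simp_all
  \<comment> \<open>On both sides the lower left entry expands into three terms. The outer two agree
    because the actions respect composites; the middle one is (g'' m') f on one side and g'' (m' f)
    on the other, which is \<open>lact_ract\<close>.\<close>
  show ?case
    by (simp add: eq Tri_simps T.cmp_assoc U.cmp_assoc hom_add[OF lact_hom(1)] hom_add[OF ract_hom(1)]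
        ract_cmp lact_cmp lact_ract lact_closed ract_closed H.a_assoc)
qed

lemma Tri_T_hom:
  assumes "t \<in> objs T" "u \<in> objs U" "t' \<in> objs T" "u' \<in> objs U"
  shows "(\<lambda>f. (f, \<zero>\<^bsub>on_obj M (u', t)\<^esub>, \<zero>\<^bsub>Hom U u u'\<^esub>)) \<in> module_hom class_ring (Hom T t t') (Hom Tri (t, u) (t', u'))"
proof -
  interpret H: vectorspace class_ring "on_obj M (u', t)" using assms by (intro M_space)
  interpret K: vectorspace class_ring "Hom U u u'" using assms by (intro U.Hom_space)
  show ?thesis
    using H.smult_r_null K.smult_r_null by (intro module_homI) (simp_all add: Tri_simps)
qed

lemma Tri_M_hom:
  assumes "t \<in> objs T" "u \<in> objs U" "t' \<in> objs T" "u' \<in> objs U"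
  shows "(\<lambda>m. (\<zero>\<^bsub>Hom T t t'\<^esub>, m, \<zero>\<^bsub>Hom U u u'\<^esub>)) \<in> module_hom class_ring (on_obj M (u', t)) (Hom Tri (t, u) (t', u'))"
proof -
  interpret H: vectorspace class_ring "Hom T t t'" using assms by (intro T.Hom_space)
  interpret K: vectorspace class_ring "Hom U u u'" using assms by (intro U.Hom_space)
  show ?thesis
    using H.smult_r_null K.smult_r_null by (intro module_homI) (simp_all add: Tri_simps)
qed

lemma Tri_U_hom:
  assumes "t \<in> objs T" "u \<in> objs U" "t' \<in> objs T" "u' \<in> objs U"
  shows "(\<lambda>g. (\<zero>\<^bsub>Hom T t t'\<^esub>, \<zero>\<^bsub>on_obj M (u', t)\<^esub>, g)) \<in> module_hom class_ring (Hom U u u') (Hom Tri (t, u) (t', u'))"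
proof -
  interpret H: vectorspace class_ring "Hom T t t'" using assms by (intro T.Hom_space)
  interpret K: vectorspace class_ring "on_obj M (u', t)" using assms by (intro M_space)
  show ?thesis
    using H.smult_r_null K.smult_r_null by (intro module_homI) (simp_all add: Tri_simps)
qed

end

section \<open>Biproducts in the triangular matrix category\<close>

lemma slots_filter: "slots (filter_mset P X) = {x \<in> slots X. P (fst x)}"
  by (auto simp: slots_def split: if_splits)

text \<open>The empty multiset has no slots, so its identity is an empty sum: it is a zero object.
  It fills the diagonal position that a single vertex leaves free.\<close>

lemma (in vertex_biproducts) idm_empty: "idm D (ob {#}) = \<zero>\<^bsub>Hom D (ob {#}) (ob {#})\<^esub>"
proof -
  interpret H: vectorspace class_ring "Hom D (ob {#}) (ob {#})"
    by (intro Hom_space ob_closed) simp_all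
  show ?thesis using sum_inc_prj[of "{#}"] by (simp add: slots_def)
qed

locale bimodule_biproducts = bimodule T U M +
    BT: vertex_biproducts T VT "\<lambda>X. X" incT prjT + BU: vertex_biproducts U VU "\<lambda>X. X" incU prjU
  for T :: "('v multiset, 'm, 'k::field) kcat" and U :: "('v multiset, 'n, 'k) kcat"
    and M :: "('v multiset, 'n, 'v multiset, 'm, 'x, 'k) bimod" and VT VU incT prjT incU prjU +
  assumes disjoint: "VT \<inter> VU = {}"
begin

definition Tpart :: "'v multiset \<Rightarrow> 'v multiset" where "Tpart X = filter_mset (\<lambda>a. a \<in> VT) X"
text \<open>Taking the complement of \<open>VT\<close> instead of membership in \<open>VU\<close>
  makes every multiset the sum of its two parts, without a side condition on its elements.\<close>

definition Upart :: "'v multiset \<Rightarrow> 'v multiset" where "Upart X = filter_mset (\<lambda>a. a \<notin> VT) X"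

definition tri_ob :: "'v multiset \<Rightarrow> 'v multiset \<times> 'v multiset" where
  "tri_ob X = (Tpart X, Upart X)"

definition tri_inc :: "'v multiset \<Rightarrow> 'v \<times> nat \<Rightarrow> 'm \<times> 'x \<times> 'n" where
  "tri_inc X x =
    (if fst x \<in> VT then (incT (Tpart X) x, \<zero>\<^bsub>on_obj M (Upart X, {#fst x#})\<^esub>, \<zero>\<^bsub>Hom U {#} (Upart X)\<^esub>)
     else (\<zero>\<^bsub>Hom T {#} (Tpart X)\<^esub>, \<zero>\<^bsub>on_obj M (Upart X, {#})\<^esub>, incU (Upart X) x))"

definition tri_prj :: "'v multiset \<Rightarrow> 'v \<times> nat \<Rightarrow> 'm \<times> 'x \<times> 'n" where
  "tri_prj X x =
    (if fst x \<in> VT then (prjT (Tpart X) x, \<zero>\<^bsub>on_obj M ({#}, Tpart X)\<^esub>, \<zero>\<^bsub>Hom U (Upart X) {#}\<^esub>)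
     else (\<zero>\<^bsub>Hom T (Tpart X) {#}\<^esub>, \<zero>\<^bsub>on_obj M ({#fst x#}, Tpart X)\<^esub>, prjU (Upart X) x))"

lemma tri_ob_single:
  "a \<in> VT \<Longrightarrow> tri_ob {#a#} = ({#a#}, {#})" "a \<in> VU \<Longrightarrow> tri_ob {#a#} = ({#}, {#a#})"
  using disjoint by (auto simp: tri_ob_def Tpart_def Upart_def)

lemma part_closed:
  assumes "set_mset X \<subseteq> VT \<union> VU"
  shows "set_mset (Tpart X) \<subseteq> VT" "set_mset (Upart X) \<subseteq> VU" "Tpart X \<in> objs T" "Upart X \<in> objs U"
proof -
  show "set_mset (Tpart X) \<subseteq> VT" "set_mset (Upart X) \<subseteq> VU"
    using assms by (auto simp: Tpart_def Upart_def)
  then show "Tpart X \<in> objs T" "Upart X \<in> objs U"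
    by (simp_all add: BT.ob_closed BU.ob_closed)
qed

lemma empty_closed [simp]: "{#} \<in> objs T" "{#} \<in> objs U"
  by (simp_all add: BT.ob_closed BU.ob_closed)

text \<open>Filtering keeps the multiplicity of each surviving vertex, so a slot of \<open>X\<close>
  is literally a slot of one of the parts, with the same number.\<close>

lemma slots_parts:
  "slots (Tpart X) = {x \<in> slots X. fst x \<in> VT}" "slots (Upart X) = {x \<in> slots X. fst x \<notin> VT}"
  by (simp_all add: Tpart_def Upart_def slots_filter)

lemma slots_split: "slots X = slots (Tpart X) \<union> slots (Upart X)"
  by (auto simp: slots_parts)

lemma M_zero_closed: "\<lbrakk>t \<in> objs T; u \<in> objs U\<rbrakk> \<Longrightarrow> \<zero>\<^bsub>on_obj M (u, t)\<^esub> \<in> carrier (on_obj M (u, t))"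
proof -
  assume "t \<in> objs T" "u \<in> objs U"
  then interpret vectorspace class_ring "on_obj M (u, t)" by (rule M_space)
  show ?thesis by simp
qed

lemma M_zero_add: "\<lbrakk>t \<in> objs T; u \<in> objs U\<rbrakk>
  \<Longrightarrow> \<zero>\<^bsub>on_obj M (u, t)\<^esub> \<oplus>\<^bsub>on_obj M (u, t)\<^esub> \<zero>\<^bsub>on_obj M (u, t)\<^esub> = \<zero>\<^bsub>on_obj M (u, t)\<^esub>"
proof -
  assume "t \<in> objs T" "u \<in> objs U"
  then interpret vectorspace class_ring "on_obj M (u, t)" by (rule M_space)
  show ?thesis by simp
qed

lemma T_zero_closed: "\<lbrakk>t \<in> objs T; t' \<in> objs T\<rbrakk> \<Longrightarrow> \<zero>\<^bsub>Hom T t t'\<^esub> \<in> carrier (Hom T t t')"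
proof -
  assume "t \<in> objs T" "t' \<in> objs T"
  then interpret vectorspace class_ring "Hom T t t'" by (rule T.Hom_space)
  show ?thesis by simp
qed

lemma U_zero_closed: "\<lbrakk>t \<in> objs U; t' \<in> objs U\<rbrakk> \<Longrightarrow> \<zero>\<^bsub>Hom U t t'\<^esub> \<in> carrier (Hom U t t')"
proof -
  assume "t \<in> objs U" "t' \<in> objs U"
  then interpret vectorspace class_ring "Hom U t t'" by (rule U.Hom_space)
  show ?thesis by simp
qed

lemmas tri_zeros = M_zero_closed M_zero_add T_zero_closed U_zero_closed lact_zero ract_zero
  T.cmp_zero_left T.cmp_zero_right U.cmp_zero_left U.cmp_zero_right

lemma slot_cases:
  assumes X: "set_mset X \<subseteq> VT \<union> VU" and x: "x \<in> slots X"
  obtains (T) "fst x \<in> VT" "x \<in> slots (Tpart X)" "tri_ob {#fst x#} = ({#fst x#}, {#})" "{#fst x#} \<in> objs T"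
  | (U) "fst x \<notin> VT" "fst x \<in> VU" "x \<in> slots (Upart X)" "tri_ob {#fst x#} = ({#}, {#fst x#})" "{#fst x#} \<in> objs U"
proof (cases "fst x \<in> VT")
  case True
  then show ?thesis using x by (intro T) (simp_all add: slots_parts tri_ob_single BT.ob_closed)
next
  case False
  then have "fst x \<in> VU" using fst_slot[OF x] X by auto
  then show ?thesis using x False by (intro U) (simp_all add: slots_parts tri_ob_single BU.ob_closed)
qed

text \<open>All inclusions and projections are diagonal matrices, and so are their composites, since
  both terms of a lower left entry are actions on or by zero. The laws therefore split into those of
  \<open>T\<close> and those of \<open>U\<close>; in the decomposition of the identity the sum is
  split along the slots of the two parts.\<close>

lemma tri_biproducts: "vertex_biproducts Tri (VT \<union> VU) tri_ob tri_inc tri_prj"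
proof (intro vertex_biproducts.intro Tri_category vertex_biproducts_axioms.intro, goal_cases)
  case (1 X)
  then show ?case by (simp add: tri_ob_def Tri_simps(1) part_closed)
next
  case (2 X x)
  note [simp] = part_closed[OF 2(1)]
  show ?case
    using 2 by (cases rule: slot_cases)
      (simp_all add: tri_ob_def[of X] tri_inc_def Tri_simps tri_zeros BT.inc_closed BU.inc_closed)
next
  case (3 X x)
  note [simp] = part_closed[OF 3(1)]
  show ?case
    using 3 by (cases rule: slot_cases)
      (simp_all add: tri_ob_def[of X] tri_prj_def Tri_simps tri_zeros BT.prj_closed BU.prj_closed)
next
  case (4 X x)
  note [simp] = part_closed[OF 4(1)]
  show ?case
    using 4 by (cases rule: slot_cases)
      (simp_all add: tri_ob_def[of X] tri_inc_def tri_prj_def Tri_simps tri_zeros BT.prj_closed BU.prj_closed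
        BT.inc_closed BU.inc_closed BT.prj_inc BU.prj_inc BT.idm_empty BU.idm_empty)
next
  case (5 X x y)
  note [simp] = part_closed[OF 5(1)]
  show ?case
    using 5(1,2)
  proof (cases rule: slot_cases)
    case T
    note Tx [simp] = this
    show ?thesis
      using 5(1,3) by (cases rule: slot_cases)
      (simp_all add: tri_ob_def[of X] tri_inc_def tri_prj_def Tri_simps tri_zeros BT.prj_closed BU.prj_closed
        BT.inc_closed BU.inc_closed BT.prj_inc_zero BU.prj_inc_zero 5(4))
  next
    case U
    note Ux [simp] = this
    show ?thesis
      using 5(1,3) by (cases rule: slot_cases)
      (simp_all add: tri_ob_def[of X] tri_inc_def tri_prj_def Tri_simps tri_zeros BT.prj_closed BU.prj_closed
        BT.inc_closed BU.inc_closed BT.prj_inc_zero BU.prj_inc_zero 5(4))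
  qed
next
  case (6 X)
  note [simp] = part_closed[OF 6]
  let ?H = "Hom Tri (Tpart X, Upart X) (Tpart X, Upart X)"
  let ?e = "\<lambda>x. cmp Tri (tri_ob X) (tri_ob {#fst x#}) (tri_ob X) (tri_inc X x) (tri_prj X x)"
  let ?eT = "\<lambda>x. cmp T (Tpart X) {#fst x#} (Tpart X) (incT (Tpart X) x) (prjT (Tpart X) x)"
  let ?eU = "\<lambda>x. cmp U (Upart X) {#fst x#} (Upart X) (incU (Upart X) x) (prjU (Upart X) x)"
  let ?iT = "\<lambda>f. (f, \<zero>\<^bsub>on_obj M (Upart X, Tpart X)\<^esub>, \<zero>\<^bsub>Hom U (Upart X) (Upart X)\<^esub>)"
  let ?iU = "\<lambda>g. (\<zero>\<^bsub>Hom T (Tpart X) (Tpart X)\<^esub>, \<zero>\<^bsub>on_obj M (Upart X, Tpart X)\<^esub>, g)"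
  interpret H: vectorspace class_ring ?H
    by (intro Tri_Hom_space) simp_all
  interpret HT: vectorspace class_ring "Hom T (Tpart X) (Tpart X)"
    by (intro T.Hom_space) simp_all
  interpret HU: vectorspace class_ring "Hom U (Upart X) (Upart X)"
    by (intro U.Hom_space) simp_all
  interpret HM: vectorspace class_ring "on_obj M (Upart X, Tpart X)"
    by (intro M_space) simp_all
  have eT: "?e x = ?iT (?eT x)" "?eT x \<in> carrier (Hom T (Tpart X) (Tpart X))" if x: "x \<in> slots (Tpart X)" for x
  proof -
    have "x \<in> slots X" "fst x \<in> VT" using x by (simp_all add: slots_parts)
    then have "fst x \<in> VT" "tri_ob {#fst x#} = ({#fst x#}, {#})" "{#fst x#} \<in> objs T"
      by (simp_all add: tri_ob_single BT.ob_closed)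
    with x show "?e x = ?iT (?eT x)" "?eT x \<in> carrier (Hom T (Tpart X) (Tpart X))"
      by (simp_all add: tri_ob_def[of X] tri_inc_def tri_prj_def Tri_simps tri_zeros BT.prj_closed BT.inc_closed T.cmp_closed)
  qed
  have eU: "?e x = ?iU (?eU x)" "?eU x \<in> carrier (Hom U (Upart X) (Upart X))" if x: "x \<in> slots (Upart X)" for x
  proof -
    have "x \<in> slots X" "fst x \<notin> VT" using x by (simp_all add: slots_parts)
    then have "fst x \<notin> VT" "tri_ob {#fst x#} = ({#}, {#fst x#})" "{#fst x#} \<in> objs U"
      using 6 fst_slot[of x X] by (auto simp: tri_ob_single BU.ob_closed)
    with x show "?e x = ?iU (?eU x)" "?eU x \<in> carrier (Hom U (Upart X) (Upart X))"
      by (simp_all add: tri_ob_def[of X] tri_inc_def tri_prj_def Tri_simps tri_zeros BU.prj_closed BU.inc_closed U.cmp_closed)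
  qed
  have "finsum ?H ?e (slots (Tpart X)) = finsum ?H (\<lambda>x. ?iT (?eT x)) (slots (Tpart X))"
    by (intro H.finsum_cong' Pi_I refl eT(1)) (simp add: Tri_simps eT(2))
  also have "\<dots> = ?iT (finsum (Hom T (Tpart X) (Tpart X)) ?eT (slots (Tpart X)))"
    by (intro hom_finsum[OF HT.vectorspace_axioms H.vectorspace_axioms Tri_T_hom, symmetric]) (simp_all add: eT(2))
  also have "\<dots> = ?iT (idm T (Tpart X))"
    using BT.sum_inc_prj[of "Tpart X"] by simp
  finally have sumT: "finsum ?H ?e (slots (Tpart X)) = ?iT (idm T (Tpart X))" .
  have "finsum ?H ?e (slots (Upart X)) = finsum ?H (\<lambda>x. ?iU (?eU x)) (slots (Upart X))"
    by (intro H.finsum_cong' Pi_I refl eU(1)) (simp add: Tri_simps eU(2))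
  also have "\<dots> = ?iU (finsum (Hom U (Upart X) (Upart X)) ?eU (slots (Upart X)))"
    by (intro hom_finsum[OF HU.vectorspace_axioms H.vectorspace_axioms Tri_U_hom, symmetric]) (simp_all add: eU(2))
  also have "\<dots> = ?iU (idm U (Upart X))"
    using BU.sum_inc_prj[of "Upart X"] by simp
  finally have sumU: "finsum ?H ?e (slots (Upart X)) = ?iU (idm U (Upart X))" .
  have "finsum ?H ?e (slots X) = finsum ?H ?e (slots (Tpart X)) \<oplus>\<^bsub>?H\<^esub> finsum ?H ?e (slots (Upart X))"
    unfolding slots_split[of X]
  proof (rule H.finsum_Un_disjoint)
    show "slots (Tpart X) \<inter> slots (Upart X) = {}" by (auto simp: slots_parts)
    show "?e \<in> slots (Tpart X) \<rightarrow> carrier ?H"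
      by (rule Pi_I) (simp add: eT Tri_simps)
    show "?e \<in> slots (Upart X) \<rightarrow> carrier ?H"
      by (rule Pi_I) (simp add: eU Tri_simps)
  qed simp_all
  also have "\<dots> = idm Tri (tri_ob X)"
    unfolding sumT sumU by (simp add: Tri_simps tri_ob_def[of X] T.idm_closed U.idm_closed)
  finally show ?case unfolding tri_ob_def .
next
  case (7 a)
  then show ?case
  proof
    assume a: "a \<in> VT"
    then have "Tpart {#a#} = {#a#}" "Upart {#a#} = {#}" by (simp_all add: Tpart_def Upart_def)
    with a show ?thesis by (simp add: tri_inc_def tri_ob_single Tri_simps BT.inc_single BU.idm_empty)
  next
    assume a: "a \<in> VU"
    then have "a \<notin> VT" using disjoint by auto
    then have "Tpart {#a#} = {#}" "Upart {#a#} = {#a#}" by (simp_all add: Tpart_def Upart_def)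
    with a \<open>a \<notin> VT\<close> show ?thesis by (simp add: tri_inc_def tri_ob_single Tri_simps BU.inc_single BT.idm_empty)
  qed
next
  case (8 a)
  then show ?case
  proof
    assume a: "a \<in> VT"
    then have "Tpart {#a#} = {#a#}" "Upart {#a#} = {#}" by (simp_all add: Tpart_def Upart_def)
    with a show ?thesis by (simp add: tri_prj_def tri_ob_single Tri_simps BT.prj_single BU.idm_empty)
  next
    assume a: "a \<in> VU"
    then have "a \<notin> VT" using disjoint by auto
    then have "Tpart {#a#} = {#}" "Upart {#a#} = {#a#}" by (simp_all add: Tpart_def Upart_def)
    with a \<open>a \<notin> VT\<close> show ?thesis by (simp add: tri_prj_def tri_ob_single Tri_simps BU.prj_single BT.idm_empty)
  qed
qed

end

section \<open>Linear maps determined on bases\<close>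

lemma hom_eq_on_span:
  fixes V :: "('k::field, 'a) module" and W :: "('k, 'b) module"
  assumes V: "vectorspace class_ring V" and W: "vectorspace class_ring W"
    and f: "f \<in> module_hom class_ring V W" and g: "g \<in> module_hom class_ring V W"
    and B: "B \<subseteq> carrier V" "LinearCombinations.module.span class_ring V B = carrier V"
    and eq: "\<And>b. b \<in> B \<Longrightarrow> f b = g b" and v: "v \<in> carrier V"
  shows "f v = g v"
proof -
  interpret V: vectorspace class_ring V by fact
  have "VectorSpace.subspace class_ring {v \<in> carrier V. f v = g v} V"
  proof (rule subspaceI[OF V])
    show "\<zero>\<^bsub>V\<^esub> \<in> {v \<in> carrier V. f v = g v}"
      using hom_zero[OF V W f] hom_zero[OF V W g] by simp
    show "x \<oplus>\<^bsub>V\<^esub> y \<in> {v \<in> carrier V. f v = g v}"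
      if "x \<in> {v \<in> carrier V. f v = g v}" "y \<in> {v \<in> carrier V. f v = g v}" for x y
      using that by (simp add: hom_add[OF f] hom_add[OF g])
    show "c \<odot>\<^bsub>V\<^esub> x \<in> {v \<in> carrier V. f v = g v}" if "x \<in> {v \<in> carrier V. f v = g v}" for c x
      using that by (simp add: hom_smult[OF f] hom_smult[OF g])
  qed auto
  then have "submodule class_ring {v \<in> carrier V. f v = g v} V"
    by (simp add: VectorSpace.subspace_def)
  then have "V.span B \<subseteq> {v \<in> carrier V. f v = g v}"
    using B(1) eq by (intro V.span_is_subset) blast
  then show ?thesis using v B(2) by blast
qed

section \<open>Coordinates in a finite basis\<close>

locale finite_basis = V: vectorspace class_ring V for V :: "('k::field, 'a) module" +
  fixes B :: "'a set"
  assumes fin_dim: "V.fin_dim" and basis: "V.basis B"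
begin

lemma B_closed: "B \<subseteq> carrier V" and B_span: "V.span B = carrier V"
  and B_indpt: "V.lin_indpt B" and B_finite: "finite B"
  using basis V.fin_dim_li_fin[OF fin_dim, of B] unfolding V.basis_def by blast+

text \<open>Outside \<open>B\<close> the chosen coefficients are arbitrary, which is why the laws
  are stated for basis vectors only.\<close>

definition coord :: "'a \<Rightarrow> 'a \<Rightarrow> 'k" where
  "coord m = (SOME c. V.lincomb c B = m)"

lemma lincomb_coord:
  assumes "m \<in> carrier V"
  shows "V.lincomb (coord m) B = m"
proof -
  have "m \<in> V.span B" using assms B_span by simp
  then have "\<exists>c. V.lincomb c B = m"
    using V.finite_in_span[OF B_finite B_closed] by blast
  then show ?thesis unfolding coord_def by (rule someI_ex)
qed

text \<open>If two coefficient functions for the same vector differed at \<open>b\<close>, their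
  difference would be a linear dependency of \<open>B\<close> with a nonzero coefficient at
  \<open>b\<close>. Independence of the basis enters here.\<close>

lemma coord_unique:
  assumes "V.lincomb c B = m" and b: "b \<in> B"
  shows "coord m b = c b"
proof (rule ccontr)
  assume "coord m b \<noteq> c b"
  have m: "m \<in> carrier V"
    using assms(1) V.lincomb_closed[OF B_closed, of c] by auto
  have "V.lincomb (\<lambda>v. coord m v \<ominus>\<^bsub>class_ring\<^esub> c v) B = V.lincomb (coord m) B \<ominus>\<^bsub>V\<^esub> V.lincomb c B"
    by (rule V.lincomb_diff[OF B_finite B_closed]) simp_all
  also have "\<dots> = \<zero>\<^bsub>V\<^esub>"
    unfolding lincomb_coord[OF m] assms(1) a_minus_def using m by (rule V.r_neg)
  finally have "V.lin_dep B"
    using \<open>coord m b \<noteq> c b\<close> b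
    by (intro V.lin_dep_crit[OF B_finite subset_refl, where v = b and a = "\<lambda>v. coord m v \<ominus>\<^bsub>class_ring\<^esub> c v"])
      (simp_all add: class_ring_simps)
  then show False using B_indpt by blast
qed

lemma coord_add:
  assumes "m \<in> carrier V" "m' \<in> carrier V" "b \<in> B"
  shows "coord (m \<oplus>\<^bsub>V\<^esub> m') b = coord m b + coord m' b"
proof -
  have "V.lincomb (\<lambda>v. coord m v \<oplus>\<^bsub>class_ring\<^esub> coord m' v) B = V.lincomb (coord m) B \<oplus>\<^bsub>V\<^esub> V.lincomb (coord m') B"
    by (rule V.lincomb_sum[OF B_finite B_closed]) simp_all
  then have "V.lincomb (\<lambda>v. coord m v + coord m' v) B = m \<oplus>\<^bsub>V\<^esub> m'"
    using assms by (simp add: lincomb_coord)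
  from coord_unique[OF this assms(3)] show ?thesis .
qed

lemma coord_smult:
  assumes "m \<in> carrier V" "b \<in> B"
  shows "coord (c \<odot>\<^bsub>V\<^esub> m) b = c * coord m b"
proof -
  have "V.lincomb (\<lambda>v. c \<otimes>\<^bsub>class_ring\<^esub> coord m v) B = c \<odot>\<^bsub>V\<^esub> V.lincomb (coord m) B"
    by (rule V.lincomb_smult[OF B_closed]) simp_all
  then have "V.lincomb (\<lambda>v. c * coord m v) B = c \<odot>\<^bsub>V\<^esub> m"
    using assms by (simp add: lincomb_coord)
  from coord_unique[OF this assms(2)] show ?thesis .
qed

lemma coord_basis:
  assumes "b \<in> B" "b' \<in> B"
  shows "coord b b' = (if b' = b then 1 else 0)"
proof -
  have "V.lincomb (\<lambda>v. if v = b then 1 else 0) B = (if b = b then 1 else 0) \<odot>\<^bsub>V\<^esub> b"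
    unfolding V.lincomb_def
  proof (rule V.finsum_only[OF B_finite assms(1)])
    have b: "b \<in> carrier V" using assms B_closed by blast
    show "(if b = b then 1 else 0) \<odot>\<^bsub>V\<^esub> b \<in> carrier V"
      using V.smult_one[OF b] b by simp
    show "(if i = b then 1 else 0) \<odot>\<^bsub>V\<^esub> i = \<zero>\<^bsub>V\<^esub>" if "i \<in> B" "i \<noteq> b" for i
      using that B_closed V.lmult_0[of i] by auto
  qed
  also have "\<dots> = b"
    using assms(1) B_closed V.smult_one[of b] by auto
  finally show ?thesis using assms(2) by (rule coord_unique)
qed

end

lemma free_space_hom_eq:
  fixes W :: "('k::field, 'b) module"
  assumes W: "vectorspace class_ring W"
    and f: "f \<in> module_hom class_ring (free_space S) W" and g: "g \<in> module_hom class_ring (free_space S) W"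
    and eq: "\<And>p. p \<in> S \<Longrightarrow> f (single p 1) = g (single p 1)"
    and h: "keys h \<subseteq> S"
  shows "f h = g h"
proof -
  have closed: "x \<in> carrier (free_space S)" if "keys x \<subseteq> S" for x :: "'a \<Rightarrow>\<^sub>0 'k"
    using that by (simp add: free_space_def)
  show ?thesis using h
  proof (induct h rule: keys_induct)
    case zero
    show ?case
      using hom_zero[OF free_space_vectorspace W f] hom_zero[OF free_space_vectorspace W g] by (simp add: free_space_def)
  next
    case (single p c)
    have "single p c = c \<odot>\<^bsub>free_space S\<^esub> (single p 1 :: 'a \<Rightarrow>\<^sub>0 'k)"
      by (simp add: free_space_def)
    moreover have "single p 1 \<in> carrier (free_space S :: ('k, _) module)"
      using single by (intro closed) simp
    ultimately show ?case
      using hom_smult[OF f] hom_smult[OF g] eq[OF single] by simp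
  next
    case (add x y)
    then show ?case
      using hom_add[OF f closed closed, of x y] hom_add[OF g closed closed, of x y] by (simp add: free_space_def)
  qed
qed

lemma free_space_homI:
  assumes "\<And>x. keys x \<subseteq> S \<Longrightarrow> f x \<in> carrier W"
    and "\<And>x y. \<lbrakk>keys x \<subseteq> S; keys y \<subseteq> S\<rbrakk> \<Longrightarrow> f (x + y) = f x \<oplus>\<^bsub>W\<^esub> f y"
    and "\<And>c x. keys x \<subseteq> S \<Longrightarrow> f (scale c x) = c \<odot>\<^bsub>W\<^esub> f x"
  shows "f \<in> module_hom class_ring (free_space S :: ('k::field, 'a \<Rightarrow>\<^sub>0 'k) module) W"
  using assms by (intro module_homI) (simp_all add: free_space_def)

lemma linear_ext_hom:
  "\<phi> ` S \<subseteq> S' \<Longrightarrow> linear_ext \<phi> \<in> module_hom class_ring (free_space S :: ('k::field, 'a \<Rightarrow>\<^sub>0 'k) module) (free_space S')"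
proof (rule free_space_homI)
  fix x :: "'a \<Rightarrow>\<^sub>0 'k"
  assume "\<phi> ` S \<subseteq> S'" "keys x \<subseteq> S"
  then show "linear_ext \<phi> x \<in> carrier (free_space S')"
    using keys_linear_ext[of \<phi> x] by (simp add: free_space_def) blast
qed (simp_all add: free_space_def linear_ext_add linear_ext_scale)

section \<open>Linear maps and embeddings of path categories\<close>

context wf_digraph
begin

lemma path_mor_hom:
  "path_mor a b \<in> module_hom class_ring (free_space {p. awalk a p b} :: ('k::field, 'b list \<Rightarrow>\<^sub>0 'k) module)
    (Hom (path_cat G) {#a#} {#b#})"
  by (rule free_space_homI) (auto simp: path_cat_simps path_mor_def fun_eq_iff)

lemma cmp_path_mor:
  "cmp (path_cat G) {#a#} {#b#} {#c#} (path_mor b c g) (path_mor a b f) = path_mor a c (path_mult g f)"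
  by (simp add: path_mor_entry cmp_entry)

lemma path_mult_keys:
  assumes "keys f \<subseteq> {p. awalk a p b}" "keys g \<subseteq> {p. awalk b p c}"
  shows "keys (path_mult g f) \<subseteq> {p. awalk a p c}"
  by (rule keys_bilinear_ext[OF assms(2,1)]) (simp del: awalk_append_iff add: awalk_appendI)

lemma path_mult_hom_right:
  assumes "keys g \<subseteq> {p. awalk b p c}"
  shows "path_mult g \<in> module_hom class_ring (free_space {p. awalk a p b} :: ('k::field, 'b list \<Rightarrow>\<^sub>0 'k) module)
    (free_space {p. awalk a p c})"
proof (rule free_space_homI)
  show "path_mult g f \<in> carrier (free_space {p. awalk a p c})" if "keys f \<subseteq> {p. awalk a p b}" for f
    using path_mult_keys[OF that assms] by (simp add: free_space_def)
qed (simp_all add: free_space_def bilinear_ext_add_right bilinear_ext_scale_right)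

lemma path_mult_hom_left:
  assumes "keys f \<subseteq> {p. awalk a p b}"
  shows "(\<lambda>g. path_mult g f) \<in> module_hom class_ring (free_space {p. awalk b p c} :: ('k::field, 'b list \<Rightarrow>\<^sub>0 'k) module)
    (free_space {p. awalk a p c})"
proof (rule free_space_homI)
  show "path_mult g f \<in> carrier (free_space {p. awalk a p c})" if "keys g \<subseteq> {p. awalk b p c}" for g
    using path_mult_keys[OF assms that] by (simp add: free_space_def)
qed (simp_all add: free_space_def bilinear_ext_add_left bilinear_ext_scale_left)

text \<open>Relabelling arrows commutes with concatenation, so it is functorial as soon as it
  preserves walks. The embeddings of \<open>R\<close> and \<open>Q\<close> into the augmented quiver
  arise this way and transport the ideals of the old relations.\<close>

lemma path_cat_embedding:
  assumes G': "wf_digraph G'" and verts: "verts G \<subseteq> verts G'"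
    and walk: "\<And>a p b. awalk a p b \<Longrightarrow> pre_digraph.awalk G' a (map h p) b"
  shows "k_functor (path_cat G :: ('a multiset, ('a, 'b, 'k::field) path_mor, 'k) kcat) (path_cat G')
    \<lparr>on_obj = \<lambda>X. X, on_hom = \<lambda>X Y f x y. linear_ext (map h) (f x y)\<rparr>"
proof (intro k_functor.intro path_cat_category wf_digraph.path_cat_category[OF G'] k_functor_axioms.intro, goal_cases)
  case (1 X)
  then show ?case using verts by (auto simp: path_cat_simps)
next
  case (2 X Y)
  have "(\<lambda>f x y. linear_ext (map h) (f x y)) \<in> module_hom class_ring
      (Hom (path_cat G) X Y :: ('k, ('a, 'b, 'k) path_mor) module) (Hom (path_cat G') X Y)"
  proof (rule module_homI)
    show "(\<lambda>x y. linear_ext (map h) (f x y)) \<in> carrier (Hom (path_cat G') X Y)"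
      if f: "f \<in> carrier (Hom (path_cat G) X Y)" for f :: "('a, 'b, 'k) path_mor"
    proof (rule path_cat_homI)
      fix x y assume "x \<in> slots X" "y \<in> slots Y"
      from path_cat_homD(1)[OF f this]
      show "keys (linear_ext (map h) (f x y)) \<subseteq> {p. pre_digraph.awalk G' (fst x) p (fst y)}"
        using keys_linear_ext[of "map h" "f x y"] walk by blast
    next
      fix x y assume "x \<notin> slots X \<or> y \<notin> slots Y"
      then have "f x y = 0" using path_cat_homD(2,3)[OF f] by blast
      then show "linear_ext (map h) (f x y) = 0" by simp
    qed
  qed (simp_all add: path_cat_simps(4,5) linear_ext_add linear_ext_scale)
  then show ?case by simp
next
  case (3 X)
  show ?case by (auto simp: path_cat_simps(6) fun_eq_iff)
next
  case (4 X Y Z f g)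
  then show ?case by (simp add: path_cat_simps(7) linear_ext_sum linear_ext_path_mult)
qed

end

lemma (in path_functor) lin_hom:
  assumes "a \<in> verts G" "b \<in> verts G"
  shows "lin a b \<in> module_hom class_ring (free_space {p. awalk a p b}) (Hom D (ob {#a#}) (ob {#b#}))"
  using assms by (intro free_space_homI) (simp_all add: lin_closed lin_add lin_scale)

section \<open>The augmented quiver\<close>

lemma path_cat_hom_single:
  assumes f: "f \<in> carrier (Hom (path_cat G) {#a#} {#b#})"
  shows "f = path_mor a b (f (a, 0) (b, 0))"
proof (intro ext)
  fix x y
  show "f x y = path_mor a b (f (a, 0) (b, 0)) x y"
    using path_cat_homD(2,3)[OF f, of x y] path_cat_homD(3)[OF f, of y x]
    by (cases "x = (a, 0)"; cases "y = (b, 0)") (simp_all add: path_mor_def)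
qed

section \<open>Path categories bound by relations\<close>

locale bound_quiver = wf_digraph G
  for G :: "('v, 'e) pre_digraph" +
  fixes S :: "('v, 'e, 'k::field) qrel set"
begin

sublocale I: k_category_ideal "path_cat G" "relations_ideal G S"
  unfolding k_category_ideal_def k_category_ideal_axioms_def relations_ideal_def
  using path_cat_category k_category.generated_ideal_ideal by blast

abbreviation "bcls \<equiv> cls (path_cat G) (relations_ideal G S)"

definition "binc X x = bcls {#fst x#} X (path_inc X x)"
definition "bprj X x = bcls X {#fst x#} (path_prj X x)"

lemma biproducts: "vertex_biproducts (bound_cat G S) (verts G) (\<lambda>X. X) binc bprj"
  using k_functor.biproducts_image[OF I.cls_functor path_cat_biproducts]
  by (simp add: bound_cat_def binc_def[abs_def] bprj_def[abs_def])

lemma arrow_cls_eq: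
  "arrow_cls G S e = bcls {#tail G e#} {#head G e#} (path_mor (tail G e) (head G e) (single [e] 1))"
  by (simp add: arrow_cls_def)

lemma bcls_hom:
  "\<lbrakk>a \<in> verts G; b \<in> verts G\<rbrakk> \<Longrightarrow> (\<lambda>h. bcls {#a#} {#b#} (path_mor a b h))
    \<in> module_hom class_ring (free_space {p. awalk a p b}) (Hom (bound_cat G S) {#a#} {#b#})"
  unfolding bound_cat_def quotient_cat_simps
  by (intro hom_compose[OF path_mor_hom I.cls_hom]) (simp_all add: path_cat_simps(1))

lemma bcls_closed:
  "\<lbrakk>a \<in> verts G; b \<in> verts G; keys h \<subseteq> {p. awalk a p b}\<rbrakk>
    \<Longrightarrow> bcls {#a#} {#b#} (path_mor a b h) \<in> carrier (Hom (bound_cat G S) {#a#} {#b#})"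
  by (rule hom_closed[OF bcls_hom]) (simp_all add: free_space_def)

lemma bcls_zero_iff:
  "\<lbrakk>a \<in> verts G; b \<in> verts G; keys h \<subseteq> {p. awalk a p b}\<rbrakk>
    \<Longrightarrow> bcls {#a#} {#b#} (path_mor a b h) = \<zero>\<^bsub>Hom (bound_cat G S) {#a#} {#b#}\<^esub>
      \<longleftrightarrow> path_mor a b h \<in> relations_ideal G S {#a#} {#b#}"
  by (simp add: bound_cat_def I.cls_eq_zero_iff path_cat_simps(1) path_mor_closed)

lemma arrow_cls_closed:
  "e \<in> arcs G \<Longrightarrow> arrow_cls G S e \<in> carrier (Hom (bound_cat G S) {#tail G e#} {#head G e#})"
  unfolding arrow_cls_eq by (simp add: bcls_closed wellformed arc_implies_awalk)

lemma bcls_surj: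
  assumes ab: "a \<in> verts G" "b \<in> verts G" and f: "f \<in> carrier (Hom (bound_cat G S) {#a#} {#b#})"
  shows "\<exists>h. keys h \<subseteq> {p. awalk a p b} \<and> f = bcls {#a#} {#b#} (path_mor a b h)"
proof -
  obtain f' where f': "f' \<in> carrier (Hom (path_cat G) {#a#} {#b#})" "f = bcls {#a#} {#b#} f'"
    using f I.carrier_quotient_Hom[of "{#a#}" "{#b#}"] ab by (auto simp: bound_cat_def path_cat_simps(1))
  have "f' = path_mor a b (f' (a, 0) (b, 0))"
    by (rule path_cat_hom_single[OF f'(1)])
  moreover have "keys (f' (a, 0) (b, 0)) \<subseteq> {p. awalk a p b}"
    using path_cat_homD(1)[OF f'(1), of "(a, 0)" "(b, 0)"] by simp
  ultimately show ?thesis using f'(2) by metis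
qed

lemma cmp_bcls:
  assumes "a \<in> verts G" "b \<in> verts G" "c \<in> verts G"
    and "keys f \<subseteq> {p. awalk a p b}" "keys g \<subseteq> {p. awalk b p c}"
  shows "cmp (bound_cat G S) {#a#} {#b#} {#c#} (bcls {#b#} {#c#} (path_mor b c g)) (bcls {#a#} {#b#} (path_mor a b f))
    = bcls {#a#} {#c#} (path_mor a c (path_mult g f))"
  using assms unfolding bound_cat_def
  by (simp add: I.cmp_cls path_cat_simps(1) path_mor_closed cmp_path_mor)

lemma cmp_arrow_cls:
  assumes e: "e \<in> arcs G" and p: "awalk (head G e) p b"
  shows "cmp (bound_cat G S) {#tail G e#} {#head G e#} {#b#}
      (bcls {#head G e#} {#b#} (path_mor (head G e) b (single p 1))) (arrow_cls G S e)
    = bcls {#tail G e#} {#b#} (path_mor (tail G e) b (single (e # p) 1))"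
  unfolding arrow_cls_eq
  using e p awalk_last_in_verts[OF p] arc_implies_awalk[OF e] by (subst cmp_bcls) (simp_all add: wellformed)

lemma idm_bcls: "idm (bound_cat G S) {#a#} = bcls {#a#} {#a#} (path_mor a a (single [] 1))"
  by (simp add: bound_cat_def idm_single path_mor_entry)

lemma relation_in_ideal:
  "\<lbrakk>(a, b, f) \<in> S; keys f \<subseteq> {p. awalk a p b}\<rbrakk> \<Longrightarrow> path_mor a b f \<in> relations_ideal G S {#a#} {#b#}"
  unfolding relations_ideal_def
  by (rule generated_ideal_base) (force, simp add: path_mor_closed)

end

section \<open>The augmented quiver and its walks\<close>

locale augmented_quiver_data =
  fixes Q R :: "('v, 'e) pre_digraph"
    and \<rho> \<sigma> :: "('v, 'e, 'k::field) qrel set"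
    and M :: "('v, 'e, 'x, 'k) quiver_bimod"
    and B :: "'v \<Rightarrow> 'v \<Rightarrow> 'x set"
  assumes wf_Q: "wf_digraph Q" and wf_R: "wf_digraph R"
    and disjoint_verts: "verts Q \<inter> verts R = {}" and disjoint_arcs: "arcs Q \<inter> arcs R = {}"
    and rho: "\<rho> \<subseteq> relations_on Q" and sigma: "\<sigma> \<subseteq> relations_on R"
    and functor_M: "k_functor (tensor_cat (bound_cat Q \<rho>) (op_cat (bound_cat R \<sigma>))) fd_spaces M"
    and basis_B: "\<And>i j. i \<in> verts Q \<Longrightarrow> j \<in> verts R \<Longrightarrow>
           vectorspace.basis class_ring (on_obj M ({#i#}, {#j#})) (B i j)"
begin

abbreviation "A \<equiv> augmented_quiver R B Q"
abbreviation "T \<equiv> bound_cat R \<sigma>"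
abbreviation "U \<equiv> bound_cat Q \<rho>"
abbreviation "IA \<equiv> relations_ideal A (view_relations (\<rho> \<union> \<sigma>))"

lemma A_simps:
  "verts A = verts R \<union> verts Q"
  "arcs A = Inl ` (arcs R \<union> arcs Q) \<union> Inr ` {(i, j, b). i \<in> verts Q \<and> j \<in> verts R \<and> b \<in> B i j}"
  "e \<in> arcs R \<Longrightarrow> tail A (Inl e) = tail R e" "e \<in> arcs R \<Longrightarrow> head A (Inl e) = head R e"
  "e \<in> arcs Q \<Longrightarrow> tail A (Inl e) = tail Q e" "e \<in> arcs Q \<Longrightarrow> head A (Inl e) = head Q e"
  "tail A (Inr (i, j, b)) = j" "head A (Inr (i, j, b)) = i"
  using disjoint_arcs by (auto simp: augmented_quiver_def)

sublocale R: bound_quiver R \<sigma> by (intro bound_quiver.intro wf_R)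
sublocale Q: bound_quiver Q \<rho> by (intro bound_quiver.intro wf_Q)

lemma wf_A: "wf_digraph A"
proof
  fix e assume "e \<in> arcs A"
  then consider e' where "e = Inl e'" "e' \<in> arcs R" | e' where "e = Inl e'" "e' \<in> arcs Q"
    | i j b where "e = Inr (i, j, b)" "i \<in> verts Q" "j \<in> verts R"
    unfolding A_simps by blast
  then show "tail A e \<in> verts A" "head A e \<in> verts A"
    by (cases; simp add: A_simps R.wellformed Q.wellformed)+
qed

sublocale A: wf_digraph A by (rule wf_A)

lemma not_both: "a \<in> verts R \<Longrightarrow> a \<in> verts Q \<Longrightarrow> False"
  using disjoint_verts by blast

lemma walk_R: "R.awalk a p b \<Longrightarrow> A.awalk a (map Inl p) b"
  by (induct p arbitrary: a) (simp_all add: R.awalk_Nil_iff A.awalk_Nil_iff R.awalk_Cons_iff A.awalk_Cons_iff A_simps)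

lemma walk_Q: "Q.awalk a p b \<Longrightarrow> A.awalk a (map Inl p) b"
  by (induct p arbitrary: a) (simp_all add: Q.awalk_Nil_iff A.awalk_Nil_iff Q.awalk_Cons_iff A.awalk_Cons_iff A_simps)

text \<open>Nothing leaves \<open>Q\<close>: the new arrows and the arrows of \<open>R\<close> start
  at vertices of \<open>R\<close>, and the vertex sets are disjoint.\<close>

lemma walk_from_Q:
  assumes "A.awalk a p b" "a \<in> verts Q"
  shows "\<exists>p'. p = map Inl p' \<and> Q.awalk a p' b"
  using assms
proof (induct p arbitrary: a)
  case Nil
  then show ?case by (simp add: A.awalk_Nil_iff Q.awalk_Nil_iff)
next
  case (Cons e p)
  then have e: "e \<in> arcs A" "a = tail A e" "A.awalk (head A e) p b"
    by (simp_all add: A.awalk_Cons_iff)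
  from e(1) consider e' where "e = Inl e'" "e' \<in> arcs R" | e' where "e = Inl e'" "e' \<in> arcs Q"
    | i j b where "e = Inr (i, j, b)" "i \<in> verts Q" "j \<in> verts R"
    unfolding A_simps by blast
  then show ?case
  proof cases
    case (1 e')
    then show ?thesis using e(2) Cons(3) not_both[of a] by (simp add: A_simps R.wellformed)
  next
    case (2 e')
    then obtain p' where "p = map Inl p'" "Q.awalk (head Q e') p' b"
      using Cons(1)[OF e(3)] by (auto simp: A_simps Q.wellformed)
    then show ?thesis
      using 2 e(2) by (intro exI[of _ "e' # p'"]) (simp add: Q.awalk_Cons_iff A_simps)
  next
    case (3 i j b)
    then show ?thesis using e(2) Cons(3) not_both[of a] by (simp add: A_simps)
  qed
qed

text \<open>As long as the walk uses arrows of \<open>R\<close> it stays among the vertices of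
  \<open>R\<close>. The first other arrow must be a new one, and from its head on
  \<open>walk_from_Q\<close> describes the rest.\<close>

lemma walk_from_R:
  assumes "A.awalk a p b" "a \<in> verts R"
  shows "(\<exists>p'. p = map Inl p' \<and> R.awalk a p' b)
    \<or> (\<exists>p1 i j x p2. p = map Inl p1 @ Inr (i, j, x) # map Inl p2 \<and> R.awalk a p1 j
        \<and> i \<in> verts Q \<and> j \<in> verts R \<and> x \<in> B i j \<and> Q.awalk i p2 b)"
  using assms
proof (induct p arbitrary: a)
  case Nil
  then show ?case by (simp add: A.awalk_Nil_iff R.awalk_Nil_iff)
next
  case (Cons e p)
  then have e: "e \<in> arcs A" "a = tail A e" "A.awalk (head A e) p b"
    by (simp_all add: A.awalk_Cons_iff)
  from e(1) consider e' where "e = Inl e'" "e' \<in> arcs R" | e' where "e = Inl e'" "e' \<in> arcs Q"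
    | i j x where "e = Inr (i, j, x)" "i \<in> verts Q" "j \<in> verts R" "x \<in> B i j"
    unfolding A_simps by blast
  then show ?case
  proof cases
    case (1 e')
    then have "head R e' \<in> verts R" "head A e = head R e'" "a = tail R e'"
      using e(2) by (simp_all add: A_simps R.wellformed)
    with Cons(1)[OF e(3)] consider p' where "p = map Inl p'" "R.awalk (head R e') p' b"
      | p1 i j x p2 where "p = map Inl p1 @ Inr (i, j, x) # map Inl p2" "R.awalk (head R e') p1 j"
        "i \<in> verts Q" "j \<in> verts R" "x \<in> B i j" "Q.awalk i p2 b"
      by auto
    then show ?thesis
    proof cases
      case (1 p')
      then show ?thesis
        using \<open>e = Inl e'\<close> \<open>e' \<in> arcs R\<close> \<open>a = tail R e'\<close>
        by (intro disjI1 exI[of _ "e' # p'"]) (simp add: R.awalk_Cons_iff)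
    next
      case (2 p1 i j x p2)
      then show ?thesis
        using \<open>e = Inl e'\<close> \<open>e' \<in> arcs R\<close> \<open>a = tail R e'\<close>
        by (intro disjI2 exI[of _ "e' # p1"] exI[of _ i] exI[of _ j] exI[of _ x] exI[of _ p2])
          (simp add: R.awalk_Cons_iff)
    qed
  next
    case (2 e')
    then show ?thesis using e(2) Cons(3) not_both[of a] by (simp add: A_simps Q.wellformed)
  next
    case (3 i j x)
    then obtain p' where "p = map Inl p'" "Q.awalk i p' b"
      using walk_from_Q[OF e(3)] by (auto simp: A_simps)
    then show ?thesis
      using 3 e(2)
      by (intro disjI2 exI[of _ "[]"] exI[of _ i] exI[of _ j] exI[of _ x] exI[of _ p'])
        (simp add: R.awalk_Nil_iff A_simps)
  qed
qed

text \<open>A walk through a new arrow ends in \<open>Q\<close>, so it cannot end at a vertex of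
  \<open>R\<close>. Together with the two following facts this leaves only walks from
  \<open>R\<close> to \<open>Q\<close> as genuinely new.\<close>

lemma walks_RR: "\<lbrakk>a \<in> verts R; b \<in> verts R\<rbrakk> \<Longrightarrow> {p. A.awalk a p b} = map Inl ` {p. R.awalk a p b}"
  using walk_from_R[of a _ b] walk_R not_both[of b] Q.awalk_last_in_verts by blast

lemma walks_QQ: "a \<in> verts Q \<Longrightarrow> {p. A.awalk a p b} = map Inl ` {p. Q.awalk a p b}"
  using walk_from_Q[of a _ b] walk_Q by blast

lemma walks_QR: "\<lbrakk>a \<in> verts Q; b \<in> verts R\<rbrakk> \<Longrightarrow> {p. A.awalk a p b} = {}"
  using walk_from_Q[of a _ b] not_both[of b] Q.awalk_last_in_verts by blast

section \<open>The functor to the triangular category\<close>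

sublocale AI: k_category_ideal "path_cat A" IA
  unfolding k_category_ideal_def k_category_ideal_axioms_def relations_ideal_def
  using A.path_cat_category k_category.generated_ideal_ideal by blast

sublocale Tri: bimodule_biproducts T U M "verts R" "verts Q" R.binc R.bprj Q.binc Q.bprj
proof (intro bimodule_biproducts.intro bimodule.intro bimodule_biproducts_axioms.intro
    R.biproducts Q.biproducts functor_M)
  show "k_category T" "k_category U"
    using R.biproducts Q.biproducts by (simp_all add: vertex_biproducts_def)
  show "verts R \<inter> verts Q = {}"
    using disjoint_verts by blast
qed

lemma vertex_simps:
  "a \<in> verts R \<Longrightarrow> {#a#} \<in> objs T" "a \<in> verts Q \<Longrightarrow> {#a#} \<in> objs U"
  "a \<in> verts R \<Longrightarrow> Tri.tri_ob {#a#} = ({#a#}, {#})" "a \<in> verts Q \<Longrightarrow> Tri.tri_ob {#a#} = ({#}, {#a#})"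
  by (simp_all add: Tri.BT.ob_closed Tri.BU.ob_closed Tri.tri_ob_single)

lemmas path_mor_closed = R.path_mor_closed Q.path_mor_closed A.path_mor_closed

text \<open>Every zero here lies in a space with an empty multiset on one side, which has no other
  element. It still has to be named, since different spaces need not share their zeros.\<close>

fun arr :: "('v, 'e, 'x) aug_arrow \<Rightarrow> ('v, 'e, 'k) path_mor set \<times> 'x \<times> ('v, 'e, 'k) path_mor set" where
  "arr (Inl e) = (if e \<in> arcs R
     then (arrow_cls R \<sigma> e, \<zero>\<^bsub>on_obj M ({#}, {#tail R e#})\<^esub>, \<zero>\<^bsub>Hom U {#} {#}\<^esub>)
     else (\<zero>\<^bsub>Hom T {#} {#}\<^esub>, \<zero>\<^bsub>on_obj M ({#head Q e#}, {#})\<^esub>, arrow_cls Q \<rho> e))"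
| "arr (Inr (i, j, b)) = (\<zero>\<^bsub>Hom T {#j#} {#}\<^esub>, b, \<zero>\<^bsub>Hom U {#} {#i#}\<^esub>)"

lemma B_closed: "\<lbrakk>i \<in> verts Q; j \<in> verts R; b \<in> B i j\<rbrakk> \<Longrightarrow> b \<in> carrier (on_obj M ({#i#}, {#j#}))"
  using basis_B[of i j] vectorspace.basis_def[OF Tri.M_space[of "{#j#}" "{#i#}"]] by (auto simp: vertex_simps)

sublocale PF: path_functor A Tri.Tri Tri.tri_ob Tri.tri_inc Tri.tri_prj arr
proof (intro path_functor.intro wf_A path_functor_axioms.intro)
  show "vertex_biproducts Tri.Tri (verts A) Tri.tri_ob Tri.tri_inc Tri.tri_prj"
    using Tri.tri_biproducts by (simp only: A_simps(1))
  fix e assume "e \<in> arcs A"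
  then consider e' where "e = Inl e'" "e' \<in> arcs R" | e' where "e = Inl e'" "e' \<in> arcs Q" "e' \<notin> arcs R"
    | i j b where "e = Inr (i, j, b)" "i \<in> verts Q" "j \<in> verts R" "b \<in> B i j"
    unfolding A_simps using disjoint_arcs by blast
  then show "arr e \<in> carrier (Hom Tri.Tri (Tri.tri_ob {#tail A e#}) (Tri.tri_ob {#head A e#}))"
  proof cases
    case (1 e')
    then show ?thesis
      by (simp add: A_simps vertex_simps R.wellformed Tri.Tri_simps(2) R.arrow_cls_closed Q.arrow_cls_closed Tri.tri_zeros)
  next
    case (2 e')
    then show ?thesis
      by (simp add: A_simps vertex_simps Q.wellformed Tri.Tri_simps(2) R.arrow_cls_closed Q.arrow_cls_closed Tri.tri_zeros)
  next
    case (3 i j b)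
    then show ?thesis
      by (simp add: A_simps vertex_simps Tri.Tri_simps(2) Tri.tri_zeros B_closed)
  qed
qed

lemma path_val_R:
  assumes "R.awalk a p b"
  shows "PF.path_val (map Inl p) a b
    = (R.bcls {#a#} {#b#} (path_mor a b (single p 1)), \<zero>\<^bsub>on_obj M ({#}, {#a#})\<^esub>, \<zero>\<^bsub>Hom U {#} {#}\<^esub>)"
  using assms
proof (induct p arbitrary: a)
  case Nil
  then have "a = b" "a \<in> verts R" by (auto simp: R.awalk_Nil_iff)
  then show ?case by (simp add: vertex_simps Tri.Tri_simps(6) R.idm_bcls Tri.BU.idm_empty)
next
  case (Cons e p)
  then have e: "e \<in> arcs R" "a = tail R e" "R.awalk (head R e) p b"
    by (simp_all add: R.awalk_Cons_iff)
  then have v: "tail R e \<in> verts R" "head R e \<in> verts R" "b \<in> verts R"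
    using R.awalk_last_in_verts by (auto simp: R.wellformed)
  have keys: "keys (single p (1::'k)) \<subseteq> {p. R.awalk (head R e) p b}"
    using e(3) by simp
  from R.cmp_arrow_cls[OF e(1,3)] show ?case
    using Cons(1)[OF e(3)] e v R.bcls_closed[OF v(2,3) keys] R.arrow_cls_closed[OF e(1)]
    by (simp add: A_simps vertex_simps Tri.Tri_simps(7) Tri.tri_zeros)
qed

lemma path_val_Q:
  assumes "Q.awalk a p b"
  shows "PF.path_val (map Inl p) a b
    = (\<zero>\<^bsub>Hom T {#} {#}\<^esub>, \<zero>\<^bsub>on_obj M ({#b#}, {#})\<^esub>, Q.bcls {#a#} {#b#} (path_mor a b (single p 1)))"
  using assms
proof (induct p arbitrary: a)
  case Nil
  then have "a = b" "a \<in> verts Q" by (auto simp: Q.awalk_Nil_iff)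
  then show ?case by (simp add: vertex_simps Tri.Tri_simps(6) Q.idm_bcls Tri.BT.idm_empty)
next
  case (Cons e p)
  then have e: "e \<in> arcs Q" "a = tail Q e" "Q.awalk (head Q e) p b"
    by (simp_all add: Q.awalk_Cons_iff)
  then have v: "tail Q e \<in> verts Q" "head Q e \<in> verts Q" "b \<in> verts Q"
    using Q.awalk_last_in_verts by (auto simp: Q.wellformed)
  \<comment> \<open>\<open>arr\<close> tests for arrows of \<open>R\<close> first, so an arrow of
    \<open>Q\<close> reaches its own case only because the arrow sets are disjoint.\<close>
  have "e \<notin> arcs R" using e(1) disjoint_arcs by blast
  have keys: "keys (single p (1::'k)) \<subseteq> {p. Q.awalk (head Q e) p b}"
    using e(3) by simp
  from Q.cmp_arrow_cls[OF e(1,3)] show ?case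
    using Cons(1)[OF e(3)] e v \<open>e \<notin> arcs R\<close> Q.bcls_closed[OF v(2,3) keys] Q.arrow_cls_closed[OF e(1)]
    by (simp add: A_simps vertex_simps Tri.Tri_simps(7) Tri.tri_zeros)
qed

lemma keys_R: "keys h \<subseteq> {p. R.awalk a p b} \<Longrightarrow> keys (linear_ext (map Inl) h) \<subseteq> {p. A.awalk a p b}"
  using keys_linear_ext[of "map Inl" h] walk_R by blast

lemma keys_Q: "keys h \<subseteq> {p. Q.awalk a p b} \<Longrightarrow> keys (linear_ext (map Inl) h) \<subseteq> {p. A.awalk a p b}"
  using keys_linear_ext[of "map Inl" h] walk_Q by blast

text \<open>Both sides are linear in \<open>h\<close> and agree on single paths. Hence, between
  vertices of \<open>R\<close>, the functor is the projection to \<open>bound_cat R \<sigma>\<close>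
  placed in the upper left corner, so its kernel there is the ideal of
  \<open>\<sigma>\<close>.\<close>

lemma lin_R:
  assumes ab: "a \<in> verts R" "b \<in> verts R" and h: "keys h \<subseteq> {p. R.awalk a p b}"
  shows "PF.lin a b (linear_ext (map Inl) h)
    = (R.bcls {#a#} {#b#} (path_mor a b h), \<zero>\<^bsub>on_obj M ({#}, {#a#})\<^esub>, \<zero>\<^bsub>Hom U {#} {#}\<^esub>)"
proof (rule free_space_hom_eq[OF _ _ _ _ h])
  show "vectorspace class_ring (Hom Tri.Tri (Tri.tri_ob {#a#}) (Tri.tri_ob {#b#}))"
    using ab by (simp add: vertex_simps Tri.Tri_Hom_space)
  show "(\<lambda>h. PF.lin a b (linear_ext (map Inl) h)) \<in> module_hom class_ring (free_space {p. R.awalk a p b})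
      (Hom Tri.Tri (Tri.tri_ob {#a#}) (Tri.tri_ob {#b#}))"
  proof (rule hom_compose[OF linear_ext_hom PF.lin_hom])
    show "map Inl ` {p. R.awalk a p b} \<subseteq> {p. A.awalk a p b}" using walk_R by blast
  qed (simp_all add: A_simps ab)
  show "(\<lambda>h. (R.bcls {#a#} {#b#} (path_mor a b h), \<zero>\<^bsub>on_obj M ({#}, {#a#})\<^esub>, \<zero>\<^bsub>Hom U {#} {#}\<^esub>))
      \<in> module_hom class_ring (free_space {p. R.awalk a p b}) (Hom Tri.Tri (Tri.tri_ob {#a#}) (Tri.tri_ob {#b#}))"
    unfolding vertex_simps(3)[OF ab(1)] vertex_simps(3)[OF ab(2)]
    by (intro hom_compose[OF R.bcls_hom[OF ab] Tri.Tri_T_hom]) (simp_all add: vertex_simps ab)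
  show "PF.lin a b (linear_ext (map Inl) (single p 1))
      = (R.bcls {#a#} {#b#} (path_mor a b (single p 1)), \<zero>\<^bsub>on_obj M ({#}, {#a#})\<^esub>, \<zero>\<^bsub>Hom U {#} {#}\<^esub>)"
    if "p \<in> {p. R.awalk a p b}" for p
    using that ab walk_R path_val_R by (simp add: PF.lin_single_one A_simps)
qed

lemma lin_Q:
  assumes ab: "a \<in> verts Q" "b \<in> verts Q" and h: "keys h \<subseteq> {p. Q.awalk a p b}"
  shows "PF.lin a b (linear_ext (map Inl) h)
    = (\<zero>\<^bsub>Hom T {#} {#}\<^esub>, \<zero>\<^bsub>on_obj M ({#b#}, {#})\<^esub>, Q.bcls {#a#} {#b#} (path_mor a b h))"
proof (rule free_space_hom_eq[OF _ _ _ _ h])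
  show "vectorspace class_ring (Hom Tri.Tri (Tri.tri_ob {#a#}) (Tri.tri_ob {#b#}))"
    using ab by (simp add: vertex_simps Tri.Tri_Hom_space)
  show "(\<lambda>h. PF.lin a b (linear_ext (map Inl) h)) \<in> module_hom class_ring (free_space {p. Q.awalk a p b})
      (Hom Tri.Tri (Tri.tri_ob {#a#}) (Tri.tri_ob {#b#}))"
  proof (rule hom_compose[OF linear_ext_hom PF.lin_hom])
    show "map Inl ` {p. Q.awalk a p b} \<subseteq> {p. A.awalk a p b}" using walk_Q by blast
  qed (simp_all add: A_simps ab)
  show "(\<lambda>h. (\<zero>\<^bsub>Hom T {#} {#}\<^esub>, \<zero>\<^bsub>on_obj M ({#b#}, {#})\<^esub>, Q.bcls {#a#} {#b#} (path_mor a b h)))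
      \<in> module_hom class_ring (free_space {p. Q.awalk a p b}) (Hom Tri.Tri (Tri.tri_ob {#a#}) (Tri.tri_ob {#b#}))"
    unfolding vertex_simps(4)[OF ab(1)] vertex_simps(4)[OF ab(2)]
    by (intro hom_compose[OF Q.bcls_hom[OF ab] Tri.Tri_U_hom]) (simp_all add: vertex_simps ab)
  show "PF.lin a b (linear_ext (map Inl) (single p 1))
      = (\<zero>\<^bsub>Hom T {#} {#}\<^esub>, \<zero>\<^bsub>on_obj M ({#b#}, {#})\<^esub>, Q.bcls {#a#} {#b#} (path_mor a b (single p 1)))"
    if "p \<in> {p. Q.awalk a p b}" for p
    using that ab walk_Q path_val_Q by (simp add: PF.lin_single_one A_simps)
qed

end

lemma (in vertex_biproducts) hom_to_empty:
  "\<lbrakk>X \<in> objs D; h \<in> carrier (Hom D X (ob {#}))\<rbrakk> \<Longrightarrow> h = \<zero>\<^bsub>Hom D X (ob {#})\<^esub>"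
  using cmp_idm_left[of X "ob {#}" h] cmp_zero_left[of X "ob {#}" "ob {#}" h]
  by (simp add: idm_empty ob_closed)

lemma (in vertex_biproducts) hom_from_empty:
  "\<lbrakk>X \<in> objs D; h \<in> carrier (Hom D (ob {#}) X)\<rbrakk> \<Longrightarrow> h = \<zero>\<^bsub>Hom D (ob {#}) X\<^esub>"
  using cmp_idm_right[of "ob {#}" X h] cmp_zero_right[of "ob {#}" "ob {#}" X h]
  by (simp add: idm_empty ob_closed)

text \<open>The identity of the empty multiset is zero, so it acts on \<open>m\<close> both as the
  identity and as zero.\<close>

lemma (in bimodule_biproducts) M_empty:
  "\<lbrakk>t \<in> objs T; m \<in> carrier (on_obj M ({#}, t))\<rbrakk> \<Longrightarrow> m = \<zero>\<^bsub>on_obj M ({#}, t)\<^esub>"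
  using lact_idm[of "{#}" t m] lact_zero(2)[of "{#}" "{#}" t m] by (simp add: BU.idm_empty)

lemma (in bimodule_biproducts) M_empty':
  "\<lbrakk>u \<in> objs U; m \<in> carrier (on_obj M (u, {#}))\<rbrakk> \<Longrightarrow> m = \<zero>\<^bsub>on_obj M (u, {#})\<^esub>"
  using ract_idm[of u "{#}" m] ract_zero(2)[of u "{#}" "{#}" m] by (simp add: BT.idm_empty)

section \<open>Vectors of the bimodule as combinations of new arrows\<close>

context augmented_quiver_data
begin

lemma basis_locale: "\<lbrakk>i \<in> verts Q; j \<in> verts R\<rbrakk> \<Longrightarrow> finite_basis (on_obj M ({#i#}, {#j#})) (B i j)"
  by (simp add: finite_basis_def finite_basis_axioms_def Tri.M_space Tri.M_fin_dim vertex_simps basis_B)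

text \<open>The form of \<open>arrow_map\<close> on the level of paths: a linear section of the
  functor over the lower left corner, as \<open>lin_lift\<close> shows. It lands in combinations of
  paths of length one, and finite dimension of the space makes the sum finite.\<close>

definition lift :: "'v \<Rightarrow> 'v \<Rightarrow> 'x \<Rightarrow> (('v, 'e, 'x) aug_arrow list \<Rightarrow>\<^sub>0 'k)" where
  "lift i j m = (\<Sum>b\<in>B i j. single [Inr (i, j, b)]
     (finite_basis.coord (on_obj M ({#i#}, {#j#})) (B i j) m b))"

abbreviation mid :: "'v \<Rightarrow> 'v \<Rightarrow> 'x \<Rightarrow> ('v, 'e, 'k) path_mor set \<times> 'x \<times> ('v, 'e, 'k) path_mor set" where
  "mid i j m \<equiv> (\<zero>\<^bsub>Hom T {#j#} {#}\<^esub>, m, \<zero>\<^bsub>Hom U {#} {#i#}\<^esub>)"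

context
  fixes i j assumes i: "i \<in> verts Q" and j: "j \<in> verts R"
begin

interpretation FB: finite_basis "on_obj M ({#i#}, {#j#})" "B i j"
  using i j by (rule basis_locale)

lemma arrow_walk: "b \<in> B i j \<Longrightarrow> A.awalk j [Inr (i, j, b)] i"
  using i j by (simp add: A.awalk_Cons_iff A.awalk_Nil_iff A_simps)

lemma lift_keys: "keys (lift i j m) \<subseteq> {p. A.awalk j p i}"
  unfolding lift_def by (intro keys_subset_sum keys_subset_single) (simp add: arrow_walk)

lemma lift_hom: "lift i j \<in> module_hom class_ring (on_obj M ({#i#}, {#j#})) (free_space {p. A.awalk j p i})"
proof (rule module_homI)
  show "lift i j m \<in> carrier (free_space {p. A.awalk j p i})" for m
    using lift_keys[of m] by (simp add: free_space_def)
  show "lift i j (m \<oplus>\<^bsub>on_obj M ({#i#}, {#j#})\<^esub> m') = lift i j m \<oplus>\<^bsub>free_space {p. A.awalk j p i}\<^esub> lift i j m'"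
    if "m \<in> carrier (on_obj M ({#i#}, {#j#}))" "m' \<in> carrier (on_obj M ({#i#}, {#j#}))" for m m'
    using that by (simp add: lift_def FB.coord_add single_add sum.distrib free_space_def)
  show "lift i j (c \<odot>\<^bsub>on_obj M ({#i#}, {#j#})\<^esub> m) = c \<odot>\<^bsub>free_space {p. A.awalk j p i}\<^esub> lift i j m"
    if "m \<in> carrier (on_obj M ({#i#}, {#j#}))" for c m
    using that by (simp add: lift_def FB.coord_smult scale_sum free_space_def)
qed

lemma lift_basis:
  assumes b: "b \<in> B i j"
  shows "lift i j b = single [Inr (i, j, b)] 1"
proof -
  have "lift i j b = (\<Sum>b'\<in>B i j. if b' = b then single [Inr (i, j, b)] 1 else 0)"
    unfolding lift_def by (intro sum.cong) (simp_all add: FB.coord_basis[OF b])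
  then show ?thesis using b FB.B_finite by simp
qed

lemma lift_zero: "lift i j \<zero>\<^bsub>on_obj M ({#i#}, {#j#})\<^esub> = 0"
  using hom_zero[OF FB.V.vectorspace_axioms free_space_vectorspace lift_hom] by (simp add: free_space_def)

lemma mid_hom: "mid i j \<in> module_hom class_ring (on_obj M ({#i#}, {#j#})) (Hom Tri.Tri (Tri.tri_ob {#j#}) (Tri.tri_ob {#i#}))"
  using Tri.Tri_M_hom[of "{#j#}" "{#}" "{#}" "{#i#}"] i j by (simp add: vertex_simps)

lemma hom_eq_M:
  fixes W :: "('k, 'w) module"
  assumes "vectorspace class_ring W" "f \<in> module_hom class_ring (on_obj M ({#i#}, {#j#})) W"
    "g \<in> module_hom class_ring (on_obj M ({#i#}, {#j#})) W" "\<And>b. b \<in> B i j \<Longrightarrow> f b = g b"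
    "m \<in> carrier (on_obj M ({#i#}, {#j#}))"
  shows "f m = g m"
  by (rule hom_eq_on_span[OF FB.V.vectorspace_axioms assms(1-3) FB.B_closed FB.B_span _ assms(5)]) (rule assms(4))

lemma Tri_RQ_space: "vectorspace class_ring (Hom Tri.Tri (Tri.tri_ob {#j#}) (Tri.tri_ob {#i#}))"
  using i j by (simp add: vertex_simps Tri.Tri_Hom_space)

text \<open>By linearity it is enough to treat a basis vector, whose lift is a single new arrow with
  value \<open>arr\<close>. The equation gives fullness onto the lower left corner, and it lets the
  functor recover \<open>m\<close> from its lift.\<close>

lemma lin_lift:
  assumes "m \<in> carrier (on_obj M ({#i#}, {#j#}))"
  shows "PF.lin j i (lift i j m) = mid i j m"
proof (rule hom_eq_M[OF Tri_RQ_space _ mid_hom _ assms])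
  show "(\<lambda>m. PF.lin j i (lift i j m)) \<in> module_hom class_ring (on_obj M ({#i#}, {#j#}))
      (Hom Tri.Tri (Tri.tri_ob {#j#}) (Tri.tri_ob {#i#}))"
    using i j by (intro hom_compose[OF lift_hom PF.lin_hom]) (simp_all add: A_simps)
  fix b assume b: "b \<in> B i j"
  have "Inr (i, j, b) \<in> arcs A" using i j b by (simp add: A_simps)
  from PF.arr_closed[OF this]
  have "arr (Inr (i, j, b)) \<in> carrier (Hom Tri.Tri (Tri.tri_ob {#j#}) (Tri.tri_ob {#i#}))"
    by (simp only: A_simps)
  moreover have "Tri.tri_ob {#j#} \<in> objs Tri.Tri" "Tri.tri_ob {#i#} \<in> objs Tri.Tri"
    using i j by (auto intro!: PF.vertex_closed simp: A_simps(1))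
  ultimately have "PF.path_val [Inr (i, j, b)] j i = arr (Inr (i, j, b))"
    using PF.cmp_idm_left by (simp add: A_simps del: arr.simps)
  then show "PF.lin j i (lift i j b) = mid i j b"
    using i j b by (simp add: lift_basis PF.lin_single_one arrow_walk A_simps)
qed

end

section \<open>The functor kills the old relations\<close>

lemma relationD:
  "(a, b, f) \<in> \<sigma> \<Longrightarrow> a \<in> verts R \<and> b \<in> verts R \<and> keys f \<subseteq> {p. R.awalk a p b}"
  "(a, b, f) \<in> \<rho> \<Longrightarrow> a \<in> verts Q \<and> b \<in> verts Q \<and> keys f \<subseteq> {p. Q.awalk a p b}"
  using rho sigma by (auto simp: relations_on_def)

lemma relation_closed:
  assumes "(a, b, f) \<in> \<rho> \<union> \<sigma>"
  shows "path_mor a b (linear_ext (map Inl) f) \<in> carrier (Hom (path_cat A) {#a#} {#b#})"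
  using assms
proof
  assume "(a, b, f) \<in> \<rho>"
  from relationD(2)[OF this] show ?thesis by (intro path_mor_closed keys_Q) simp
next
  assume "(a, b, f) \<in> \<sigma>"
  from relationD(1)[OF this] show ?thesis by (intro path_mor_closed keys_R) simp
qed

lemma relation_in_IA:
  assumes "(a, b, f) \<in> \<rho> \<union> \<sigma>"
  shows "path_mor a b (linear_ext (map Inl) f) \<in> IA {#a#} {#b#}"
  unfolding relations_ideal_def
proof (rule generated_ideal_base)
  show "({#a#}, {#b#}, path_mor a b (linear_ext (map Inl) f))
      \<in> (\<lambda>(a, b, f). ({#a#}, {#b#}, path_mor a b f)) ` view_relations (\<rho> \<union> \<sigma>)"
    unfolding view_relations_def image_image using assms by (rule rev_image_eqI) simp
  show "path_mor a b (linear_ext (map Inl) f) \<in> carrier (Hom (path_cat A) {#a#} {#b#})"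
    using assms by (rule relation_closed)
qed

lemma Phi_relation:
  assumes "(a, b, f) \<in> \<rho> \<union> \<sigma>"
  shows "PF.Phi {#a#} {#b#} (path_mor a b (linear_ext (map Inl) f))
    = \<zero>\<^bsub>Hom Tri.Tri (Tri.tri_ob {#a#}) (Tri.tri_ob {#b#})\<^esub>"
  using assms
proof
  assume f: "(a, b, f) \<in> \<sigma>"
  then have ab: "a \<in> verts R" "b \<in> verts R" and keys: "keys f \<subseteq> {p. R.awalk a p b}"
    using relationD by auto
  have "R.bcls {#a#} {#b#} (path_mor a b f) = \<zero>\<^bsub>Hom T {#a#} {#b#}\<^esub>"
    using R.relation_in_ideal[OF f keys] ab keys
    by (simp add: R.bcls_zero_iff)
  then show ?thesis
    using ab keys by (simp add: PF.Phi_path_mor A_simps(1) keys_R lin_R vertex_simps Tri.Tri_simps(3))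
next
  assume f: "(a, b, f) \<in> \<rho>"
  then have ab: "a \<in> verts Q" "b \<in> verts Q" and keys: "keys f \<subseteq> {p. Q.awalk a p b}"
    using relationD by auto
  have "Q.bcls {#a#} {#b#} (path_mor a b f) = \<zero>\<^bsub>Hom U {#a#} {#b#}\<^esub>"
    using Q.relation_in_ideal[OF f keys] ab keys
    by (simp add: Q.bcls_zero_iff)
  then show ?thesis
    using ab keys by (simp add: PF.Phi_path_mor A_simps(1) keys_Q lin_Q vertex_simps Tri.Tri_simps(3))
qed

lemma Phi_IA: "f \<in> IA X Y \<Longrightarrow> PF.Phi X Y f = \<zero>\<^bsub>Hom Tri.Tri (Tri.tri_ob X) (Tri.tri_ob Y)\<^esub>"
  unfolding relations_ideal_def
proof (drule k_functor.generated_ideal_preimage[OF PF.Phi_functor k_category.zero_ideal[OF Tri.Tri_category], rotated -1])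
  fix X Y and h :: "('v, ('v, 'e, 'x) aug_arrow, 'k) path_mor"
  assume "(X, Y, h) \<in> (\<lambda>(a, b, f). ({#a#}, {#b#}, path_mor a b f)) ` view_relations (\<rho> \<union> \<sigma>)"
  then obtain a b f where f: "(a, b, f) \<in> \<rho> \<union> \<sigma>"
    and eq: "X = {#a#}" "Y = {#b#}" "h = path_mor a b (linear_ext (map Inl) f)"
    by (auto simp: view_relations_def)
  have "h \<in> carrier (Hom (path_cat A) X Y)"
    unfolding eq using f by (rule relation_closed)
  then show "h \<in> carrier (Hom (path_cat A) X Y) \<and>
      on_hom \<lparr>on_obj = Tri.tri_ob, on_hom = PF.Phi\<rparr> X Y h
      \<in> {\<zero>\<^bsub>Hom Tri.Tri (on_obj \<lparr>on_obj = Tri.tri_ob, on_hom = PF.Phi\<rparr> X) (on_obj \<lparr>on_obj = Tri.tri_ob, on_hom = PF.Phi\<rparr> Y)\<^esub>}"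
    using Phi_relation[OF f] by (simp add: eq)
qed simp

section \<open>The iterated quotient as a quotient of the path category\<close>

abbreviation PA :: "('v multiset, ('v, ('v, 'e, 'x) aug_arrow, 'k) path_mor, 'k) kcat" where
  "PA \<equiv> path_cat A"

abbreviation "E \<equiv> quotient_cat PA IA"

lemma augmented_cat_eq: "augmented_cat R \<sigma> B Q \<rho> = E"
  by (simp add: augmented_cat_def bound_cat_def)

definition "clsA = cls (path_cat A) IA"

definition "J = generated_ideal E (mu_relations R \<sigma> B Q \<rho> M)"

lemma J_ideal: "two_sided_ideal E J"
  unfolding J_def by (rule AI.quotient.generated_ideal_ideal)

text \<open>The full preimage of \<open>J\<close> under the projection to the first quotient. It
  replaces the two successive quotients by a single ideal, so that one can work with paths instead
  of classes of classes.\<close>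

definition N :: "'v multiset \<Rightarrow> 'v multiset \<Rightarrow> ('v, ('v, 'e, 'x) aug_arrow, 'k) path_mor set" where
  "N X Y = {f \<in> carrier (Hom (path_cat A) X Y). clsA X Y f \<in> J X Y}"

lemma N_ideal: "two_sided_ideal (path_cat A) N"
  using k_functor.preimage_ideal[OF AI.cls_functor J_ideal] by (simp add: N_def[abs_def] clsA_def)

sublocale NI: k_category_ideal "path_cat A" N
  by (simp add: k_category_ideal_def k_category_ideal_axioms_def N_ideal A.path_cat_category)

lemma IA_subset_N:
  assumes "set_mset X \<subseteq> verts A" "set_mset Y \<subseteq> verts A" and f: "f \<in> IA X Y"
  shows "f \<in> N X Y"
proof -
  have X: "X \<in> objs PA" and Y: "Y \<in> objs PA"
    using assms(1,2) by (simp_all add: path_cat_simps(1))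
  have f': "f \<in> carrier (Hom (path_cat A) X Y)"
    using subspaceD(1)[OF two_sided_idealD(1)[OF AI.ideal X Y]] f by blast
  have "clsA X Y f = \<zero>\<^bsub>Hom E X Y\<^esub>"
    using AI.cls_eq_zero_iff[OF X Y f'] f by (simp add: clsA_def)
  moreover have "\<zero>\<^bsub>Hom E X Y\<^esub> \<in> J X Y"
    using subspaceD(2)[OF two_sided_idealD(1)[OF J_ideal]] X Y by simp
  ultimately show ?thesis using f' by (simp add: N_def)
qed

lemma linear_ext_path_mor: "(\<lambda>x y. linear_ext (map h) (path_mor a b f x y)) = path_mor a b (linear_ext (map h) f)"
  by (simp add: path_mor_def fun_eq_iff)

text \<open>The preimage of \<open>N\<close> under the embedding of the path category of
  \<open>R\<close> is an ideal. It contains \<open>\<sigma>\<close>, because the relations viewed on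
  the augmented quiver lie in \<open>IA\<close>, hence in \<open>N\<close>; so it contains all that
  \<open>\<sigma>\<close> generates.\<close>

lemma IR_subset_N:
  assumes "path_mor a b h \<in> relations_ideal R \<sigma> {#a#} {#b#}"
  shows "path_mor a b (linear_ext (map Inl) h) \<in> N {#a#} {#b#}"
proof -
  define F :: "('v multiset, ('v, 'e, 'k) path_mor, 'v multiset, ('v, ('v, 'e, 'x) aug_arrow, 'k) path_mor) kfun"
    where "F = \<lparr>on_obj = \<lambda>X. X, on_hom = \<lambda>X Y f x y. linear_ext (map Inl) (f x y)\<rparr>"
  have F_simps: "on_obj F X = X" "on_hom F X Y f = (\<lambda>x y. linear_ext (map Inl) (f x y))" for X Y f
    by (simp_all add: F_def)
  have F: "k_functor (path_cat R) PA F"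
    unfolding F_def by (rule R.path_cat_embedding[OF wf_A _ walk_R]) (simp add: A_simps(1))
  have "on_hom F {#a#} {#b#} (path_mor a b h) \<in> N (on_obj F {#a#}) (on_obj F {#b#})"
  proof (rule k_functor.generated_ideal_preimage[OF F N_ideal])
    show "path_mor a b h \<in> generated_ideal (path_cat R) ((\<lambda>(a, b, f). ({#a#}, {#b#}, path_mor a b f)) ` \<sigma>) {#a#} {#b#}"
      using assms by (simp only: relations_ideal_def)
    fix X Y f assume "(X, Y, f) \<in> (\<lambda>(a, b, f). ({#a#}, {#b#}, path_mor a b f)) ` \<sigma>"
    then obtain a' b' f' where f': "(a', b', f') \<in> \<sigma>" "X = {#a'#}" "Y = {#b'#}" "f = path_mor a' b' f'"
      by auto
    have "path_mor a' b' (linear_ext (map Inl) f') \<in> N {#a'#} {#b'#}"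
      using f'(1) relationD(1)[OF f'(1)] relation_in_IA[of a' b' f']
      by (intro IA_subset_N) (simp_all add: path_cat_simps(1) A_simps(1))
    then show "f \<in> carrier (Hom (path_cat R) X Y) \<and> on_hom F X Y f \<in> N (on_obj F X) (on_obj F Y)"
      using f' relationD(1)[OF f'(1)] by (simp add: F_simps linear_ext_path_mor path_mor_closed)
  qed
  then show ?thesis by (simp add: F_simps linear_ext_path_mor)
qed

lemma IQ_subset_N:
  assumes "path_mor a b h \<in> relations_ideal Q \<rho> {#a#} {#b#}"
  shows "path_mor a b (linear_ext (map Inl) h) \<in> N {#a#} {#b#}"
proof -
  define F :: "('v multiset, ('v, 'e, 'k) path_mor, 'v multiset, ('v, ('v, 'e, 'x) aug_arrow, 'k) path_mor) kfun"
    where "F = \<lparr>on_obj = \<lambda>X. X, on_hom = \<lambda>X Y f x y. linear_ext (map Inl) (f x y)\<rparr>"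
  have F_simps: "on_obj F X = X" "on_hom F X Y f = (\<lambda>x y. linear_ext (map Inl) (f x y))" for X Y f
    by (simp_all add: F_def)
  have F: "k_functor (path_cat Q) PA F"
    unfolding F_def by (rule Q.path_cat_embedding[OF wf_A _ walk_Q]) (simp add: A_simps(1))
  have "on_hom F {#a#} {#b#} (path_mor a b h) \<in> N (on_obj F {#a#}) (on_obj F {#b#})"
  proof (rule k_functor.generated_ideal_preimage[OF F N_ideal])
    show "path_mor a b h \<in> generated_ideal (path_cat Q) ((\<lambda>(a, b, f). ({#a#}, {#b#}, path_mor a b f)) ` \<rho>) {#a#} {#b#}"
      using assms by (simp only: relations_ideal_def)
    fix X Y f assume "(X, Y, f) \<in> (\<lambda>(a, b, f). ({#a#}, {#b#}, path_mor a b f)) ` \<rho>"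
    then obtain a' b' f' where f': "(a', b', f') \<in> \<rho>" "X = {#a'#}" "Y = {#b'#}" "f = path_mor a' b' f'"
      by auto
    have "path_mor a' b' (linear_ext (map Inl) f') \<in> N {#a'#} {#b'#}"
      using f'(1) relationD(2)[OF f'(1)] relation_in_IA[of a' b' f']
      by (intro IA_subset_N) (simp_all add: path_cat_simps(1) A_simps(1))
    then show "f \<in> carrier (Hom (path_cat Q) X Y) \<and> on_hom F X Y f \<in> N (on_obj F X) (on_obj F Y)"
      using f' relationD(2)[OF f'(1)] by (simp add: F_simps linear_ext_path_mor path_mor_closed)
  qed
  then show ?thesis by (simp add: F_simps linear_ext_path_mor)
qed

text \<open>Classes modulo \<open>N\<close>, in which rewriting by the old relations and by
  \<open>\<mu>\<close> becomes equality.\<close>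

definition clsN :: "'v \<Rightarrow> 'v \<Rightarrow> (('v, 'e, 'x) aug_arrow list \<Rightarrow>\<^sub>0 'k) \<Rightarrow> ('v, ('v, 'e, 'x) aug_arrow, 'k) path_mor set" where
  "clsN a b h = cls (path_cat A) N {#a#} {#b#} (path_mor a b h)"

lemma clsN_hom:
  assumes "a \<in> verts A" "b \<in> verts A"
  shows "clsN a b \<in> module_hom class_ring (free_space {p. A.awalk a p b}) (Hom (quotient_cat (path_cat A) N) {#a#} {#b#})"
  unfolding clsN_def[abs_def] quotient_cat_simps using assms
  by (intro hom_compose[OF A.path_mor_hom NI.cls_hom]) (simp_all add: path_cat_simps(1))

lemma clsN_space:
  "\<lbrakk>a \<in> verts A; b \<in> verts A\<rbrakk> \<Longrightarrow> vectorspace class_ring (Hom (quotient_cat (path_cat A) N) {#a#} {#b#})"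
  by (intro NI.quotient.Hom_space) (simp_all add: path_cat_simps(1))

lemma cmp_clsN:
  assumes "a \<in> verts A" "b \<in> verts A" "c \<in> verts A"
    and "keys f \<subseteq> {p. A.awalk a p b}" "keys g \<subseteq> {p. A.awalk b p c}"
  shows "cmp (quotient_cat (path_cat A) N) {#a#} {#b#} {#c#} (clsN b c g) (clsN a b f) = clsN a c (path_mult g f)"
  using assms unfolding clsN_def
  by (simp add: NI.cmp_cls path_cat_simps(1) path_mor_closed A.cmp_path_mor)

lemma clsN_eq_zero_iff:
  "\<lbrakk>a \<in> verts A; b \<in> verts A; keys h \<subseteq> {p. A.awalk a p b}\<rbrakk>
    \<Longrightarrow> clsN a b h = \<zero>\<^bsub>Hom (quotient_cat (path_cat A) N) {#a#} {#b#}\<^esub> \<longleftrightarrow> path_mor a b h \<in> N {#a#} {#b#}"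
  unfolding clsN_def quotient_cat_simps
  by (intro NI.cls_eq_zero_iff) (simp_all add: path_cat_simps(1) path_mor_closed)

lemma aug_arrow_cls_eq:
  "aug_arrow_cls R \<sigma> B Q \<rho> e = clsA {#tail A e#} {#head A e#} (path_mor (tail A e) (head A e) (single [e] 1))"
  by (simp add: aug_arrow_cls_def arrow_cls_def clsA_def)

text \<open>\<open>arrow_map\<close> is a definite description, so the candidate built from
  \<open>lift\<close> must be linear, have the right values and be the only such map. Uniqueness
  holds on the carrier because the basis spans, and off the carrier because members of
  \<open>linear_maps\<close> are extensional; hence the restriction.\<close>

lemma arrow_map_eq:
  assumes i: "i \<in> verts Q" and j: "j \<in> verts R" and m: "m \<in> carrier (on_obj M ({#i#}, {#j#}))"
  shows "arrow_map R \<sigma> B Q \<rho> M i j m = clsA {#j#} {#i#} (path_mor j i (lift i j m))"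
proof -
  let ?V = "on_obj M ({#i#}, {#j#})" and ?W = "Hom E {#j#} {#i#}"
  define \<phi> where "\<phi> = restrict (\<lambda>m. clsA {#j#} {#i#} (path_mor j i (lift i j m))) (carrier ?V)"
  have obj: "{#j#} \<in> objs PA" "{#i#} \<in> objs PA"
    using i j by (simp_all add: path_cat_simps(1) A_simps(1))
  interpret FB: finite_basis ?V "B i j" using i j by (rule basis_locale)
  have W: "vectorspace class_ring ?W" using obj by (intro AI.quotient.Hom_space) simp_all
  have "(\<lambda>m. clsA {#j#} {#i#} (path_mor j i (lift i j m))) \<in> module_hom class_ring ?V ?W"
    unfolding clsA_def quotient_cat_simps
    by (rule hom_compose[OF lift_hom[OF i j] hom_compose[OF A.path_mor_hom AI.cls_hom[OF obj]]])
  then have hom: "\<phi> \<in> module_hom class_ring ?V ?W"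
    using FB.V.smult_closed by (auto simp: \<phi>_def LinearCombinations.module_hom_def)
  have phi_basis: "\<phi> b = aug_arrow_cls R \<sigma> B Q \<rho> (Inr (i, j, b))" if "b \<in> B i j" for b
    using that FB.B_closed lift_basis[OF i j that] by (auto simp: \<phi>_def aug_arrow_cls_eq A_simps(7,8))
  have "arrow_map R \<sigma> B Q \<rho> M i j = \<phi>"
    unfolding arrow_map_def augmented_cat_eq
  proof (rule the_equality)
    show "\<phi> \<in> carrier (linear_maps ?V ?W) \<and> (\<forall>b\<in>B i j. \<phi> b = aug_arrow_cls R \<sigma> B Q \<rho> (Inr (i, j, b)))"
      using hom phi_basis by (simp add: linear_maps_def) (simp add: \<phi>_def)
    fix \<psi> assume \<psi>: "\<psi> \<in> carrier (linear_maps ?V ?W) \<and> (\<forall>b\<in>B i j. \<psi> b = aug_arrow_cls R \<sigma> B Q \<rho> (Inr (i, j, b)))"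
    show "\<psi> = \<phi>"
    proof (rule extensionalityI)
      show "\<psi> \<in> extensional (carrier ?V)" using \<psi> by (simp add: linear_maps_def)
      show "\<phi> \<in> extensional (carrier ?V)" by (simp add: \<phi>_def)
      show "\<psi> x = \<phi> x" if "x \<in> carrier ?V" for x
        by (rule hom_eq_M[OF i j W _ hom _ that]) (use \<psi> phi_basis in \<open>simp_all add: linear_maps_def\<close>)
    qed
  qed
  then show ?thesis using m by (simp add: \<phi>_def)
qed

section \<open>The relations between new and old arrows\<close>

lemma arrow_keys:
  "q \<in> arcs Q \<Longrightarrow> keys (single [Inl q] (1::'k)) \<subseteq> {p. A.awalk (tail Q q) p (head Q q)}"
  "r \<in> arcs R \<Longrightarrow> keys (single [Inl r] (1::'k)) \<subseteq> {p. A.awalk (tail R r) p (head R r)}"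
  using keys_Q[of "single [q] (1::'k)" "tail Q q" "head Q q"] Q.arc_implies_awalk
    keys_R[of "single [r] (1::'k)" "tail R r" "head R r"] R.arc_implies_awalk by simp_all

lemma verts_A: "a \<in> verts R \<Longrightarrow> a \<in> verts A" "a \<in> verts Q \<Longrightarrow> a \<in> verts A"
  by (simp_all add: A_simps(1))

text \<open>In the product with a matrix concentrated in the \<open>Q\<close> corner, one term of
  the lower left entry vanishes and the other is the action of the arrow. This has two uses: the
  functor kills \<open>\<mu>\<close>, and images can be followed through the reduction of
  paths.\<close>

lemma lin_arrow_mult_left:
  assumes q: "q \<in> arcs Q" and j: "j \<in> verts R" and m: "m \<in> carrier (on_obj M ({#tail Q q#}, {#j#}))"
    and h: "keys h \<subseteq> {p. A.awalk j p (tail Q q)}" and lin: "PF.lin j (tail Q q) h = mid (tail Q q) j m"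
  shows "PF.lin j (head Q q) (path_mult (single [Inl q] 1) h)
    = mid (head Q q) j (Tri.lact {#j#} {#tail Q q#} {#head Q q#} (arrow_cls Q \<rho> q) m)"
proof -
  have v: "tail Q q \<in> verts Q" "head Q q \<in> verts Q" using q by (simp_all add: Q.wellformed)
  interpret H: vectorspace class_ring "on_obj M ({#head Q q#}, {#j#})"
    using v j by (intro Tri.M_space) (simp_all add: vertex_simps)
  have "PF.lin (tail Q q) (head Q q) (single [Inl q] 1)
      = (\<zero>\<^bsub>Hom T {#} {#}\<^esub>, \<zero>\<^bsub>on_obj M ({#head Q q#}, {#})\<^esub>, arrow_cls Q \<rho> q)"
    using lin_Q[OF v, of "single [q] 1"] Q.arc_implies_awalk[OF q] by (simp add: R.arrow_cls_eq Q.arrow_cls_eq)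
  then have "PF.lin j (head Q q) (path_mult (single [Inl q] 1) h)
    = cmp Tri.Tri ({#j#}, {#}) ({#}, {#tail Q q#}) ({#}, {#head Q q#})
      (\<zero>\<^bsub>Hom T {#} {#}\<^esub>, \<zero>\<^bsub>on_obj M ({#head Q q#}, {#})\<^esub>, arrow_cls Q \<rho> q) (mid (tail Q q) j m)"
    using PF.lin_mult[OF verts_A(1)[OF j] verts_A(2)[OF v(1)] verts_A(2)[OF v(2)] h arrow_keys(1)[OF q]]
      lin v j by (simp add: vertex_simps)
  also have "\<dots> = mid (head Q q) j (Tri.lact {#j#} {#tail Q q#} {#head Q q#} (arrow_cls Q \<rho> q) m)"
    using v j m Q.arrow_cls_closed[OF q]
    by (simp add: Tri.Tri_simps(7) vertex_simps Tri.tri_zeros Tri.lact_closed)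
  finally show ?thesis .
qed

lemma lin_arrow_mult_right:
  assumes r: "r \<in> arcs R" and i: "i \<in> verts Q" and m: "m \<in> carrier (on_obj M ({#i#}, {#head R r#}))"
    and h: "keys h \<subseteq> {p. A.awalk (head R r) p i}" and lin: "PF.lin (head R r) i h = mid i (head R r) m"
  shows "PF.lin (tail R r) i (path_mult h (single [Inl r] 1))
    = mid i (tail R r) (Tri.ract {#i#} {#tail R r#} {#head R r#} m (arrow_cls R \<sigma> r))"
proof -
  have v: "tail R r \<in> verts R" "head R r \<in> verts R" using r by (simp_all add: R.wellformed)
  interpret H: vectorspace class_ring "on_obj M ({#i#}, {#tail R r#})"
    using v i by (intro Tri.M_space) (simp_all add: vertex_simps)
  have "PF.lin (tail R r) (head R r) (single [Inl r] 1)
      = (arrow_cls R \<sigma> r, \<zero>\<^bsub>on_obj M ({#}, {#tail R r#})\<^esub>, \<zero>\<^bsub>Hom U {#} {#}\<^esub>)"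
    using lin_R[OF v, of "single [r] 1"] R.arc_implies_awalk[OF r] by (simp add: R.arrow_cls_eq Q.arrow_cls_eq)
  then have "PF.lin (tail R r) i (path_mult h (single [Inl r] 1))
    = cmp Tri.Tri ({#tail R r#}, {#}) ({#head R r#}, {#}) ({#}, {#i#}) (mid i (head R r) m)
      (arrow_cls R \<sigma> r, \<zero>\<^bsub>on_obj M ({#}, {#tail R r#})\<^esub>, \<zero>\<^bsub>Hom U {#} {#}\<^esub>)"
    using PF.lin_mult[OF verts_A(1)[OF v(1)] verts_A(1)[OF v(2)] verts_A(2)[OF i] arrow_keys(2)[OF r] h]
      lin v i by (simp add: vertex_simps)
  also have "\<dots> = mid i (tail R r) (Tri.ract {#i#} {#tail R r#} {#head R r#} m (arrow_cls R \<sigma> r))"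
    using v i m R.arrow_cls_closed[OF r]
    by (simp add: Tri.Tri_simps(7) vertex_simps Tri.tri_zeros Tri.ract_closed)
  finally show ?thesis .
qed

lemma lact_arrow_closed:
  "\<lbrakk>q \<in> arcs Q; j \<in> verts R; m \<in> carrier (on_obj M ({#tail Q q#}, {#j#}))\<rbrakk>
    \<Longrightarrow> Tri.lact {#j#} {#tail Q q#} {#head Q q#} (arrow_cls Q \<rho> q) m \<in> carrier (on_obj M ({#head Q q#}, {#j#}))"
  by (intro Tri.lact_closed Q.arrow_cls_closed) (simp_all add: vertex_simps Q.wellformed)

lemma ract_arrow_closed:
  "\<lbrakk>r \<in> arcs R; i \<in> verts Q; m \<in> carrier (on_obj M ({#i#}, {#head R r#}))\<rbrakk>
    \<Longrightarrow> Tri.ract {#i#} {#tail R r#} {#head R r#} m (arrow_cls R \<sigma> r) \<in> carrier (on_obj M ({#i#}, {#tail R r#}))"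
  by (intro Tri.ract_closed R.arrow_cls_closed) (simp_all add: vertex_simps R.wellformed)

text \<open>The relations \<open>\<mu>\<close> are stated in the first quotient. Here both of their
  terms become classes of explicit combinations of paths, the new arrow of \<open>b\<close> being
  the lift of \<open>b\<close>; this form can be compared modulo \<open>N\<close> and evaluated by
  \<open>lin\<close>.\<close>

lemma mu_left_eq:
  assumes q: "q \<in> arcs Q" and i: "tail Q q = i" and j: "j \<in> verts R" and b: "b \<in> B i j"
  shows "cmp E {#j#} {#i#} {#head Q q#} (aug_arrow_cls R \<sigma> B Q \<rho> (Inl q)) (aug_arrow_cls R \<sigma> B Q \<rho> (Inr (i, j, b)))
    = clsA {#j#} {#head Q q#} (path_mor j (head Q q) (path_mult (single [Inl q] 1) (lift i j b)))"
    "arrow_map R \<sigma> B Q \<rho> M (head Q q) j (Tri.lact {#j#} {#i#} {#head Q q#} (arrow_cls Q \<rho> q) b)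
    = clsA {#j#} {#head Q q#} (path_mor j (head Q q)
        (lift (head Q q) j (Tri.lact {#j#} {#i#} {#head Q q#} (arrow_cls Q \<rho> q) b)))"
proof -
  have v: "i \<in> verts Q" "head Q q \<in> verts Q" using q i by (auto simp: Q.wellformed)
  show "cmp E {#j#} {#i#} {#head Q q#} (aug_arrow_cls R \<sigma> B Q \<rho> (Inl q)) (aug_arrow_cls R \<sigma> B Q \<rho> (Inr (i, j, b)))
    = clsA {#j#} {#head Q q#} (path_mor j (head Q q) (path_mult (single [Inl q] 1) (lift i j b)))"
    using arrow_keys(1)[OF q] lift_keys[OF v(1) j, of b] v j i q
    by (simp add: aug_arrow_cls_eq A_simps lift_basis[OF v(1) j b] clsA_def AI.cmp_cls path_cat_simps(1)
        path_mor_closed A.cmp_path_mor del: bilinear_ext_single)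
  show "arrow_map R \<sigma> B Q \<rho> M (head Q q) j (Tri.lact {#j#} {#i#} {#head Q q#} (arrow_cls Q \<rho> q) b)
    = clsA {#j#} {#head Q q#} (path_mor j (head Q q)
        (lift (head Q q) j (Tri.lact {#j#} {#i#} {#head Q q#} (arrow_cls Q \<rho> q) b)))"
    using lact_arrow_closed[OF q j, of b] B_closed[OF v(1) j b] i
    by (intro arrow_map_eq[OF v(2) j]) simp
qed

lemma mu_right_eq:
  assumes r: "r \<in> arcs R" and j: "head R r = j" and i: "i \<in> verts Q" and b: "b \<in> B i j"
  shows "cmp E {#tail R r#} {#j#} {#i#} (aug_arrow_cls R \<sigma> B Q \<rho> (Inr (i, j, b))) (aug_arrow_cls R \<sigma> B Q \<rho> (Inl r))
    = clsA {#tail R r#} {#i#} (path_mor (tail R r) i (path_mult (lift i j b) (single [Inl r] 1)))"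
    "arrow_map R \<sigma> B Q \<rho> M i (tail R r) (Tri.ract {#i#} {#tail R r#} {#j#} b (arrow_cls R \<sigma> r))
    = clsA {#tail R r#} {#i#} (path_mor (tail R r) i
        (lift i (tail R r) (Tri.ract {#i#} {#tail R r#} {#j#} b (arrow_cls R \<sigma> r))))"
proof -
  have v: "j \<in> verts R" "tail R r \<in> verts R" using r j by (auto simp: R.wellformed)
  show "cmp E {#tail R r#} {#j#} {#i#} (aug_arrow_cls R \<sigma> B Q \<rho> (Inr (i, j, b))) (aug_arrow_cls R \<sigma> B Q \<rho> (Inl r))
    = clsA {#tail R r#} {#i#} (path_mor (tail R r) i (path_mult (lift i j b) (single [Inl r] 1)))"
    using arrow_keys(2)[OF r] lift_keys[OF i v(1), of b] v j i r
    by (simp add: aug_arrow_cls_eq A_simps lift_basis[OF i v(1) b] clsA_def AI.cmp_cls path_cat_simps(1)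
        path_mor_closed A.cmp_path_mor del: bilinear_ext_single)
  show "arrow_map R \<sigma> B Q \<rho> M i (tail R r) (Tri.ract {#i#} {#tail R r#} {#j#} b (arrow_cls R \<sigma> r))
    = clsA {#tail R r#} {#i#} (path_mor (tail R r) i
        (lift i (tail R r) (Tri.ract {#i#} {#tail R r#} {#j#} b (arrow_cls R \<sigma> r))))"
    using ract_arrow_closed[OF r i, of b] B_closed[OF i v(1) b] j
    by (intro arrow_map_eq[OF i v(2)]) simp
qed

lemma mu_left_mem:
  assumes "q \<in> arcs Q" "tail Q q = i" "j \<in> verts R" "b \<in> B i j"
  shows "({#j#}, {#head Q q#},
      clsA {#j#} {#head Q q#} (path_mor j (head Q q) (path_mult (single [Inl q] 1) (lift i j b)))
      \<ominus>\<^bsub>Hom E {#j#} {#head Q q#}\<^esub>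
      clsA {#j#} {#head Q q#} (path_mor j (head Q q)
        (lift (head Q q) j (Tri.lact {#j#} {#i#} {#head Q q#} (arrow_cls Q \<rho> q) b))))
    \<in> mu_relations R \<sigma> B Q \<rho> M"
  unfolding mu_left_eq[OF assms, symmetric] mu_relations_def Let_def augmented_cat_eq
  using assms Q.tail_in_verts[OF assms(1)] by blast

lemma mu_right_mem:
  assumes "r \<in> arcs R" "head R r = j" "i \<in> verts Q" "b \<in> B i j"
  shows "({#tail R r#}, {#i#},
      clsA {#tail R r#} {#i#} (path_mor (tail R r) i (path_mult (lift i j b) (single [Inl r] 1)))
      \<ominus>\<^bsub>Hom E {#tail R r#} {#i#}\<^esub>
      clsA {#tail R r#} {#i#} (path_mor (tail R r) i
        (lift i (tail R r) (Tri.ract {#i#} {#tail R r#} {#j#} b (arrow_cls R \<sigma> r)))))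
    \<in> mu_relations R \<sigma> B Q \<rho> M"
  unfolding mu_right_eq[OF assms, symmetric] mu_relations_def Let_def augmented_cat_eq
  using assms R.head_in_verts[OF assms(1)] by blast

text \<open>The converse of \<open>mu_left_mem\<close> and \<open>mu_right_mem\<close>: those put
  concrete differences into \<open>\<mu>\<close>, this one serves to show that every generator is
  killed.\<close>

lemma mu_relations_cases:
  assumes "(X, Y, z) \<in> mu_relations R \<sigma> B Q \<rho> M"
  obtains (left) i j b q where "q \<in> arcs Q" "tail Q q = i" "j \<in> verts R" "b \<in> B i j" "X = {#j#}" "Y = {#head Q q#}"
      "z = clsA {#j#} {#head Q q#} (path_mor j (head Q q) (path_mult (single [Inl q] 1) (lift i j b)))
      \<ominus>\<^bsub>Hom E {#j#} {#head Q q#}\<^esub>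
      clsA {#j#} {#head Q q#} (path_mor j (head Q q)
        (lift (head Q q) j (Tri.lact {#j#} {#i#} {#head Q q#} (arrow_cls Q \<rho> q) b)))"
  | (right) i j b r where "r \<in> arcs R" "head R r = j" "i \<in> verts Q" "b \<in> B i j" "X = {#tail R r#}" "Y = {#i#}"
      "z = clsA {#tail R r#} {#i#} (path_mor (tail R r) i (path_mult (lift i j b) (single [Inl r] 1)))
      \<ominus>\<^bsub>Hom E {#tail R r#} {#i#}\<^esub>
      clsA {#tail R r#} {#i#} (path_mor (tail R r) i
        (lift i (tail R r) (Tri.ract {#i#} {#tail R r#} {#j#} b (arrow_cls R \<sigma> r))))"
proof -
  from assms consider
    (1) i j b q where "i \<in> verts Q" "j \<in> verts R" "b \<in> B i j" "q \<in> arcs Q" "tail Q q = i" "X = {#j#}" "Y = {#head Q q#}"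
      "z = cmp E {#j#} {#i#} {#head Q q#} (aug_arrow_cls R \<sigma> B Q \<rho> (Inl q)) (aug_arrow_cls R \<sigma> B Q \<rho> (Inr (i, j, b)))
        \<ominus>\<^bsub>Hom E {#j#} {#head Q q#}\<^esub>
        arrow_map R \<sigma> B Q \<rho> M (head Q q) j (Tri.lact {#j#} {#i#} {#head Q q#} (arrow_cls Q \<rho> q) b)"
  | (2) i j b r where "i \<in> verts Q" "j \<in> verts R" "b \<in> B i j" "r \<in> arcs R" "head R r = j" "X = {#tail R r#}" "Y = {#i#}"
      "z = cmp E {#tail R r#} {#j#} {#i#} (aug_arrow_cls R \<sigma> B Q \<rho> (Inr (i, j, b))) (aug_arrow_cls R \<sigma> B Q \<rho> (Inl r))
        \<ominus>\<^bsub>Hom E {#tail R r#} {#i#}\<^esub>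
        arrow_map R \<sigma> B Q \<rho> M i (tail R r) (Tri.ract {#i#} {#tail R r#} {#j#} b (arrow_cls R \<sigma> r))"
    unfolding mu_relations_def Let_def augmented_cat_eq by blast
  then show ?thesis
  proof cases
    case (1 i j b q)
    note eq = mu_left_eq[OF 1(4,5,2,3)]
    show ?thesis by (rule left[OF 1(4,5,2,3,6,7)]) (simp only: 1(8) eq)
  next
    case (2 i j b r)
    note eq = mu_right_eq[OF 2(4,5,1,3)]
    show ?thesis by (rule right[OF 2(4,5,1,3,6,7)]) (simp only: 2(8) eq)
  qed
qed

section \<open>Rewriting paths modulo \<open>N\<close>\<close>

lemma mu_cls_eq:
  assumes "({#a#}, {#b#}, clsA {#a#} {#b#} (path_mor a b f) \<ominus>\<^bsub>Hom E {#a#} {#b#}\<^esub> clsA {#a#} {#b#} (path_mor a b g))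
      \<in> mu_relations R \<sigma> B Q \<rho> M"
    and ab: "a \<in> verts A" "b \<in> verts A"
    and f: "keys f \<subseteq> {p. A.awalk a p b}" and g: "keys g \<subseteq> {p. A.awalk a p b}"
  shows "clsN a b f = clsN a b g"
proof -
  have obj: "{#a#} \<in> objs PA" "{#b#} \<in> objs PA" using ab by (simp_all add: path_cat_simps(1))
  interpret P: vectorspace class_ring "Hom PA {#a#} {#b#}" by (rule path_cat_Hom_space)
  have E: "vectorspace class_ring (quotient_space (Hom PA {#a#} {#b#}) (IA {#a#} {#b#}))"
    using AI.quotient.Hom_space[of "{#a#}" "{#b#}"] obj by simp
  note closed = path_mor_closed(3)[OF f] path_mor_closed(3)[OF g]
  let ?d = "path_mor a b f \<ominus>\<^bsub>Hom PA {#a#} {#b#}\<^esub> path_mor a b g"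
  have d: "?d \<in> carrier (Hom PA {#a#} {#b#})" using closed by (rule P.minus_closed)
  have eq: "clsA {#a#} {#b#} (path_mor a b f) \<ominus>\<^bsub>Hom E {#a#} {#b#}\<^esub> clsA {#a#} {#b#} (path_mor a b g) = clsA {#a#} {#b#} ?d"
    using hom_minus[OF P.vectorspace_axioms E AI.cls_hom[OF obj] closed] by (simp add: clsA_def)
  have "clsA {#a#} {#b#} ?d \<in> J {#a#} {#b#}"
    unfolding J_def
  proof (rule generated_ideal_base)
    show "({#a#}, {#b#}, clsA {#a#} {#b#} ?d) \<in> mu_relations R \<sigma> B Q \<rho> M"
      using assms(1) unfolding eq .
    show "clsA {#a#} {#b#} ?d \<in> carrier (Hom E {#a#} {#b#})"
      using hom_closed[OF AI.cls_hom[OF obj] d] by (simp add: clsA_def)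
  qed
  with d have "?d \<in> N {#a#} {#b#}" by (simp add: N_def)
  then show ?thesis
    unfolding clsN_def using NI.cls_eq_iff[OF obj closed] by simp
qed

text \<open>The relations \<open>\<mu>\<close> give this for basis vectors, and both sides are
  linear in \<open>m\<close>. The extension to all vectors is indispensable for iterating, since an
  arrow sends a basis vector to an arbitrary one.\<close>

lemma clsN_arrow_mult_left:
  assumes q: "q \<in> arcs Q" and i: "tail Q q = i" and j: "j \<in> verts R" and m: "m \<in> carrier (on_obj M ({#i#}, {#j#}))"
  shows "clsN j (head Q q) (path_mult (single [Inl q] 1) (lift i j m))
    = clsN j (head Q q) (lift (head Q q) j (Tri.lact {#j#} {#i#} {#head Q q#} (arrow_cls Q \<rho> q) m))"
proof (rule hom_eq_M[OF _ j clsN_space _ _ _ m])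
  have v: "i \<in> verts Q" "head Q q \<in> verts Q" using q i by (auto simp: Q.wellformed)
  then show "i \<in> verts Q" by simp
  show vA: "j \<in> verts A" "head Q q \<in> verts A" using v j by (simp_all add: verts_A)
  have keys: "keys (single [Inl q] (1::'k)) \<subseteq> {p. A.awalk i p (head Q q)}"
    using arrow_keys(1)[OF q] i by simp
  show "(\<lambda>m. clsN j (head Q q) (path_mult (single [Inl q] 1) (lift i j m)))
      \<in> module_hom class_ring (on_obj M ({#i#}, {#j#})) (Hom (quotient_cat (path_cat A) N) {#j#} {#head Q q#})"
    by (rule hom_compose[OF lift_hom[OF v(1) j] hom_compose[OF A.path_mult_hom_right[OF keys] clsN_hom[OF vA]]])
  have act: "(\<lambda>m. Tri.lact {#j#} {#i#} {#head Q q#} (arrow_cls Q \<rho> q) m)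
      \<in> module_hom class_ring (on_obj M ({#i#}, {#j#})) (on_obj M ({#head Q q#}, {#j#}))"
    using Q.arrow_cls_closed[OF q] v j i by (intro Tri.lact_hom(1)) (simp_all add: vertex_simps)
  show "(\<lambda>m. clsN j (head Q q) (lift (head Q q) j (Tri.lact {#j#} {#i#} {#head Q q#} (arrow_cls Q \<rho> q) m)))
      \<in> module_hom class_ring (on_obj M ({#i#}, {#j#})) (Hom (quotient_cat (path_cat A) N) {#j#} {#head Q q#})"
    by (rule hom_compose[OF act hom_compose[OF lift_hom[OF v(2) j] clsN_hom[OF vA]]])
  show "clsN j (head Q q) (path_mult (single [Inl q] 1) (lift i j b))
    = clsN j (head Q q) (lift (head Q q) j (Tri.lact {#j#} {#i#} {#head Q q#} (arrow_cls Q \<rho> q) b))"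
    if b: "b \<in> B i j" for b
    by (rule mu_cls_eq[OF mu_left_mem[OF q i j b] vA A.path_mult_keys[OF lift_keys[OF v(1) j] keys] lift_keys[OF v(2) j]])
qed

lemma clsN_arrow_mult_right:
  assumes r: "r \<in> arcs R" and j: "head R r = j" and i: "i \<in> verts Q" and m: "m \<in> carrier (on_obj M ({#i#}, {#j#}))"
  shows "clsN (tail R r) i (path_mult (lift i j m) (single [Inl r] 1))
    = clsN (tail R r) i (lift i (tail R r) (Tri.ract {#i#} {#tail R r#} {#j#} m (arrow_cls R \<sigma> r)))"
proof (rule hom_eq_M[OF i _ clsN_space _ _ _ m])
  have v: "j \<in> verts R" "tail R r \<in> verts R" using r j by (auto simp: R.wellformed)
  then show "j \<in> verts R" by simp
  show vA: "tail R r \<in> verts A" "i \<in> verts A" using v i by (simp_all add: verts_A)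
  have keys: "keys (single [Inl r] (1::'k)) \<subseteq> {p. A.awalk (tail R r) p j}"
    using arrow_keys(2)[OF r] j by simp
  show "(\<lambda>m. clsN (tail R r) i (path_mult (lift i j m) (single [Inl r] 1)))
      \<in> module_hom class_ring (on_obj M ({#i#}, {#j#})) (Hom (quotient_cat (path_cat A) N) {#tail R r#} {#i#})"
    by (rule hom_compose[OF lift_hom[OF i v(1)] hom_compose[OF A.path_mult_hom_left[OF keys] clsN_hom[OF vA]]])
  have act: "(\<lambda>m. Tri.ract {#i#} {#tail R r#} {#j#} m (arrow_cls R \<sigma> r))
      \<in> module_hom class_ring (on_obj M ({#i#}, {#j#})) (on_obj M ({#i#}, {#tail R r#}))"
    using R.arrow_cls_closed[OF r] v i j by (intro Tri.ract_hom(1)) (simp_all add: vertex_simps)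
  show "(\<lambda>m. clsN (tail R r) i (lift i (tail R r) (Tri.ract {#i#} {#tail R r#} {#j#} m (arrow_cls R \<sigma> r))))
      \<in> module_hom class_ring (on_obj M ({#i#}, {#j#})) (Hom (quotient_cat (path_cat A) N) {#tail R r#} {#i#})"
    by (rule hom_compose[OF act hom_compose[OF lift_hom[OF i v(2)] clsN_hom[OF vA]]])
  show "clsN (tail R r) i (path_mult (lift i j b) (single [Inl r] 1))
    = clsN (tail R r) i (lift i (tail R r) (Tri.ract {#i#} {#tail R r#} {#j#} b (arrow_cls R \<sigma> r)))"
    if b: "b \<in> B i j" for b
    by (rule mu_cls_eq[OF mu_right_mem[OF r j i b] vA A.path_mult_keys[OF keys lift_keys[OF i v(1)]] lift_keys[OF i v(2)]])
qed

text \<open>The same vector \<open>m\<close> must describe both the image of \<open>h\<close> and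
  its class modulo \<open>N\<close>. This coupling turns reduction into a statement on the kernel:
  the image determines \<open>m\<close>, and \<open>m\<close> determines the class.\<close>

definition reducible :: "'v \<Rightarrow> 'v \<Rightarrow> (('v, 'e, 'x) aug_arrow list \<Rightarrow>\<^sub>0 'k) \<Rightarrow> bool" where
  "reducible a b h \<longleftrightarrow> keys h \<subseteq> {p. A.awalk a p b} \<and>
    (\<exists>m\<in>carrier (on_obj M ({#b#}, {#a#})). PF.lin a b h = mid b a m \<and> clsN a b h = clsN a b (lift b a m))"

lemma reducible_lift:
  "\<lbrakk>i \<in> verts Q; j \<in> verts R; m \<in> carrier (on_obj M ({#i#}, {#j#}))\<rbrakk> \<Longrightarrow> reducible j i (lift i j m)"
  unfolding reducible_def using lift_keys lin_lift by blast

lemma reducible_left: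
  assumes h: "reducible j (tail Q q) h" and q: "q \<in> arcs Q" and j: "j \<in> verts R"
  shows "reducible j (head Q q) (path_mult (single [Inl q] 1) h)"
proof -
  obtain m where keys: "keys h \<subseteq> {p. A.awalk j p (tail Q q)}"
    and m: "m \<in> carrier (on_obj M ({#tail Q q#}, {#j#}))"
    and lin: "PF.lin j (tail Q q) h = mid (tail Q q) j m" and clsN: "clsN j (tail Q q) h = clsN j (tail Q q) (lift (tail Q q) j m)"
    using h by (auto simp: reducible_def)
  let ?s = "single [Inl q] (1::'k)"
  have v: "tail Q q \<in> verts Q" "head Q q \<in> verts Q" using q by (auto simp: Q.wellformed)
  note vA = verts_A(1)[OF j] verts_A(2)[OF v(1)] verts_A(2)[OF v(2)]
  \<comment> \<open>Composition is well defined modulo \<open>N\<close>, so \<open>h\<close> may be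
    replaced by its lift before the rule for a single arrow is applied.\<close>
  have "clsN j (head Q q) (path_mult ?s h) = clsN j (head Q q) (path_mult ?s (lift (tail Q q) j m))"
    using cmp_clsN[OF vA keys arrow_keys(1)[OF q]] cmp_clsN[OF vA lift_keys[OF v(1) j] arrow_keys(1)[OF q]] clsN by metis
  then show ?thesis
    unfolding reducible_def
    using A.path_mult_keys[OF keys arrow_keys(1)[OF q]] lin_arrow_mult_left[OF q j m keys lin]
      lact_arrow_closed[OF q j m] clsN_arrow_mult_left[OF q refl j m] by auto
qed

lemma reducible_right:
  assumes h: "reducible (head R r) i h" and r: "r \<in> arcs R" and i: "i \<in> verts Q"
  shows "reducible (tail R r) i (path_mult h (single [Inl r] 1))"
proof -
  obtain m where keys: "keys h \<subseteq> {p. A.awalk (head R r) p i}"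
    and m: "m \<in> carrier (on_obj M ({#i#}, {#head R r#}))"
    and lin: "PF.lin (head R r) i h = mid i (head R r) m" and clsN: "clsN (head R r) i h = clsN (head R r) i (lift i (head R r) m)"
    using h by (auto simp: reducible_def)
  let ?s = "single [Inl r] (1::'k)"
  have v: "tail R r \<in> verts R" "head R r \<in> verts R" using r by (auto simp: R.wellformed)
  note vA = verts_A(1)[OF v(1)] verts_A(1)[OF v(2)] verts_A(2)[OF i]
  have "clsN (tail R r) i (path_mult h ?s) = clsN (tail R r) i (path_mult (lift i (head R r) m) ?s)"
    using cmp_clsN[OF vA arrow_keys(2)[OF r] keys] cmp_clsN[OF vA arrow_keys(2)[OF r] lift_keys[OF i v(2)]] clsN by metis
  then show ?thesis
    unfolding reducible_def
    using A.path_mult_keys[OF arrow_keys(2)[OF r] keys] lin_arrow_mult_right[OF r i m keys lin]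
      ract_arrow_closed[OF r i m] clsN_arrow_mult_right[OF r refl i m] by auto
qed

text \<open>The arrows of \<open>Q\<close> are absorbed in the order in which they follow the new
  arrow. The last arrow of the walk is absorbed last, which is why the induction runs from the end
  of the list.\<close>

lemma reducible_path_from_arrow:
  assumes "Q.awalk i p b" "i \<in> verts Q" "j \<in> verts R" "x \<in> B i j"
  shows "reducible j b (single (Inr (i, j, x) # map Inl p) 1)"
  using assms(1)
proof (induct p arbitrary: b rule: rev_induct)
  case Nil
  then have "b = i" by (simp add: Q.awalk_Nil_iff)
  then show ?case
    using reducible_lift[OF assms(2,3) B_closed[OF assms(2-4)]] by (simp add: lift_basis[OF assms(2-4)])
next
  case (snoc q p)
  then have q: "q \<in> arcs Q" "head Q q = b" and p: "Q.awalk i p (tail Q q)"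
    by (auto simp: Q.awalk_Cons_iff Q.awalk_Nil_iff)
  from reducible_left[OF snoc(1)[OF p] q(1) assms(3)] q(2) show ?case
    by simp
qed

text \<open>The arrows of \<open>R\<close> precede the new arrow and act from the right, the nearest
  one first. The first arrow of the walk is absorbed last, so ordinary induction on the list
  fits.\<close>

lemma reducible_path:
  assumes "R.awalk a p1 j" "Q.awalk i p b" "i \<in> verts Q" "j \<in> verts R" "x \<in> B i j"
  shows "reducible a b (single (map Inl p1 @ Inr (i, j, x) # map Inl p) 1)"
  using assms(1)
proof (induct p1 arbitrary: a)
  case Nil
  then show ?case
    using reducible_path_from_arrow[OF assms(2-5)] by (simp add: R.awalk_Nil_iff)
next
  case (Cons r p1)
  then have r: "r \<in> arcs R" "tail R r = a" and p1: "R.awalk (head R r) p1 j"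
    by (auto simp: R.awalk_Cons_iff)
  have "b \<in> verts Q" using assms(2) by (rule Q.awalk_last_in_verts)
  from reducible_right[OF Cons(1)[OF p1] r(1) this] r(2) show ?case
    by simp
qed

text \<open>Every path from \<open>R\<close> to \<open>Q\<close> passes through a new arrow, so
  single paths are covered. Witnesses may be scaled and added because the functor, the lift and the
  class are all linear.\<close>

lemma reducible_all:
  assumes a: "a \<in> verts R" and b: "b \<in> verts Q" and h: "keys h \<subseteq> {p. A.awalk a p b}"
  shows "reducible a b h"
  using h
proof (induct h rule: keys_induct)
  note vA = verts_A(1)[OF a] verts_A(2)[OF b]
  interpret V: vectorspace class_ring "on_obj M ({#b#}, {#a#})"
    using a b by (intro Tri.M_space) (simp_all add: vertex_simps)
  note hl = hom_compose[OF lift_hom[OF b a] clsN_hom[OF vA]]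
  {
    case zero
    show ?case using reducible_lift[OF b a V.zero_closed] by (simp add: lift_zero[OF b a])
  next
    case (single p c)
    then have "A.awalk a p b" by simp
    from walk_from_R[OF this a] have "reducible a b (single p 1)"
    proof (elim disjE exE conjE)
      fix p' assume "R.awalk a p' b"
      then have "b \<in> verts R" by (rule R.awalk_last_in_verts)
      with b show ?thesis using not_both by blast
    next
      fix p1 i j x p2
      assume "p = map Inl p1 @ Inr (i, j, x) # map Inl p2" "R.awalk a p1 j" "i \<in> verts Q" "j \<in> verts R"
        "x \<in> B i j" "Q.awalk i p2 b"
      then show ?thesis using reducible_path by simp
    qed
    then obtain m where m: "m \<in> carrier (on_obj M ({#b#}, {#a#}))"
      "PF.lin a b (single p 1) = mid b a m" "clsN a b (single p 1) = clsN a b (lift b a m)"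
      by (auto simp: reducible_def)
    have p1: "keys (single p (1::'k)) \<subseteq> {p. A.awalk a p b}" using single by simp
    have "single p c = scale c (single p 1)" by simp
    moreover have "PF.lin a b (scale c (single p 1)) = mid b a (c \<odot>\<^bsub>on_obj M ({#b#}, {#a#})\<^esub> m)"
      using PF.lin_scale[OF vA p1, of c] m(2) hom_smult[OF mid_hom[OF b a] m(1), of c] by simp
    moreover have "clsN a b (scale c (single p 1)) = clsN a b (lift b a (c \<odot>\<^bsub>on_obj M ({#b#}, {#a#})\<^esub> m))"
      using hom_smult[OF clsN_hom[OF vA], of "single p 1" c] p1 m(3) hom_smult[OF hl m(1), of c]
      by (simp add: free_space_def)
    moreover have "c \<odot>\<^bsub>on_obj M ({#b#}, {#a#})\<^esub> m \<in> carrier (on_obj M ({#b#}, {#a#}))"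
      using m(1) V.smult_closed[of c m] by simp
    ultimately show ?case
      unfolding reducible_def using keys_subset_scale[OF p1, of c] by metis
  next
    case (add h h')
    obtain m where m: "m \<in> carrier (on_obj M ({#b#}, {#a#}))"
      "PF.lin a b h = mid b a m" "clsN a b h = clsN a b (lift b a m)"
      using add(3) by (auto simp: reducible_def)
    obtain m' where m': "m' \<in> carrier (on_obj M ({#b#}, {#a#}))"
      "PF.lin a b h' = mid b a m'" "clsN a b h' = clsN a b (lift b a m')"
      using add(4) by (auto simp: reducible_def)
    have "PF.lin a b (h + h') = mid b a (m \<oplus>\<^bsub>on_obj M ({#b#}, {#a#})\<^esub> m')"
      using PF.lin_add[OF vA add(1,2)] m(2) m'(2) hom_add[OF mid_hom[OF b a] m(1) m'(1)] by simp
    moreover have "clsN a b (h + h') = clsN a b (lift b a (m \<oplus>\<^bsub>on_obj M ({#b#}, {#a#})\<^esub> m'))"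
      using hom_add[OF clsN_hom[OF vA], of h h'] add(1,2) m(3) m'(3) hom_add[OF hl m(1) m'(1)]
      by (simp add: free_space_def)
    moreover have "m \<oplus>\<^bsub>on_obj M ({#b#}, {#a#})\<^esub> m' \<in> carrier (on_obj M ({#b#}, {#a#}))"
      using m(1) m'(1) by simp
    ultimately show ?case
      unfolding reducible_def using keys_subset_add[OF add(1,2)] by blast
  }
qed

text \<open>Within one quiver the functor is the projection to its bound path category, whose kernel
  is its relation ideal. From \<open>Q\<close> to \<open>R\<close> there are no paths. From
  \<open>R\<close> to \<open>Q\<close> a combination is congruent to the lift of a vector
  \<open>m\<close> that is also the lower left entry of its image; a zero image gives
  \<open>m\<close> zero, and the class vanishes.\<close>

lemma kernel_vertices:
  assumes a: "a \<in> verts A" and b: "b \<in> verts A" and h: "keys h \<subseteq> {p. A.awalk a p b}"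
    and zero: "PF.lin a b h = \<zero>\<^bsub>Hom Tri.Tri (Tri.tri_ob {#a#}) (Tri.tri_ob {#b#})\<^esub>"
  shows "path_mor a b h \<in> N {#a#} {#b#}"
proof -
  consider "a \<in> verts R" "b \<in> verts R" | "a \<in> verts Q" "b \<in> verts Q"
    | "a \<in> verts Q" "b \<in> verts R" | "a \<in> verts R" "b \<in> verts Q"
    using a b by (auto simp: A_simps(1))
  then show ?thesis
  proof cases
    case 1
    obtain h' where h': "keys h' \<subseteq> {p. R.awalk a p b}" "h = linear_ext (map Inl) h'"
      using linear_ext_surj[of h "map Inl" "{p. R.awalk a p b}"] h walks_RR[OF 1] by auto
    have "R.bcls {#a#} {#b#} (path_mor a b h') = \<zero>\<^bsub>Hom T {#a#} {#b#}\<^esub>"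
      using zero lin_R[OF 1 h'(1)] 1 by (simp add: h'(2) vertex_simps Tri.Tri_simps(3))
    then have "path_mor a b h' \<in> relations_ideal R \<sigma> {#a#} {#b#}"
      using 1 h'(1) by (simp add: R.bcls_zero_iff)
    then show ?thesis unfolding h'(2) by (rule IR_subset_N)
  next
    case 2
    obtain h' where h': "keys h' \<subseteq> {p. Q.awalk a p b}" "h = linear_ext (map Inl) h'"
      using linear_ext_surj[of h "map Inl" "{p. Q.awalk a p b}"] h walks_QQ[OF 2(1), of b] by auto
    have "Q.bcls {#a#} {#b#} (path_mor a b h') = \<zero>\<^bsub>Hom U {#a#} {#b#}\<^esub>"
      using zero lin_Q[OF 2 h'(1)] 2 by (simp add: h'(2) vertex_simps Tri.Tri_simps(3))
    then have "path_mor a b h' \<in> relations_ideal Q \<rho> {#a#} {#b#}"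
      using 2 h'(1) by (simp add: Q.bcls_zero_iff)
    then show ?thesis unfolding h'(2) by (rule IQ_subset_N)
  next
    case 3
    then have "h = 0" using h walks_QR[OF 3] by simp
    then show ?thesis
      using clsN_eq_zero_iff[OF a b, of 0] hom_zero[OF free_space_vectorspace clsN_space[OF a b] clsN_hom[OF a b]]
      by (simp add: free_space_def)
  next
    case 4
    obtain m where m: "m \<in> carrier (on_obj M ({#b#}, {#a#}))" "PF.lin a b h = mid b a m"
      "clsN a b h = clsN a b (lift b a m)"
      using reducible_all[OF 4 h] by (auto simp: reducible_def)
    have "m = \<zero>\<^bsub>on_obj M ({#b#}, {#a#})\<^esub>"
      using m(2) zero 4 by (simp add: vertex_simps Tri.Tri_simps(3))
    then have "clsN a b h = clsN a b 0"
      using m(3) lift_zero[OF 4(2,1)] by simp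
    also have "\<dots> = \<zero>\<^bsub>Hom (quotient_cat (path_cat A) N) {#a#} {#b#}\<^esub>"
      using hom_zero[OF free_space_vectorspace clsN_space[OF a b] clsN_hom[OF a b]] by (simp add: free_space_def)
    finally show ?thesis
      using clsN_eq_zero_iff[OF a b h] by simp
  qed
qed

text \<open>For each position of the two vertices only one entry of the matrix lies in a space that
  can be nonzero; the other two are forced to vanish by the empty multiset. The remaining entry is
  hit by a combination of old paths or by a lift.\<close>

lemma surj_vertices:
  assumes a: "a \<in> verts A" and b: "b \<in> verts A"
    and k: "k \<in> carrier (Hom Tri.Tri (Tri.tri_ob {#a#}) (Tri.tri_ob {#b#}))"
  shows "\<exists>h. keys h \<subseteq> {p. A.awalk a p b} \<and> PF.lin a b h = k"
proof -
  obtain f m g where eq: "k = (f, m, g)" by (cases k)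
  consider "a \<in> verts R" "b \<in> verts R" | "a \<in> verts Q" "b \<in> verts Q"
    | "a \<in> verts Q" "b \<in> verts R" | "a \<in> verts R" "b \<in> verts Q"
    using a b by (auto simp: A_simps(1))
  then show ?thesis
  proof cases
    case 1
    then have c: "f \<in> carrier (Hom T {#a#} {#b#})" "m \<in> carrier (on_obj M ({#}, {#a#}))" "g \<in> carrier (Hom U {#} {#})"
      using k by (simp_all add: eq vertex_simps Tri.Tri_simps(2))
    obtain h where h: "keys h \<subseteq> {p. R.awalk a p b}" "f = R.bcls {#a#} {#b#} (path_mor a b h)"
      using R.bcls_surj[OF 1 c(1)] by blast
    have "PF.lin a b (linear_ext (map Inl) h) = k"
      using lin_R[OF 1 h(1)] Tri.M_empty[OF _ c(2)] Tri.BU.hom_to_empty[OF _ c(3)] 1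
      by (simp add: eq h(2) vertex_simps)
    then show ?thesis using keys_R[OF h(1)] by blast
  next
    case 2
    then have c: "f \<in> carrier (Hom T {#} {#})" "m \<in> carrier (on_obj M ({#b#}, {#}))" "g \<in> carrier (Hom U {#a#} {#b#})"
      using k by (simp_all add: eq vertex_simps Tri.Tri_simps(2))
    obtain h where h: "keys h \<subseteq> {p. Q.awalk a p b}" "g = Q.bcls {#a#} {#b#} (path_mor a b h)"
      using Q.bcls_surj[OF 2 c(3)] by blast
    have "PF.lin a b (linear_ext (map Inl) h) = k"
      using lin_Q[OF 2 h(1)] Tri.M_empty'[OF _ c(2)] Tri.BT.hom_to_empty[OF _ c(1)] 2
      by (simp add: eq h(2) vertex_simps)
    then show ?thesis using keys_Q[OF h(1)] by blast
  next
    case 3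
    then have c: "f \<in> carrier (Hom T {#} {#b#})" "m \<in> carrier (on_obj M ({#}, {#}))" "g \<in> carrier (Hom U {#a#} {#})"
      using k by (simp_all add: eq vertex_simps Tri.Tri_simps(2))
    have "PF.lin a b 0 = k"
      using PF.lin_zero[OF a b] Tri.M_empty[OF _ c(2)] Tri.BT.hom_from_empty[OF _ c(1)] Tri.BU.hom_to_empty[OF _ c(3)] 3
      by (simp add: eq vertex_simps Tri.Tri_simps(3))
    then show ?thesis by (intro exI[of _ 0]) simp
  next
    case 4
    then have c: "f \<in> carrier (Hom T {#a#} {#})" "m \<in> carrier (on_obj M ({#b#}, {#a#}))" "g \<in> carrier (Hom U {#} {#b#})"
      using k by (simp_all add: eq vertex_simps Tri.Tri_simps(2))
    have "PF.lin a b (lift b a m) = k"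
      using lin_lift[OF 4(2,1) c(2)] Tri.BT.hom_to_empty[OF _ c(1)] Tri.BU.hom_from_empty[OF _ c(3)] 4
      by (simp add: eq vertex_simps)
    then show ?thesis using lift_keys[OF 4(2,1), of m] by blast
  qed
qed

section \<open>Assembling the isomorphism\<close>

lemma Phi_mu:
  assumes F: "k_functor E Tri.Tri F" and obj: "on_obj F = Tri.tri_ob"
    and hom: "\<And>X Y f. \<lbrakk>X \<in> objs PA; Y \<in> objs PA; f \<in> carrier (Hom PA X Y)\<rbrakk>
      \<Longrightarrow> on_hom F X Y (clsA X Y f) = PF.Phi X Y f"
    and ab: "a \<in> verts A" "b \<in> verts A"
    and f: "keys f \<subseteq> {p. A.awalk a p b}" and g: "keys g \<subseteq> {p. A.awalk a p b}"
    and eq: "PF.lin a b f = PF.lin a b g"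
    and z: "z = clsA {#a#} {#b#} (path_mor a b f) \<ominus>\<^bsub>Hom E {#a#} {#b#}\<^esub> clsA {#a#} {#b#} (path_mor a b g)"
  shows "z \<in> carrier (Hom E {#a#} {#b#})"
    and "on_hom F {#a#} {#b#} z = \<zero>\<^bsub>Hom Tri.Tri (Tri.tri_ob {#a#}) (Tri.tri_ob {#b#})\<^esub>"
proof -
  interpret F: k_functor E Tri.Tri F by fact
  have objs: "{#a#} \<in> objs PA" "{#b#} \<in> objs PA" using ab by (simp_all add: path_cat_simps(1))
  have E: "vectorspace class_ring (Hom E {#a#} {#b#})"
    using objs by (intro AI.quotient.Hom_space) simp_all
  have Tri: "vectorspace class_ring (Hom Tri.Tri (Tri.tri_ob {#a#}) (Tri.tri_ob {#b#}))"
    using ab by (intro PF.Hom_space PF.vertex_closed)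
  interpret E: vectorspace class_ring "Hom E {#a#} {#b#}" by (rule E)
  interpret Tr: vectorspace class_ring "Hom Tri.Tri (Tri.tri_ob {#a#}) (Tri.tri_ob {#b#})" by (rule Tri)
  note c = path_mor_closed(3)[OF f] path_mor_closed(3)[OF g]
  have closed: "clsA {#a#} {#b#} (path_mor a b f) \<in> carrier (Hom E {#a#} {#b#})"
    "clsA {#a#} {#b#} (path_mor a b g) \<in> carrier (Hom E {#a#} {#b#})"
    using hom_closed[OF AI.cls_hom[OF objs] c(1)] hom_closed[OF AI.cls_hom[OF objs] c(2)] by (simp_all add: clsA_def)
  then show "z \<in> carrier (Hom E {#a#} {#b#})"
    unfolding z by (rule E.minus_closed)
  have lin: "on_hom F {#a#} {#b#} \<in> module_hom class_ring (Hom E {#a#} {#b#}) (Hom Tri.Tri (Tri.tri_ob {#a#}) (Tri.tri_ob {#b#}))"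
    using F.on_hom_linear[of "{#a#}" "{#b#}"] objs by (simp add: obj)
  have "on_hom F {#a#} {#b#} z = on_hom F {#a#} {#b#} (clsA {#a#} {#b#} (path_mor a b f))
      \<ominus>\<^bsub>Hom Tri.Tri (Tri.tri_ob {#a#}) (Tri.tri_ob {#b#})\<^esub> on_hom F {#a#} {#b#} (clsA {#a#} {#b#} (path_mor a b g))"
    unfolding z by (rule hom_minus[OF E Tri lin closed])
  also have "\<dots> = PF.lin a b g \<ominus>\<^bsub>Hom Tri.Tri (Tri.tri_ob {#a#}) (Tri.tri_ob {#b#})\<^esub> PF.lin a b g"
    unfolding hom[OF objs c(1)] hom[OF objs c(2)] PF.Phi_path_mor[OF ab f] PF.Phi_path_mor[OF ab g] eq ..
  also have "\<dots> = \<zero>\<^bsub>Hom Tri.Tri (Tri.tri_ob {#a#}) (Tri.tri_ob {#b#})\<^esub>"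
    unfolding a_minus_def using PF.lin_closed[OF ab g] by (rule Tr.r_neg)
  finally show "on_hom F {#a#} {#b#} z = \<zero>\<^bsub>Hom Tri.Tri (Tri.tri_ob {#a#}) (Tri.tri_ob {#b#})\<^esub>" .
qed

text \<open>Adding the two parts is inverse to splitting, because no vertex of \<open>Q\<close> is a
  vertex of \<open>R\<close>. The bijection on objects is what yields an isomorphism of categories
  and not merely an equivalence.\<close>

lemma tri_ob_bij: "bij_betw Tri.tri_ob (objs PA) (objs Tri.Tri)"
proof (rule bij_betwI[where g = "\<lambda>(t, u). t + u"])
  have obj: "(t, u) \<in> objs Tri.Tri \<longleftrightarrow> set_mset t \<subseteq> verts R \<and> set_mset u \<subseteq> verts Q" for t u
    unfolding Tri.Tri_simps(1) by (simp add: bound_cat_def path_cat_simps(1))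
  show "Tri.tri_ob \<in> objs PA \<rightarrow> objs Tri.Tri"
    using PF.ob_closed by (simp add: path_cat_simps(1))
  show "(\<lambda>(t, u). t + u) \<in> objs Tri.Tri \<rightarrow> objs PA"
    by (auto simp: obj path_cat_simps(1) A_simps(1))
  show "(\<lambda>(t, u). t + u) (Tri.tri_ob X) = X" for X
    by (simp add: Tri.tri_ob_def Tri.Tpart_def Tri.Upart_def)
  fix Y assume "Y \<in> objs Tri.Tri"
  then obtain t u where Y: "Y = (t, u)" and t: "set_mset t \<subseteq> verts R" and u: "set_mset u \<subseteq> verts Q"
    by (cases Y) (auto simp: obj)
  have "filter_mset (\<lambda>a. a \<in> verts R) t = filter_mset (\<lambda>_. True) t"
    "filter_mset (\<lambda>a. a \<notin> verts R) t = filter_mset (\<lambda>_. False) t"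
    by (rule filter_mset_cong0; use t in auto)+
  moreover have "filter_mset (\<lambda>a. a \<in> verts R) u = filter_mset (\<lambda>_. False) u"
    "filter_mset (\<lambda>a. a \<notin> verts R) u = filter_mset (\<lambda>_. True) u"
    by (rule filter_mset_cong0; use u not_both in auto)+
  ultimately show "Tri.tri_ob ((\<lambda>(t, u). t + u) Y) = Y"
    by (simp add: Y Tri.tri_ob_def Tri.Tpart_def Tri.Upart_def)
qed

lemma quotient_isomorphism: "\<exists>F. k_isomorphism Tri.Tri (augmented_quotient R \<sigma> B Q \<rho> M) F"
proof -
  interpret Phi: k_functor PA Tri.Tri "\<lparr>on_obj = Tri.tri_ob, on_hom = PF.Phi\<rparr>"
    by (rule PF.Phi_functor)
  have van: "on_hom \<lparr>on_obj = Tri.tri_ob, on_hom = PF.Phi\<rparr> X Y f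
      = \<zero>\<^bsub>Hom Tri.Tri (on_obj \<lparr>on_obj = Tri.tri_ob, on_hom = PF.Phi\<rparr> X) (on_obj \<lparr>on_obj = Tri.tri_ob, on_hom = PF.Phi\<rparr> Y)\<^esub>"
    if "X \<in> objs PA" "Y \<in> objs PA" "f \<in> IA X Y" for X Y f
    using Phi_IA[OF that(3)] by simp
  obtain F1 where F1: "k_functor E Tri.Tri F1"
    and F1_obj: "on_obj F1 = on_obj \<lparr>on_obj = Tri.tri_ob, on_hom = PF.Phi\<rparr>"
    and F1_cls: "\<forall>X\<in>objs PA. \<forall>Y\<in>objs PA. \<forall>f\<in>carrier (Hom PA X Y).
      on_hom F1 X Y (cls PA IA X Y f) = on_hom \<lparr>on_obj = Tri.tri_ob, on_hom = PF.Phi\<rparr> X Y f"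
    using Phi.factor_quotient[OF AI.ideal van] by blast
  have F1_obj: "on_obj F1 = Tri.tri_ob" using F1_obj by simp
  have F1_hom: "on_hom F1 X Y (clsA X Y f) = PF.Phi X Y f"
    if "X \<in> objs PA" "Y \<in> objs PA" "f \<in> carrier (Hom PA X Y)" for X Y f
    using F1_cls that by (simp add: clsA_def)
  interpret F1: k_functor E Tri.Tri F1 by (rule F1)
  have J_zero: "on_hom F1 X Y z = \<zero>\<^bsub>Hom Tri.Tri (on_obj F1 X) (on_obj F1 Y)\<^esub>" if "z \<in> J X Y" for X Y z
  proof -
    have "on_hom F1 X Y z \<in> {\<zero>\<^bsub>Hom Tri.Tri (on_obj F1 X) (on_obj F1 Y)\<^esub>}"
    proof (rule F1.generated_ideal_preimage[OF k_category.zero_ideal[OF Tri.Tri_category]])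
      show "z \<in> generated_ideal E (mu_relations R \<sigma> B Q \<rho> M) X Y"
        using that by (simp add: J_def)
      fix X Y z assume "(X, Y, z) \<in> mu_relations R \<sigma> B Q \<rho> M"
      then show "z \<in> carrier (Hom E X Y) \<and> on_hom F1 X Y z \<in> {\<zero>\<^bsub>Hom Tri.Tri (on_obj F1 X) (on_obj F1 Y)\<^esub>}"
      proof (cases rule: mu_relations_cases)
        case (left i j b q)
        have v: "i \<in> verts Q" "head Q q \<in> verts Q" using left(1,2) by (auto simp: Q.wellformed)
        have keys: "keys (single [Inl q] (1::'k)) \<subseteq> {p. A.awalk i p (head Q q)}"
          using arrow_keys(1)[OF left(1)] left(2) by simp
        have b: "b \<in> carrier (on_obj M ({#i#}, {#j#}))" using B_closed[OF v(1) left(3,4)] .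
        \<comment> \<open>Both combinations have the same image, the matrix whose lower left entry
          is q \<bullet> b.\<close>
        have "PF.lin j (head Q q) (path_mult (single [Inl q] 1) (lift i j b))
          = PF.lin j (head Q q) (lift (head Q q) j (Tri.lact {#j#} {#i#} {#head Q q#} (arrow_cls Q \<rho> q) b))"
          using lin_arrow_mult_left[OF left(1,3), of b "lift i j b"] lin_lift[OF v(1) left(3) b] lift_keys[OF v(1) left(3), of b]
            lin_lift[OF v(2) left(3) lact_arrow_closed[OF left(1,3), of b]] b left(2) by simp
        from Phi_mu[OF F1 F1_obj F1_hom verts_A(1)[OF left(3)] verts_A(2)[OF v(2)]
            A.path_mult_keys[OF lift_keys[OF v(1) left(3)] keys] lift_keys[OF v(2) left(3)] this left(7)]
        show ?thesis by (simp add: left(5,6) F1_obj)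
      next
        case (right i j b r)
        have v: "j \<in> verts R" "tail R r \<in> verts R" using right(1,2) by (auto simp: R.wellformed)
        have keys: "keys (single [Inl r] (1::'k)) \<subseteq> {p. A.awalk (tail R r) p j}"
          using arrow_keys(2)[OF right(1)] right(2) by simp
        have b: "b \<in> carrier (on_obj M ({#i#}, {#j#}))" using B_closed[OF right(3) v(1) right(4)] .
        have "PF.lin (tail R r) i (path_mult (lift i j b) (single [Inl r] 1))
          = PF.lin (tail R r) i (lift i (tail R r) (Tri.ract {#i#} {#tail R r#} {#j#} b (arrow_cls R \<sigma> r)))"
          using lin_arrow_mult_right[OF right(1,3), of b "lift i j b"] lin_lift[OF right(3) v(1) b] lift_keys[OF right(3) v(1), of b]
            lin_lift[OF right(3) v(2) ract_arrow_closed[OF right(1,3), of b]] b right(2) by simp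
        from Phi_mu[OF F1 F1_obj F1_hom verts_A(1)[OF v(2)] verts_A(2)[OF right(3)]
            A.path_mult_keys[OF keys lift_keys[OF right(3) v(1)]] lift_keys[OF right(3) v(2)] this right(7)]
        show ?thesis by (simp add: right(5,6) F1_obj)
      qed
    qed
    then show ?thesis by simp
  qed
  interpret EJ: k_category_ideal E J
    using J_ideal AI.quotient.k_category_axioms by (simp add: k_category_ideal_def k_category_ideal_axioms_def)
  obtain F2 where F2: "k_functor (quotient_cat E J) Tri.Tri F2" and F2_F1: "on_obj F2 = on_obj F1"
    and F2_cls: "\<forall>X\<in>objs E. \<forall>Y\<in>objs E. \<forall>f\<in>carrier (Hom E X Y).
      on_hom F2 X Y (cls E J X Y f) = on_hom F1 X Y f"
    using F1.factor_quotient[OF J_ideal J_zero] by blast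
  have F2_obj: "on_obj F2 = Tri.tri_ob" using F2_F1 F1_obj by simp
  interpret F2: k_functor "quotient_cat E J" Tri.Tri F2 by (rule F2)
  have E_eq: "carrier (Hom E X Y) = clsA X Y ` carrier (Hom PA X Y)" if "X \<in> objs PA" "Y \<in> objs PA" for X Y
    using AI.carrier_quotient_Hom[OF that] by (simp add: clsA_def)
  have F2_hom: "on_hom F2 X Y (cls E J X Y (clsA X Y f)) = PF.Phi X Y f"
    if "X \<in> objs PA" "Y \<in> objs PA" "f \<in> carrier (Hom PA X Y)" for X Y f
    using that by (simp add: F2_cls F1_hom E_eq del: quotient_cat_simps(2))
  have EJ_eq: "carrier (Hom (quotient_cat E J) X Y) = (\<lambda>f. cls E J X Y (clsA X Y f)) ` carrier (Hom PA X Y)"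
    if "X \<in> objs PA" "Y \<in> objs PA" for X Y
    using EJ.carrier_quotient_Hom[of X Y] that E_eq[OF that] by (simp add: image_image)
  have bij: "bij_betw (on_hom F2 X Y) (carrier (Hom (quotient_cat E J) X Y))
      (carrier (Hom Tri.Tri (on_obj F2 X) (on_obj F2 Y)))"
    if XY: "X \<in> objs (quotient_cat E J)" "Y \<in> objs (quotient_cat E J)" for X Y
  proof -
    have obj: "X \<in> objs PA" "Y \<in> objs PA" and set: "set_mset X \<subseteq> verts A" "set_mset Y \<subseteq> verts A"
      using XY by (simp_all add: path_cat_simps(1))
    interpret S: vectorspace class_ring "Hom (quotient_cat E J) X Y"
      using XY by (rule EJ.quotient.Hom_space)
    interpret D: vectorspace class_ring "Hom Tri.Tri (on_obj F2 X) (on_obj F2 Y)"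
      using XY by (intro PF.Hom_space F2.on_obj_closed)
    note lin = F2.on_hom_linear[OF XY]
    \<comment> \<open>A morphism of the iterated quotient comes from a matrix of paths. If its image
      is zero, that matrix lies in \<open>N\<close> by the analysis on vertices, which by definition
      of \<open>N\<close> means that its class in the first quotient lies in
      \<open>J\<close>.\<close>
    have kernel: "y = \<zero>\<^bsub>Hom (quotient_cat E J) X Y\<^esub>"
      if y: "y \<in> carrier (Hom (quotient_cat E J) X Y)" and zero: "on_hom F2 X Y y = \<zero>\<^bsub>Hom Tri.Tri (on_obj F2 X) (on_obj F2 Y)\<^esub>" for y
    proof -
      obtain f where f: "f \<in> carrier (Hom PA X Y)" "y = cls E J X Y (clsA X Y f)"
        using y unfolding EJ_eq[OF obj] by blast
      have "PF.Phi X Y f = \<zero>\<^bsub>Hom Tri.Tri (Tri.tri_ob X) (Tri.tri_ob Y)\<^esub>"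
        using zero F2_hom[OF obj f(1)] by (simp add: f(2) F2_obj)
      then have "f \<in> N X Y"
        by (rule PF.Phi_kernel[OF N_ideal _ set f(1), rotated -1]) (rule kernel_vertices)
      then have "clsA X Y f \<in> J X Y"
        by (simp add: N_def)
      moreover have "clsA X Y f \<in> carrier (Hom E X Y)"
        using f(1) unfolding E_eq[OF obj] by blast
      ultimately show ?thesis
        using EJ.cls_eq_zero_iff[of X Y "clsA X Y f"] obj by (simp add: f(2))
    qed
    have "inj_on (on_hom F2 X Y) (carrier (Hom (quotient_cat E J) X Y))"
    proof (rule inj_onI)
      fix y y' assume y: "y \<in> carrier (Hom (quotient_cat E J) X Y)" "y' \<in> carrier (Hom (quotient_cat E J) X Y)"
        and eq: "on_hom F2 X Y y = on_hom F2 X Y y'"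
      have "on_hom F2 X Y (y \<ominus>\<^bsub>Hom (quotient_cat E J) X Y\<^esub> y')
          = on_hom F2 X Y y' \<ominus>\<^bsub>Hom Tri.Tri (on_obj F2 X) (on_obj F2 Y)\<^esub> on_hom F2 X Y y'"
        using hom_minus[OF S.vectorspace_axioms D.vectorspace_axioms lin y] eq by simp
      also have "\<dots> = \<zero>\<^bsub>Hom Tri.Tri (on_obj F2 X) (on_obj F2 Y)\<^esub>"
        unfolding a_minus_def using hom_closed[OF lin y(2)] by (rule D.r_neg)
      finally have "y \<ominus>\<^bsub>Hom (quotient_cat E J) X Y\<^esub> y' = \<zero>\<^bsub>Hom (quotient_cat E J) X Y\<^esub>"
        by (intro kernel S.minus_closed y)
      then show "y = y'" using y by (rule S.minus_eq_zeroD)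
    qed
    moreover have "on_hom F2 X Y ` carrier (Hom (quotient_cat E J) X Y) = carrier (Hom Tri.Tri (on_obj F2 X) (on_obj F2 Y))"
    proof
      show "on_hom F2 X Y ` carrier (Hom (quotient_cat E J) X Y) \<subseteq> carrier (Hom Tri.Tri (on_obj F2 X) (on_obj F2 Y))"
        using hom_closed[OF lin] by blast
      show "carrier (Hom Tri.Tri (on_obj F2 X) (on_obj F2 Y)) \<subseteq> on_hom F2 X Y ` carrier (Hom (quotient_cat E J) X Y)"
      proof
        fix k assume "k \<in> carrier (Hom Tri.Tri (on_obj F2 X) (on_obj F2 Y))"
        then have "k \<in> carrier (Hom Tri.Tri (Tri.tri_ob X) (Tri.tri_ob Y))" by (simp only: F2_obj)
        then have "\<exists>f\<in>carrier (Hom PA X Y). PF.Phi X Y f = k"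
          by (rule PF.Phi_surj[OF _ set, rotated -1]) (rule surj_vertices)
        then obtain f where f: "f \<in> carrier (Hom PA X Y)" "PF.Phi X Y f = k" by blast
        then have "k = on_hom F2 X Y (cls E J X Y (clsA X Y f))"
          using F2_hom[OF obj f(1)] by simp
        moreover have "cls E J X Y (clsA X Y f) \<in> carrier (Hom (quotient_cat E J) X Y)"
          using f(1) unfolding EJ_eq[OF obj] by blast
        ultimately show "k \<in> on_hom F2 X Y ` carrier (Hom (quotient_cat E J) X Y)" by (rule image_eqI)
      qed
    qed
    ultimately show ?thesis by (rule bij_betw_imageI)
  qed
  \<comment> \<open>\<open>F2\<close> leads from the iterated quotient to the triangular category;
    the isomorphism asked for is its inverse.\<close>
  have "\<exists>G. k_isomorphism Tri.Tri (quotient_cat E J) G"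
    by (rule F2.inverse_isomorphism[OF _ bij]) (use tri_ob_bij F2_obj in simp_all)
  then show ?thesis
    by (simp add: augmented_quotient_def augmented_cat_eq J_def)
qed

end

theorem theorem2p8:
  fixes Q R :: "('v, 'e) pre_digraph"
    and \<rho> \<sigma> :: "('v, 'e, 'k::field) qrel set"
    and M :: "('v, 'e, 'x, 'k) quiver_bimod"
    and B :: "'v \<Rightarrow> 'v \<Rightarrow> 'x set"
  assumes "wf_digraph Q" and "wf_digraph R"
    and "strongly_locally_finite Q" and "strongly_locally_finite R"
    and "verts Q \<inter> verts R = {}" and "arcs Q \<inter> arcs R = {}"
    and "\<rho> \<subseteq> relations_on Q" and "\<sigma> \<subseteq> relations_on R"
    and "k_functor (tensor_cat (bound_cat Q \<rho>) (op_cat (bound_cat R \<sigma>))) fd_spaces M"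
    and "\<And>i j. i \<in> verts Q \<Longrightarrow> j \<in> verts R \<Longrightarrow>
           vectorspace.basis class_ring (on_obj M ({#i#}, {#j#})) (B i j)"
  shows "\<exists>F. k_isomorphism (triangular_cat (bound_cat R \<sigma>) (bound_cat Q \<rho>) M)
               (augmented_quotient R \<sigma> B Q \<rho> M) F"
proof -
  interpret augmented_quiver_data Q R \<rho> \<sigma> M B
    using assms by (intro augmented_quiver_data.intro)
  show ?thesis by (rule quotient_isomorphism)
qed

end
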